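(* Let $X$ be a Banach space, let $p\in[1,2]$, and let $Y=\ell_p$. Then the following are equivalent: (i) $X$ coarsely embeds into $Y$; (ii) $X$ uniformly embeds into $Y$; (iii) $X$ strongly embeds into $Y$; (iv) $X$ maps into $Y$ by a map which is coarse and solvent; (v) $X$ maps into $Y$ by a map which is uniformly continuous and almost uncollapsed.
   Context: All Banach spaces are over the reals. Let $f:(M,d)\to(N,\partial)$ be a map between metric spaces. For $t\ge0$ set $\omega_f(t)=\sup\{\partial(f(x),f(y)): d(x,y)\le t\}$, $\rho_f(t)=\inf\{\partial(f(x),f(y)): d(x,y)\ge t\}$ and $\overline{\rho}_f(t)=\inf\{\partial(f(x),f(y)): d(x,y)=t\}$ (with $\inf\emptyset=+\infty$). The map $f$ is a uniform embedding if it is injective and both $f$ and $f^{-1}$ (defined on the image) are uniformly continuous, i.e. $\lim_{t\to0^+}\omega_f(t)=0$ and $\rho_f(t)>0$ for all $t>0$. It is coarse if $\omega_f(t)<\infty$ for all $t\ge0$, expanding if $\lim_{t\to\infty}\rho_f(t)=\infty$, a coarse embedding if it is both coarse and expanding, and a strong embedding if it is both a uniform and a coarse embedding. It is solvent if for each $n\in\mathbb{N}$ there is $R>0$ such that for all $x,y\in M$, $d(x,y)\in[R,R+n]$ implies $\partial(f(x),f(y))>n$; and almost uncollapsed if $\overline{\rho}_f(t)>0$ for some $t>0$. $X$ coarsely (uniformly, strongly) embeds into $Y$ if there is a coarse (uniform, strong) embedding $X\to Y$. *)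

theory Defs
  imports "HOL-Analysis.Analysis"
begin

text \<open>Moduli take values in \<open>[0, \<infinity>]\<close>; in \<^typ>\<open>ennreal\<close> the infimum of the empty set is
  \<open>\<infinity>\<close> and the supremum of the empty set is 0.\<close>

definition expansion_modulus ::
    "'a metric \<Rightarrow> 'b metric \<Rightarrow> ('a \<Rightarrow> 'b) \<Rightarrow> real \<Rightarrow> ennreal"  (* omega *)
  where "expansion_modulus m1 m2 f t =
    Sup {ennreal (mdist m2 (f x) (f y)) | x y. x \<in> mspace m1 \<and> y \<in> mspace m1 \<and> mdist m1 x y \<le> t}"

definition compression_modulus ::
    "'a metric \<Rightarrow> 'b metric \<Rightarrow> ('a \<Rightarrow> 'b) \<Rightarrow> real \<Rightarrow> ennreal"  (* rho *)
  where "compression_modulus m1 m2 f t =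
    Inf {ennreal (mdist m2 (f x) (f y)) | x y. x \<in> mspace m1 \<and> y \<in> mspace m1 \<and> t \<le> mdist m1 x y}"

definition exact_compression_modulus ::
    "'a metric \<Rightarrow> 'b metric \<Rightarrow> ('a \<Rightarrow> 'b) \<Rightarrow> real \<Rightarrow> ennreal"  (* rho bar *)
  where "exact_compression_modulus m1 m2 f t =
    Inf {ennreal (mdist m2 (f x) (f y)) | x y. x \<in> mspace m1 \<and> y \<in> mspace m1 \<and> mdist m1 x y = t}"

definition uniform_embedding :: "'a metric \<Rightarrow> 'b metric \<Rightarrow> ('a \<Rightarrow> 'b) \<Rightarrow> bool"
  where "uniform_embedding m1 m2 f \<longleftrightarrow>
    inj_on f (mspace m1) \<and>
    uniformly_continuous_map m1 m2 f \<and>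
    uniformly_continuous_map (submetric m2 (f ` mspace m1)) m1 (inv_into (mspace m1) f)"

definition coarse_map :: "'a metric \<Rightarrow> 'b metric \<Rightarrow> ('a \<Rightarrow> 'b) \<Rightarrow> bool"
  where "coarse_map m1 m2 f \<longleftrightarrow>
    f \<in> mspace m1 \<rightarrow> mspace m2 \<and> (\<forall>t\<ge>0. expansion_modulus m1 m2 f t < \<infinity>)"

definition expanding_map :: "'a metric \<Rightarrow> 'b metric \<Rightarrow> ('a \<Rightarrow> 'b) \<Rightarrow> bool"
  where "expanding_map m1 m2 f \<longleftrightarrow>
    f \<in> mspace m1 \<rightarrow> mspace m2 \<and> (compression_modulus m1 m2 f \<longlongrightarrow> \<infinity>) at_top"

definition coarse_embedding :: "'a metric \<Rightarrow> 'b metric \<Rightarrow> ('a \<Rightarrow> 'b) \<Rightarrow> bool"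
  where "coarse_embedding m1 m2 f \<longleftrightarrow> coarse_map m1 m2 f \<and> expanding_map m1 m2 f"

definition strong_embedding :: "'a metric \<Rightarrow> 'b metric \<Rightarrow> ('a \<Rightarrow> 'b) \<Rightarrow> bool"
  where "strong_embedding m1 m2 f \<longleftrightarrow> uniform_embedding m1 m2 f \<and> coarse_embedding m1 m2 f"

definition solvent_map :: "'a metric \<Rightarrow> 'b metric \<Rightarrow> ('a \<Rightarrow> 'b) \<Rightarrow> bool"
  where "solvent_map m1 m2 f \<longleftrightarrow>
    f \<in> mspace m1 \<rightarrow> mspace m2 \<and>
    (\<forall>n::nat. \<exists>R>0. \<forall>x\<in>mspace m1. \<forall>y\<in>mspace m1.
       mdist m1 x y \<in> {R..R + real n} \<longrightarrow> mdist m2 (f x) (f y) > real n)"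

definition almost_uncollapsed :: "'a metric \<Rightarrow> 'b metric \<Rightarrow> ('a \<Rightarrow> 'b) \<Rightarrow> bool"
  where "almost_uncollapsed m1 m2 f \<longleftrightarrow>
    f \<in> mspace m1 \<rightarrow> mspace m2 \<and> (\<exists>t>0. exact_compression_modulus m1 m2 f t > 0)"

definition coarsely_embeds :: "'a metric \<Rightarrow> 'b metric \<Rightarrow> bool"
  where "coarsely_embeds m1 m2 \<longleftrightarrow> (\<exists>f. coarse_embedding m1 m2 f)"

definition uniformly_embeds :: "'a metric \<Rightarrow> 'b metric \<Rightarrow> bool"
  where "uniformly_embeds m1 m2 \<longleftrightarrow> (\<exists>f. uniform_embedding m1 m2 f)"

definition strongly_embeds :: "'a metric \<Rightarrow> 'b metric \<Rightarrow> bool"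
  where "strongly_embeds m1 m2 \<longleftrightarrow> (\<exists>f. strong_embedding m1 m2 f)"

text \<open>Uniform continuity and uniform embeddings in terms of the moduli.\<close>

lemma ennreal_real_between:
  fixes a :: ennreal
  assumes "0 < a"
  obtains e where "0 < e" "ennreal e < a"
proof -
  obtain c where c: "0 < c" "c < a" using dense[OF assms] by blast
  then obtain r where "0 \<le> r" "c = ennreal r" by (cases c) auto
  with c that[of r] show ?thesis by simp
qed

lemma uniformly_continuous_map_iff_modulus:
  "uniformly_continuous_map m1 m2 f \<longleftrightarrow>
    f \<in> mspace m1 \<rightarrow> mspace m2 \<and> (expansion_modulus m1 m2 f \<longlongrightarrow> 0) (at_right 0)"
proof (cases "f \<in> mspace m1 \<rightarrow> mspace m2")
  case True
  have "(expansion_modulus m1 m2 f \<longlongrightarrow> 0) (at_right 0)" if uc: "uniformly_continuous_map m1 m2 f"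
  proof (rule order_tendstoI)
    fix a :: ennreal assume "0 < a"
    then obtain e where e: "0 < e" "ennreal e < a" by (rule ennreal_real_between)
    obtain d where d: "d > 0" "\<And>x y. \<lbrakk>x \<in> mspace m1; y \<in> mspace m1; mdist m1 y x < d\<rbrakk>
        \<Longrightarrow> mdist m2 (f y) (f x) < e"
      using uc e unfolding uniformly_continuous_map_def by meson
    have "expansion_modulus m1 m2 f t < a" if t: "t < d" for t
    proof -
      have "expansion_modulus m1 m2 f t \<le> ennreal e"
        unfolding expansion_modulus_def
      proof (rule Sup_least, clarify)
        fix x y assume "x \<in> mspace m1" "y \<in> mspace m1" "mdist m1 x y \<le> t"
        then show "ennreal (mdist m2 (f x) (f y)) \<le> ennreal e"
          using d(2)[of y x] t by (intro ennreal_leI) simp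
      qed
      then show ?thesis using e by simp
    qed
    then show "\<forall>\<^sub>F t in at_right 0. expansion_modulus m1 m2 f t < a"
      using d(1) by (auto simp: eventually_at_right_field)
  qed simp
  moreover have "uniformly_continuous_map m1 m2 f"
    if lim: "(expansion_modulus m1 m2 f \<longlongrightarrow> 0) (at_right 0)"
    unfolding uniformly_continuous_map_def
  proof (intro conjI allI impI)
    show "f \<in> mspace m1 \<rightarrow> mspace m2" by (rule True)
    fix e :: real assume "e > 0"
    then have "\<forall>\<^sub>F t in at_right 0. expansion_modulus m1 m2 f t < ennreal e"
      using lim by (intro order_tendstoD) auto
    then obtain b where b: "b > 0" "\<And>t. 0 < t \<Longrightarrow> t < b \<Longrightarrow> expansion_modulus m1 m2 f t < ennreal e"
      by (auto simp: eventually_at_right_field)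
    have "mdist m2 (f y) (f x) < e"
      if "x \<in> mspace m1" "y \<in> mspace m1" "mdist m1 y x < b/2" for x y
    proof -
      have "ennreal (mdist m2 (f y) (f x)) \<le> expansion_modulus m1 m2 f (b/2)"
        unfolding expansion_modulus_def using that by (intro Sup_upper) force
      also have "\<dots> < ennreal e" using b by simp
      finally show ?thesis by (simp add: ennreal_less_iff)
    qed
    then show "\<exists>\<delta>>0. \<forall>x\<in>mspace m1. \<forall>y\<in>mspace m1. mdist m1 y x < \<delta> \<longrightarrow> mdist m2 (f y) (f x) < e"
      using b(1) by (intro exI[of _ "b/2"]) auto
  qed
  ultimately show ?thesis using True by blast
qed (auto simp: uniformly_continuous_map_def)

lemma uniform_embedding_iff_moduli:
  "uniform_embedding m1 m2 f \<longleftrightarrow>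
    f \<in> mspace m1 \<rightarrow> mspace m2 \<and> inj_on f (mspace m1) \<and>
    (expansion_modulus m1 m2 f \<longlongrightarrow> 0) (at_right 0) \<and>
    (\<forall>t>0. compression_modulus m1 m2 f t > 0)"
proof (cases "f \<in> mspace m1 \<rightarrow> mspace m2 \<and> inj_on f (mspace m1)")
  case True
  let ?M = "mspace m1"
  let ?P = "\<forall>e>0. \<exists>d>0. \<forall>x\<in>?M. \<forall>y\<in>?M. mdist m2 (f y) (f x) < d \<longrightarrow> mdist m1 y x < e"
  have inv: "f ` ?M \<inter> mspace m2 = f ` ?M" "\<And>x. x \<in> ?M \<Longrightarrow> inv_into ?M f (f x) = x"
    using True by auto
  have 1: "uniformly_continuous_map (submetric m2 (f ` ?M)) m1 (inv_into ?M f) \<longleftrightarrow> ?P"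
    unfolding uniformly_continuous_map_def using inv by (simp add: Pi_iff)
  have "?P \<longleftrightarrow> (\<forall>t>0. compression_modulus m1 m2 f t > 0)"
  proof (intro iffI allI impI)
    fix t :: real assume P: ?P and "t > 0"
    then obtain d where d: "d > 0" "\<And>x y. \<lbrakk>x \<in> ?M; y \<in> ?M; mdist m2 (f y) (f x) < d\<rbrakk> \<Longrightarrow> mdist m1 y x < t"
      by meson
    have "ennreal d \<le> compression_modulus m1 m2 f t"
      unfolding compression_modulus_def
    proof (rule Inf_greatest, clarify)
      fix x y assume "x \<in> ?M" "y \<in> ?M" "t \<le> mdist m1 x y"
      then show "ennreal d \<le> ennreal (mdist m2 (f x) (f y))"
        using d(2)[of y x] by (intro ennreal_leI) force
    qed
    with d(1) show "compression_modulus m1 m2 f t > 0"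
      by (meson ennreal_less_zero_iff less_le_trans)
  next
    fix e :: real assume R: "\<forall>t>0. compression_modulus m1 m2 f t > 0" and "e > 0"
    then have "0 < compression_modulus m1 m2 f e" by blast
    then obtain d where d: "0 < d" "ennreal d < compression_modulus m1 m2 f e" by (rule ennreal_real_between)
    have "mdist m1 y x < e" if "x \<in> ?M" "y \<in> ?M" "mdist m2 (f y) (f x) < d" for x y
    proof (rule ccontr)
      assume "\<not> mdist m1 y x < e"
      then have "compression_modulus m1 m2 f e \<le> ennreal (mdist m2 (f y) (f x))"
        unfolding compression_modulus_def using that by (intro Inf_lower) force
      also have "\<dots> \<le> ennreal d" using that by (intro ennreal_leI) simp
      finally show False using d by simp
    qed
    with d(1) show "\<exists>d>0. \<forall>x\<in>?M. \<forall>y\<in>?M. mdist m2 (f y) (f x) < d \<longrightarrow> mdist m1 y x < e" by blast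
  qed
  with 1 True show ?thesis
    by (simp add: uniform_embedding_def uniformly_continuous_map_iff_modulus)
qed (auto simp: uniform_embedding_def uniformly_continuous_map_def)

text \<open>The real sequence space \<open>\<ell>\<^sub>p\<close> for \<open>1 \<le> p < \<infinity>\<close>, with its norm metric.\<close>

definition lp_carrier :: "real \<Rightarrow> (nat \<Rightarrow> real) set"
  where "lp_carrier p = {x. summable (\<lambda>n. \<bar>x n\<bar> powr p)}"

definition lp_norm :: "real \<Rightarrow> (nat \<Rightarrow> real) \<Rightarrow> real"
  where "lp_norm p x = (\<Sum>n. \<bar>x n\<bar> powr p) powr (1 / p)"

definition lp_metric :: "real \<Rightarrow> (nat \<Rightarrow> real) metric"
  where "lp_metric p = metric (lp_carrier p, \<lambda>x y. lp_norm p (\<lambda>n. x n - y n))"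

lemma powr_convex_combination:
  fixes u v s p :: real
  assumes "p \<ge> 1" "u \<ge> 0" "v \<ge> 0" "0 \<le> s" "s \<le> 1"
  shows "((1 - s) * u + s * v) powr p \<le> (1 - s) * u powr p + s * v powr p"
proof -
  have scale: "(r * w) powr p \<le> r * w powr p" if "0 \<le> r" "r \<le> 1" "0 \<le> w" for r w :: real
  proof -
    have "r powr p \<le> r"
      using powr_mono'[of 1 p r] that assms(1) by auto
    then show ?thesis using that by (simp add: powr_mult mult_right_mono)
  qed
  consider "u = 0" | "v = 0" | "u > 0" "v > 0" using assms by force
  then show ?thesis
  proof cases
    case 1 then show ?thesis using scale[of s v] assms by simp
  next
    case 2 then show ?thesis using scale[of "1 - s" u] assms by simp
  next
    case 3 then show ?thesis
      using convex_onD[OF powr_convex[OF assms(1)], of s u v] assms by simp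
  qed
qed

lemma lp_norm_nonneg: "lp_norm p x \<ge> 0"
  by (simp add: lp_norm_def)

lemma lp_norm_powr:
  assumes "p \<ge> 1" "x \<in> lp_carrier p"
  shows "lp_norm p x powr p = (\<Sum>n. \<bar>x n\<bar> powr p)"
  using assms by (simp add: lp_norm_def lp_carrier_def powr_powr suminf_nonneg)

lemma lp_norm_eq_0_iff:
  assumes "p \<ge> 1" "x \<in> lp_carrier p"
  shows "lp_norm p x = 0 \<longleftrightarrow> x = (\<lambda>n. 0)"
proof -
  have "lp_norm p x = 0 \<longleftrightarrow> (\<Sum>n. \<bar>x n\<bar> powr p) = 0"
    by (simp add: lp_norm_def)
  also have "\<dots> \<longleftrightarrow> (\<forall>n. \<bar>x n\<bar> powr p = 0)"
    using assms by (intro suminf_eq_zero_iff) (auto simp: lp_carrier_def)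
  finally show ?thesis by (auto simp: fun_eq_iff)
qed

lemma lp_Minkowski:
  assumes p: "p \<ge> 1" and x: "x \<in> lp_carrier p" and y: "y \<in> lp_carrier p"
  shows "(\<lambda>n. x n + y n) \<in> lp_carrier p"
    and "lp_norm p (\<lambda>n. x n + y n) \<le> lp_norm p x + lp_norm p y"
proof -
  define a b where "a = lp_norm p x" and "b = lp_norm p y"
  have "(\<lambda>n. x n + y n) \<in> lp_carrier p \<and> lp_norm p (\<lambda>n. x n + y n) \<le> a + b"
  proof (cases "a = 0 \<or> b = 0")
    case True
    then show ?thesis
      using lp_norm_eq_0_iff[OF p x] lp_norm_eq_0_iff[OF p y] x y
      by (auto simp: a_def b_def lp_norm_nonneg)
  next
    case False
    then have ab: "a > 0" "b > 0"
      using lp_norm_nonneg[of p x] lp_norm_nonneg[of p y] by (auto simp: a_def b_def)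
    define s where "s = b / (a + b)"
    have s: "0 \<le> s" "s \<le> 1" using ab by (auto simp: s_def)
    let ?B = "\<lambda>n. (1 - s) * (\<bar>x n\<bar> powr p / a powr p) + s * (\<bar>y n\<bar> powr p / b powr p)"
    have sx: "(\<lambda>n. \<bar>x n\<bar> powr p) sums (a powr p)"
      using x lp_norm_powr[OF p x] by (simp add: a_def lp_carrier_def summable_sums)
    have sy: "(\<lambda>n. \<bar>y n\<bar> powr p) sums (b powr p)"
      using y lp_norm_powr[OF p y] by (simp add: b_def lp_carrier_def summable_sums)
    have "?B sums ((1 - s) * (a powr p / a powr p) + s * (b powr p / b powr p))"
      by (intro sums_add sums_mult sums_divide sx sy)
    then have B: "?B sums 1" using ab by simp
    have le: "(\<bar>x n + y n\<bar> / (a + b)) powr p \<le> ?B n" for n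
    proof -
      have c: "(1 - s) * (\<bar>x n\<bar> / a) + s * (\<bar>y n\<bar> / b) = (\<bar>x n\<bar> + \<bar>y n\<bar>) / (a + b)"
      proof -
        have "1 - s = a / (a + b)" using ab by (simp add: s_def field_simps)
        then show ?thesis using ab by (simp add: s_def add_divide_distrib)
      qed
      have "(\<bar>x n + y n\<bar> / (a + b)) powr p \<le> ((1 - s) * (\<bar>x n\<bar> / a) + s * (\<bar>y n\<bar> / b)) powr p"
        unfolding c using ab p by (intro powr_mono2 divide_right_mono) auto
      also have "\<dots> \<le> (1 - s) * (\<bar>x n\<bar> / a) powr p + s * (\<bar>y n\<bar> / b) powr p"
        using ab p s by (intro powr_convex_combination) auto
      finally show ?thesis using ab by (simp add: powr_divide)
    qed
    have summ: "summable (\<lambda>n. (\<bar>x n + y n\<bar> / (a + b)) powr p)"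
      by (rule summable_comparison_test'[OF sums_summable[OF B], of 0]) (use le in auto)
    have eq: "\<bar>x n + y n\<bar> powr p = (a + b) powr p * (\<bar>x n + y n\<bar> / (a + b)) powr p" for n
      using ab by (simp add: powr_divide)
    have mem: "(\<lambda>n. x n + y n) \<in> lp_carrier p"
      unfolding lp_carrier_def mem_Collect_eq eq by (intro summable_mult summ)
    have "(\<Sum>n. (\<bar>x n + y n\<bar> / (a + b)) powr p) \<le> 1"
      using suminf_le[OF le summ sums_summable[OF B]] sums_unique[OF B] by simp
    then have "(\<Sum>n. \<bar>x n + y n\<bar> powr p) \<le> (a + b) powr p"
      unfolding eq suminf_mult[OF summ] by (simp add: mult_left_le)
    then have "lp_norm p (\<lambda>n. x n + y n) \<le> ((a + b) powr p) powr (1 / p)"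
      unfolding lp_norm_def using mem p
      by (intro powr_mono2 suminf_nonneg) (auto simp: lp_carrier_def)
    also have "\<dots> = a + b" using ab p by (simp add: powr_powr)
    finally show ?thesis using mem by simp
  qed
  then show "(\<lambda>n. x n + y n) \<in> lp_carrier p"
    and "lp_norm p (\<lambda>n. x n + y n) \<le> lp_norm p x + lp_norm p y"
    by (auto simp: a_def b_def)
qed

lemma lp_diff_mem:
  assumes "p \<ge> 1" "x \<in> lp_carrier p" "y \<in> lp_carrier p"
  shows "(\<lambda>n. x n - y n) \<in> lp_carrier p"
  using lp_Minkowski(1)[OF assms(1,2), of "\<lambda>n. - y n"] assms(3) by (simp add: lp_carrier_def)

lemma Metric_space_lp:
  assumes "p \<ge> 1"
  shows "Metric_space (lp_carrier p) (\<lambda>x y. lp_norm p (\<lambda>n. x n - y n))"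
proof
  fix x y z
  show "lp_norm p (\<lambda>n. x n - y n) \<ge> 0" by (rule lp_norm_nonneg)
  show "lp_norm p (\<lambda>n. x n - y n) = lp_norm p (\<lambda>n. y n - x n)"
    by (simp add: lp_norm_def abs_minus_commute)
  assume x: "x \<in> lp_carrier p" and y: "y \<in> lp_carrier p"
  show "lp_norm p (\<lambda>n. x n - y n) = 0 \<longleftrightarrow> x = y"
    using lp_norm_eq_0_iff[OF assms lp_diff_mem[OF assms x y]] by (auto simp: fun_eq_iff)
  assume z: "z \<in> lp_carrier p"
  show "lp_norm p (\<lambda>n. x n - z n) \<le> lp_norm p (\<lambda>n. x n - y n) + lp_norm p (\<lambda>n. y n - z n)"
    using lp_Minkowski(2)[OF assms lp_diff_mem[OF assms x y] lp_diff_mem[OF assms y z]] by simp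
qed

lemma mspace_lp_metric [simp]: "p \<ge> 1 \<Longrightarrow> mspace (lp_metric p) = lp_carrier p"
  by (simp add: lp_metric_def Metric_space.mspace_metric[OF Metric_space_lp])

lemma mdist_lp_metric [simp]:
  "p \<ge> 1 \<Longrightarrow> mdist (lp_metric p) x y = lp_norm p (\<lambda>n. x n - y n)"
  by (simp add: lp_metric_def Metric_space.mdist_metric[OF Metric_space_lp])

end

theory Submission
  imports Defs
begin

text \<open>Strong embeddings are at once coarse and uniform, coarse embeddings are solvent, and uniform
embeddings are almost uncollapsed. What has to be shown is that a single map that is coarse and
solvent, or uniformly continuous and almost uncollapsed, already produces a strong embedding. Maps
into Hilbert space are handled throughout by their squared distances: a kernel is of negative type
exactly if it has the form \<open>|b x - b y|\<^sup>2\<close> for some Hilbert space valued \<open>b\<close>. This turns every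
construction into a statement about convex and pointwise closed sets of real functions of two
variables, to which compactness of products applies.

\<^bold>\<open>From the given map to a kernel.\<close> For \<open>1 \<le> p \<le> 2\<close> the \<open>p\<close>-th power of the distance
of \<open>\<ell>\<^sub>p\<close> is of negative type (\<open>negtype_on_lp\<close>), because \<open>|u|\<^sup>p\<close> is a mixture of the functions
\<open>1 - cos (s u)\<close>. Pulling it back along the map and applying Schoenberg's theorem gives a bounded kernel
\<open>Q\<close> of negative type on \<open>X\<close> that stays away from 0 at some distance \<open>t\<close>. If the map is uniformly
continuous, then \<open>Q x y\<close> tends to 0 with the distance of \<open>x\<close> and \<open>y\<close>. A coarse map need not be
continuous; here \<open>Q\<close> is kept only on 1-separated finite sets, where it is bounded by a small multiple of
the distance, and extended from there. That bound survives the extension since a 1/2-Hoelder map from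
any subset of a metric space into Hilbert space extends with the same constant
(\<open>negtype_extend_point\<close>). This yields \<open>negtype_smoothing\<close>, and the long intervals of distances
in the definition of solvency leave room for moving points into the separated set.

\<^bold>\<open>Invariance and growth.\<close> The group \<open>X\<close> is abelian, so the Markov-Kakutani argument makes the
kernel translation invariant without losing its bounds (\<open>invariant_kernel\<close>): there is a function
\<open>q\<close> on \<open>X\<close> with \<open>q (x - y)\<close> of negative type, continuous at 0, and bounded below on one sphere.
If \<open>q\<close> were small at many points of a long segment, it would be small at two of them whose difference has
a prescribed small length; so the mean of \<open>q\<close> over the segment from 0 to \<open>x\<close> is bounded below, uniformly
for \<open>x\<close> outside any ball around 0 (\<open>ray_avg_lower\<close>).

\<^bold>\<open>Back to sequences.\<close> Let \<open>a\<close> denote this mean. By Schoenberg, \<open>exp (- a (l (x - y)))\<close> is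
the inner product of unit vectors attached to \<open>x\<close> and \<open>y\<close>. They can be taken in \<open>\<ell>\<^sub>2\<close> because \<open>X\<close> is
separable: a non-separable space has, inside every uncountable subset of a suitable set, pairs of points
at nearly the distance \<open>t\<close>, whereas the map into \<open>\<ell>\<^sub>p\<close> brings uncountably many points close together
(\<open>separable_of_uncollapsed\<close>). The Mazur map carries the unit sphere of \<open>\<ell>\<^sub>2\<close> uniformly
homeomorphically onto that of \<open>\<ell>\<^sub>p\<close>. The \<open>\<ell>\<^sub>p\<close>-sum of the resulting maps over a sequence of scales
\<open>l\<close> tending to 0 fast is the strong embedding (\<open>lp_map_of_negtype\<close>): on bounded sets the sum
converges uniformly, and at large distances more and more summands contribute a fixed amount.\<close>

section \<open>Positive semidefinite kernels and kernels of negative type\<close>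

definition quad_form :: "'i set \<Rightarrow> ('i \<Rightarrow> real) \<Rightarrow> ('i \<Rightarrow> 'i \<Rightarrow> real) \<Rightarrow> real"
  where "quad_form I c M = (\<Sum>i\<in>I. \<Sum>j\<in>I. c i * c j * M i j)"

text \<open>The points \<open>x i\<close> may repeat. Adjoining a base point to a finite family, or pulling a kernel back along a
map that is not injective, then needs no case distinction.\<close>

definition psd_on :: "'a set \<Rightarrow> ('a \<Rightarrow> 'a \<Rightarrow> real) \<Rightarrow> bool"
  where "psd_on A K \<longleftrightarrow> (\<forall>x\<in>A. \<forall>y\<in>A. K x y = K y x) \<and>
    (\<forall>(n::nat) x c. (\<forall>i<n. x i \<in> A) \<longrightarrow> 0 \<le> quad_form {..<n} c (\<lambda>i j. K (x i) (x j)))"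

definition negtype_on :: "'a set \<Rightarrow> ('a \<Rightarrow> 'a \<Rightarrow> real) \<Rightarrow> bool"
  where "negtype_on A Q \<longleftrightarrow> (\<forall>x\<in>A. Q x x = 0) \<and> (\<forall>x\<in>A. \<forall>y\<in>A. Q x y = Q y x) \<and>
    (\<forall>(n::nat) x c. (\<forall>i<n. x i \<in> A) \<longrightarrow> (\<Sum>i<n. c i) = 0 \<longrightarrow>
      quad_form {..<n} c (\<lambda>i j. Q (x i) (x j)) \<le> 0)"

lemma quad_form_add: "quad_form I c (\<lambda>i j. M i j + N i j) = quad_form I c M + quad_form I c N"
  by (simp add: quad_form_def sum.distrib algebra_simps)

lemma quad_form_diff: "quad_form I c (\<lambda>i j. M i j - N i j) = quad_form I c M - quad_form I c N"
  by (simp add: quad_form_def sum_subtractf algebra_simps)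

lemma quad_form_scale: "quad_form I c (\<lambda>i j. a * M i j) = a * quad_form I c M"
  by (simp add: quad_form_def sum_distrib_left algebra_simps)

lemma quad_form_rank1: "quad_form I c (\<lambda>i j. u i * v j) = (\<Sum>i\<in>I. c i * u i) * (\<Sum>j\<in>I. c j * v j)"
  unfolding quad_form_def sum_product by (intro sum.cong refl) (simp add: algebra_simps)

lemma quad_form_weights: "quad_form I c (\<lambda>i j. u i * u j * M i j) = quad_form I (\<lambda>i. c i * u i) M"
  unfolding quad_form_def by (intro sum.cong refl) (simp add: algebra_simps)

lemma quad_form_sum: "quad_form I c (\<lambda>i j. \<Sum>z\<in>F. M z i j) = (\<Sum>z\<in>F. quad_form I c (M z))"
proof -
  have "quad_form I c (\<lambda>i j. \<Sum>z\<in>F. M z i j) = (\<Sum>i\<in>I. \<Sum>j\<in>I. \<Sum>z\<in>F. c i * c j * M z i j)"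
    by (simp add: quad_form_def sum_distrib_left)
  also have "\<dots> = (\<Sum>i\<in>I. \<Sum>z\<in>F. \<Sum>j\<in>I. c i * c j * M z i j)"
    by (intro sum.cong refl sum.swap)
  also have "\<dots> = (\<Sum>z\<in>F. \<Sum>i\<in>I. \<Sum>j\<in>I. c i * c j * M z i j)"
    by (rule sum.swap)
  finally show ?thesis by (simp add: quad_form_def)
qed

lemma quad_form_cong:
  "(\<And>i j. i \<in> I \<Longrightarrow> j \<in> I \<Longrightarrow> M i j = N i j) \<Longrightarrow> quad_form I c M = quad_form I c N"
  by (simp add: quad_form_def)

lemma quad_form_reindex:
  assumes "inj_on h J"
  shows "quad_form (h ` J) c M = quad_form J (c \<circ> h) (\<lambda>i j. M (h i) (h j))"
  using assms by (simp add: quad_form_def sum.reindex)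

lemma quad_form_tendsto:
  assumes "\<And>i j. i \<in> I \<Longrightarrow> j \<in> I \<Longrightarrow> ((\<lambda>n. M n i j) \<longlongrightarrow> N i j) F"
  shows "((\<lambda>n. quad_form I c (M n)) \<longlongrightarrow> quad_form I c N) F"
  unfolding quad_form_def by (intro tendsto_sum tendsto_mult tendsto_const assms)

lemma psd_onI:
  assumes "\<And>x y. x \<in> A \<Longrightarrow> y \<in> A \<Longrightarrow> K x y = K y x"
    and "\<And>(n::nat) x c. (\<And>i. i < n \<Longrightarrow> x i \<in> A) \<Longrightarrow> 0 \<le> quad_form {..<n} c (\<lambda>i j. K (x i) (x j))"
  shows "psd_on A K"
  using assms by (auto simp: psd_on_def)

lemma negtype_onI:
  assumes "\<And>x. x \<in> A \<Longrightarrow> Q x x = 0" "\<And>x y. x \<in> A \<Longrightarrow> y \<in> A \<Longrightarrow> Q x y = Q y x"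
    and "\<And>(n::nat) x c. (\<And>i. i < n \<Longrightarrow> x i \<in> A) \<Longrightarrow> (\<Sum>i<n. c i) = 0 \<Longrightarrow>
      quad_form {..<n} c (\<lambda>i j. Q (x i) (x j)) \<le> 0"
  shows "negtype_on A Q"
  using assms by (auto simp: negtype_on_def)

lemma psd_on_sym: "psd_on A K \<Longrightarrow> x \<in> A \<Longrightarrow> y \<in> A \<Longrightarrow> K x y = K y x"
  by (auto simp: psd_on_def)

lemma negtype_on_sym: "negtype_on A Q \<Longrightarrow> x \<in> A \<Longrightarrow> y \<in> A \<Longrightarrow> Q x y = Q y x"
  by (auto simp: negtype_on_def)

lemma negtype_on_diag: "negtype_on A Q \<Longrightarrow> x \<in> A \<Longrightarrow> Q x x = 0"
  by (auto simp: negtype_on_def)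

lemma psd_onD:
  assumes "psd_on A K" "finite I" "\<And>i. i \<in> I \<Longrightarrow> x i \<in> A"
  shows "0 \<le> quad_form I c (\<lambda>i j. K (x i) (x j))"
proof -
  obtain n :: nat and h where h: "I = h ` {i. i < n}" "inj_on h {i. i < n}"
    using finite_imp_nat_seg_image_inj_on[OF assms(2)] by blast
  have "{i. i < n} = {..<n}" by auto
  then show ?thesis
    using assms h unfolding h(1) quad_form_reindex[OF h(2)]
    by (auto simp: psd_on_def)
qed

lemma negtype_onD:
  assumes "negtype_on A Q" "finite I" "\<And>i. i \<in> I \<Longrightarrow> x i \<in> A" "(\<Sum>i\<in>I. c i) = 0"
  shows "quad_form I c (\<lambda>i j. Q (x i) (x j)) \<le> 0"
proof -
  obtain n :: nat and h where h: "I = h ` {i. i < n}" "inj_on h {i. i < n}"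
    using finite_imp_nat_seg_image_inj_on[OF assms(2)] by blast
  then have h: "I = h ` {..<n}" "inj_on h {..<n}" by (simp_all add: lessThan_def)
  have "(\<Sum>i<n. (c \<circ> h) i) = 0"
    using assms(4) h by (simp add: sum.reindex)
  moreover have "\<forall>i<n. (x \<circ> h) i \<in> A" using assms h by auto
  ultimately have "quad_form {..<n} (c \<circ> h) (\<lambda>i j. Q ((x \<circ> h) i) ((x \<circ> h) j)) \<le> 0"
    using assms(1) unfolding negtype_on_def by blast
  then show ?thesis
    unfolding h(1) quad_form_reindex[OF h(2)] by (simp add: comp_def)
qed

lemma psd_on_subset: "psd_on A K \<Longrightarrow> B \<subseteq> A \<Longrightarrow> psd_on B K"
  unfolding psd_on_def by (meson subsetD)

lemma negtype_on_subset: "negtype_on A K \<Longrightarrow> B \<subseteq> A \<Longrightarrow> negtype_on B K"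
  unfolding negtype_on_def by (meson subsetD)

lemma negtype_on_cong:
  assumes "A = B" "\<And>x y. x \<in> B \<Longrightarrow> y \<in> B \<Longrightarrow> Q x y = R x y"
  shows "negtype_on A Q \<longleftrightarrow> negtype_on B R"
proof -
  have imp: "negtype_on B S" if "negtype_on B T" "\<And>x y. x \<in> B \<Longrightarrow> y \<in> B \<Longrightarrow> S x y = T x y" for S T
  proof (rule negtype_onI)
    fix n :: nat and x and c :: "nat \<Rightarrow> real" assume x: "\<And>i. i < n \<Longrightarrow> x i \<in> B" and c: "(\<Sum>i<n. c i) = 0"
    have "quad_form {..<n} c (\<lambda>i j. S (x i) (x j)) = quad_form {..<n} c (\<lambda>i j. T (x i) (x j))"
      by (intro quad_form_cong that x) auto
    then show "quad_form {..<n} c (\<lambda>i j. S (x i) (x j)) \<le> 0"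
      using negtype_onD[OF that(1), of "{..<n}" x c] x c by simp
  qed (use that negtype_on_sym[OF that(1)] negtype_on_diag[OF that(1)] in auto)
  show ?thesis using imp[of Q R] imp[of R Q] assms by auto
qed

lemma psd_on_pullback: "psd_on A K \<Longrightarrow> (\<And>x. x \<in> B \<Longrightarrow> h x \<in> A) \<Longrightarrow> psd_on B (\<lambda>x y. K (h x) (h y))"
  by (rule psd_onI) (auto intro: psd_on_sym psd_onD)

lemma negtype_on_pullback:
  "negtype_on A K \<Longrightarrow> (\<And>x. x \<in> B \<Longrightarrow> h x \<in> A) \<Longrightarrow> negtype_on B (\<lambda>x y. K (h x) (h y))"
  by (rule negtype_onI) (auto intro: negtype_on_sym negtype_on_diag negtype_onD)

lemma psd_on_diag: "psd_on A K \<Longrightarrow> x \<in> A \<Longrightarrow> 0 \<le> K x x"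
  using psd_onD[of A K "{0::nat}" "\<lambda>_. x" "\<lambda>_. 1"] by (simp add: quad_form_def)

lemma psd_on_two_points:
  assumes "psd_on A K" "x \<in> A" "y \<in> A"
  shows "0 \<le> a\<^sup>2 * K x x + 2 * a * b * K x y + b\<^sup>2 * K y y"
  using psd_onD[OF assms(1), of "{0,1::nat}" "\<lambda>i. if i = 0 then x else y" "\<lambda>i. if i = 0 then a else b"]
    assms psd_on_sym[OF assms]
  by (simp add: quad_form_def power2_eq_square algebra_simps)

lemma negtype_on_nonneg:
  assumes "negtype_on A Q" "x \<in> A" "y \<in> A"
  shows "0 \<le> Q x y"
  using negtype_onD[OF assms(1), of "{0,1::nat}" "\<lambda>i. if i = 0 then x else y" "\<lambda>i. if i = 0 then 1 else -1"]
    assms negtype_on_sym[OF assms] negtype_on_diag[OF assms(1)]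
  by (simp add: quad_form_def)

text \<open>In terms of a Hilbert space realisation this is \<open>|u + v|\<^sup>2 \<le> (1 + e) |v|\<^sup>2 + (1 + 1/e) |u|\<^sup>2\<close>; it
replaces the triangle inequality for the square root of the kernel.\<close>

lemma negtype_on_triangle_weighted:
  assumes Q: "negtype_on A Q" and xyz: "x \<in> A" "y \<in> A" "z \<in> A" and e: "0 < e"
  shows "Q x z \<le> (1 + e) * Q y z + (1 + 1 / e) * Q x y"
proof -
  have "quad_form {..<3::nat} (\<lambda>i. if i = 0 then 1 else if i = 1 then - (1 + e) else e)
     (\<lambda>i j. Q (if i = 0 then x else if i = 1 then y else z) (if j = 0 then x else if j = 1 then y else z)) \<le> 0"
    by (intro negtype_onD[OF Q]) (use xyz in \<open>auto simp: numeral_3_eq_3\<close>)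
  then have "e * Q x z \<le> (1 + e) * Q x y + e * (1 + e) * Q y z"
    using xyz negtype_on_sym[OF Q] negtype_on_diag[OF Q]
    by (simp add: quad_form_def numeral_3_eq_3 algebra_simps)
  also have "\<dots> = e * ((1 + e) * Q y z + (1 + 1 / e) * Q x y)"
    using e by (simp add: field_simps)
  finally show ?thesis using e by simp
qed

lemma negtype_on_triangle:
  assumes "negtype_on A Q" "x \<in> A" "y \<in> A" "z \<in> A"
  shows "Q x z \<le> 2 * Q x y + 2 * Q y z"
  using negtype_on_triangle_weighted[OF assms, of 1] by simp

lemma psd_on_add: "psd_on A K \<Longrightarrow> psd_on A L \<Longrightarrow> psd_on A (\<lambda>x y. K x y + L x y)"
  unfolding psd_on_def quad_form_add by (auto intro: add_nonneg_nonneg)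

lemma psd_on_scale: "psd_on A K \<Longrightarrow> 0 \<le> a \<Longrightarrow> psd_on A (\<lambda>x y. a * K x y)"
  unfolding psd_on_def quad_form_scale by (auto intro: mult_nonneg_nonneg)

lemma psd_on_rank1: "psd_on A (\<lambda>x y. u x * u y)"
  unfolding psd_on_def quad_form_rank1 by (auto simp: mult.commute)

lemma psd_on_LIMSEQ:
  assumes "\<And>n::nat. psd_on A (K n)" "\<And>x y. x \<in> A \<Longrightarrow> y \<in> A \<Longrightarrow> (\<lambda>n. K n x y) \<longlonglongrightarrow> L x y"
  shows "psd_on A L"
proof (rule psd_onI)
  fix x y assume "x \<in> A" "y \<in> A"
  then show "L x y = L y x"
    using assms(2)[of x y] assms(2)[of y x] psd_on_sym[OF assms(1)] by (simp add: LIMSEQ_unique)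
next
  fix n :: nat and x c assume x: "\<And>i. i < n \<Longrightarrow> x i \<in> A"
  show "0 \<le> quad_form {..<n} c (\<lambda>i j. L (x i) (x j))"
  proof (rule tendsto_lowerbound)
    show "(\<lambda>k. quad_form {..<n} c (\<lambda>i j. K k (x i) (x j))) \<longlonglongrightarrow> quad_form {..<n} c (\<lambda>i j. L (x i) (x j))"
      by (intro quad_form_tendsto assms x) auto
  qed (use x in \<open>auto intro!: always_eventually psd_onD[OF assms(1)]\<close>)
qed

lemma negtype_on_LIMSEQ:
  assumes "\<And>n::nat. negtype_on A (K n)" "\<And>x y. x \<in> A \<Longrightarrow> y \<in> A \<Longrightarrow> (\<lambda>n. K n x y) \<longlonglongrightarrow> L x y"
  shows "negtype_on A L"
proof (rule negtype_onI)
  fix x y assume xy: "x \<in> A" "y \<in> A"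
  then show "L x y = L y x"
    using assms(2)[of x y] assms(2)[of y x] negtype_on_sym[OF assms(1)] by (simp add: LIMSEQ_unique)
  show "L x x = 0"
    using xy assms(2)[of x x] negtype_on_diag[OF assms(1)] by (simp add: LIMSEQ_const_iff)
next
  fix n :: nat and x and c :: "nat \<Rightarrow> real" assume x: "\<And>i. i < n \<Longrightarrow> x i \<in> A" and c: "(\<Sum>i<n. c i) = 0"
  show "quad_form {..<n} c (\<lambda>i j. L (x i) (x j)) \<le> 0"
  proof (rule tendsto_upperbound)
    show "(\<lambda>k. quad_form {..<n} c (\<lambda>i j. K k (x i) (x j))) \<longlonglongrightarrow> quad_form {..<n} c (\<lambda>i j. L (x i) (x j))"
      by (intro quad_form_tendsto assms x) auto
  qed (use x c in \<open>auto intro!: always_eventually negtype_onD[OF assms(1)]\<close>)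
qed

lemma negtype_on_zero: "negtype_on A (\<lambda>x y. 0)"
  by (simp add: negtype_on_def quad_form_def)

lemma negtype_on_add: "negtype_on A K \<Longrightarrow> negtype_on A L \<Longrightarrow> negtype_on A (\<lambda>x y. K x y + L x y)"
  unfolding negtype_on_def quad_form_add by (auto intro: add_nonpos_nonpos)

lemma negtype_on_scale: "negtype_on A K \<Longrightarrow> 0 \<le> a \<Longrightarrow> negtype_on A (\<lambda>x y. a * K x y)"
  unfolding negtype_on_def quad_form_scale by (auto intro: mult_nonneg_nonpos)

lemma negtype_on_sum:
  assumes "\<And>k. k \<in> J \<Longrightarrow> negtype_on A (K k)"
  shows "negtype_on A (\<lambda>x y. \<Sum>k\<in>J. K k x y)"
  using assms
  by (induction J rule: infinite_finite_induct) (auto simp: negtype_on_zero negtype_on_add)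

lemma negtype_on_suminf:
  assumes "\<And>k::nat. negtype_on A (K k)" "\<And>x y. x \<in> A \<Longrightarrow> y \<in> A \<Longrightarrow> summable (\<lambda>k. K k x y)"
  shows "negtype_on A (\<lambda>x y. \<Sum>k. K k x y)"
  by (rule negtype_on_LIMSEQ[where K = "\<lambda>n x y. \<Sum>k<n. K k x y"])
    (auto intro!: negtype_on_sum assms summable_LIMSEQ)

section \<open>The theorems of Schur and Schoenberg\<close>

text \<open>The kernel of the components orthogonal to the vector of \<open>a\<close>. If \<open>K a a = 0\<close>, division by zero gives
back \<open>K\<close> itself; for positive semidefinite \<open>K\<close> this is the right answer, as the vector of \<open>a\<close> is 0.\<close>

definition schur_compl :: "'a \<Rightarrow> ('a \<Rightarrow> 'a \<Rightarrow> real) \<Rightarrow> 'a \<Rightarrow> 'a \<Rightarrow> real"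
  where "schur_compl a K x y = K x y - K x a * K a y / K a a"

lemma psd_on_null_row:
  assumes "psd_on A K" "a \<in> A" "x \<in> A" "K a a = 0"
  shows "K a x = 0"
proof -
  have "0 \<le> - 2 * (K x x + 1) + K x x" if "K a x \<noteq> 0"
    using psd_on_two_points[OF assms(1-3), of "- (K x x + 1) / K a x" 1] assms(4) that by simp
  moreover have "0 \<le> K x x" using psd_on_diag assms by metis
  ultimately show ?thesis by force
qed

lemma schur_compl_row: "psd_on A K \<Longrightarrow> a \<in> A \<Longrightarrow> x \<in> A \<Longrightarrow> schur_compl a K a x = 0"
  using psd_on_null_row[of A K a x] by (cases "K a a = 0") (auto simp: schur_compl_def)

text \<open>Among all values of the quadratic form that arise by giving \<open>a\<close> some additional weight, the smallest one is
the quadratic form of the Schur complement.\<close>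

lemma psd_on_schur_compl:
  assumes K: "psd_on A K" and a: "a \<in> A"
  shows "psd_on A (schur_compl a K)"
proof (cases "K a a = 0")
  case True
  then show ?thesis using K unfolding schur_compl_def by simp
next
  case False
  show ?thesis
  proof (rule psd_onI)
    fix x y assume "x \<in> A" "y \<in> A"
    then show "schur_compl a K x y = schur_compl a K y x"
      using psd_on_sym[OF K] a by (simp add: schur_compl_def)
  next
    fix n :: nat and x c assume x: "\<And>i. i < n \<Longrightarrow> x i \<in> A"
    define s where "s = (\<Sum>i<n. c i * K (x i) a)"
    define x' where "x' = (\<lambda>i. if i < n then x i else a)"
    define c' where "c' = (\<lambda>i. if i < n then c i else - s / K a a)"
    have s': "s = (\<Sum>i<n. c i * K a (x i))"
      unfolding s_def by (intro sum.cong refl) (use psd_on_sym[OF K] a x in auto)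
    have "0 \<le> quad_form {..<Suc n} c' (\<lambda>i j. K (x' i) (x' j))"
      by (rule psd_onD[OF K]) (auto simp: x'_def a x)
    also have "\<dots> = quad_form {..<n} c (\<lambda>i j. K (x i) (x j)) + (\<Sum>i<n. c i * (- s / K a a) * K (x i) a)
        + (\<Sum>i<n. (- s / K a a) * c i * K a (x i)) + (- s / K a a)\<^sup>2 * K a a"
      by (simp add: quad_form_def x'_def c'_def sum.distrib sum_subtractf sum_negf power2_eq_square)
    also have "(\<Sum>i<n. c i * (- s / K a a) * K (x i) a) = - s / K a a * s"
      unfolding s_def sum_distrib_left by (intro sum.cong refl) simp
    also have "(\<Sum>i<n. (- s / K a a) * c i * K a (x i)) = - s / K a a * s"
      by (subst (3) s', unfold sum_distrib_left) (intro sum.cong refl, simp)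
    also have "quad_form {..<n} c (\<lambda>i j. K (x i) (x j)) + - s / K a a * s + - s / K a a * s + (- s / K a a)\<^sup>2 * K a a
       = quad_form {..<n} c (\<lambda>i j. K (x i) (x j)) - s * s / K a a"
      using False by (simp add: field_simps power2_eq_square)
    also have "s * s / K a a = quad_form {..<n} c (\<lambda>i j. (K (x i) a / K a a) * K a (x j))"
      unfolding quad_form_rank1 s'[symmetric] by (simp add: s_def flip: sum_divide_distrib)
    also have "quad_form {..<n} c (\<lambda>i j. K (x i) (x j)) - \<dots> = quad_form {..<n} c (\<lambda>i j. schur_compl a K (x i) (x j))"
      unfolding schur_compl_def quad_form_diff by simp
    finally show "0 \<le> quad_form {..<n} c (\<lambda>i j. schur_compl a K (x i) (x j))" .
  qed
qed

text \<open>Gram-Schmidt: splitting off the component along \<open>a\<close> leaves the Schur complement, which vanishes on the row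
of \<open>a\<close> and is therefore a kernel on the remaining points.\<close>

lemma psd_on_gram:
  assumes "finite F" "psd_on F K"
  shows "\<exists>v. \<forall>x\<in>F. \<forall>y\<in>F. K x y = (\<Sum>z\<in>F. v z x * v z y)"
  using assms
proof (induction F arbitrary: K rule: finite_induct)
  case (insert a F)
  have S: "psd_on F (schur_compl a K)"
    by (rule psd_on_subset[OF psd_on_schur_compl[OF insert.prems]]) auto
  obtain v where v: "\<forall>x\<in>F. \<forall>y\<in>F. schur_compl a K x y = (\<Sum>z\<in>F. v z x * v z y)"
    using insert.IH[OF S] by blast
  have pos: "0 \<le> K a a" by (rule psd_on_diag[OF insert.prems]) simp
  define w where "w = (\<lambda>z x. if z = a then K x a / sqrt (K a a) else if x = a then 0 else v z x)"
  have "K x y = (\<Sum>z\<in>insert a F. w z x * w z y)" if "x \<in> insert a F" "y \<in> insert a F" for x y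
  proof -
    have "(\<Sum>z\<in>insert a F. w z x * w z y) = K x a * K y a / K a a + (\<Sum>z\<in>F. w z x * w z y)"
      using insert.hyps pos by (simp add: w_def)
    also have "(\<Sum>z\<in>F. w z x * w z y) = schur_compl a K x y"
    proof (cases "x = a \<or> y = a")
      case True
      then have "schur_compl a K x y = 0"
        using schur_compl_row[OF insert.prems] that psd_on_sym[OF psd_on_schur_compl[OF insert.prems]]
        by (metis insertI1)
      moreover have "(\<Sum>z\<in>F. w z x * w z y) = 0"
        using True insert.hyps by (intro sum.neutral) (auto simp: w_def)
      ultimately show ?thesis by simp
    next
      case False
      then have "(\<Sum>z\<in>F. w z x * w z y) = (\<Sum>z\<in>F. v z x * v z y)"
        using insert.hyps by (intro sum.cong) (auto simp: w_def)
      then show ?thesis using v that False by simp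
    qed
    also have "K x a * K y a / K a a + schur_compl a K x y = K x y"
      using psd_on_sym[OF insert.prems, of y a] that by (simp add: schur_compl_def)
    finally show ?thesis by simp
  qed
  then show ?case by blast
qed simp

text \<open>Schur's product theorem: the product with a rank one kernel only rescales the coefficients, and on finitely
many points every positive semidefinite kernel is a sum of rank one kernels.\<close>

lemma psd_on_mult:
  assumes K: "psd_on A K" and L: "psd_on A L"
  shows "psd_on A (\<lambda>x y. K x y * L x y)"
proof (rule psd_onI)
  fix x y assume "x \<in> A" "y \<in> A"
  then show "K x y * L x y = K y x * L y x" using psd_on_sym[OF K] psd_on_sym[OF L] by simp
next
  fix n :: nat and x c assume x: "\<And>i. i < n \<Longrightarrow> x i \<in> A"
  have "psd_on {..<n} (\<lambda>i j. K (x i) (x j))" by (rule psd_on_pullback[OF K]) (use x in auto)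
  then obtain v where v: "\<forall>i\<in>{..<n}. \<forall>j\<in>{..<n}. K (x i) (x j) = (\<Sum>z<n. v z i * v z j)"
    using psd_on_gram[of "{..<n}"] by blast
  have "quad_form {..<n} c (\<lambda>i j. K (x i) (x j) * L (x i) (x j))
      = quad_form {..<n} c (\<lambda>i j. \<Sum>z<n. v z i * v z j * L (x i) (x j))"
    using v by (intro quad_form_cong) (simp add: sum_distrib_right)
  also have "\<dots> = (\<Sum>z<n. quad_form {..<n} (\<lambda>i. c i * v z i) (\<lambda>i j. L (x i) (x j)))"
    by (simp add: quad_form_sum quad_form_weights)
  also have "\<dots> \<ge> 0" by (intro sum_nonneg psd_onD[OF L]) (use x in auto)
  finally show "0 \<le> quad_form {..<n} c (\<lambda>i j. K (x i) (x j) * L (x i) (x j))" .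
qed

lemma psd_on_power: "psd_on A K \<Longrightarrow> psd_on A (\<lambda>x y. K x y ^ n)"
  using psd_on_rank1[of A "\<lambda>_. 1"] by (induction n) (auto intro: psd_on_mult)

lemma psd_on_exp:
  assumes K: "psd_on A K"
  shows "psd_on A (\<lambda>x y. exp (K x y))"
proof (rule psd_on_LIMSEQ)
  show "psd_on A (\<lambda>x y. \<Sum>k<n. K x y ^ k /\<^sub>R fact k)" for n
  proof (induction n)
    case 0 then show ?case using psd_on_rank1[of A "\<lambda>_. 0"] by simp
  next
    case (Suc n) then show ?case
      using psd_on_add[OF Suc psd_on_scale[OF psd_on_power[OF K, of n], of "inverse (fact n)"]] by simp
  qed
  show "(\<lambda>n. \<Sum>k<n. K x y ^ k /\<^sub>R fact k) \<longlonglongrightarrow> exp (K x y)" for x y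
    using exp_converges[of "K x y"] by (simp add: sums_def)
qed

text \<open>Moving the base point of a Hilbert space realisation to \<open>a\<close> turns \<open>Q\<close> into twice the kernel of inner
products.\<close>

lemma negtype_on_imp_psd_on:
  assumes Q: "negtype_on A Q" and a: "a \<in> A"
  shows "psd_on A (\<lambda>x y. Q x a + Q y a - Q x y)"
proof (rule psd_onI)
  fix x y assume "x \<in> A" "y \<in> A"
  then show "Q x a + Q y a - Q x y = Q y a + Q x a - Q y x" using negtype_on_sym[OF Q] by simp
next
  fix n :: nat and x and c :: "nat \<Rightarrow> real" assume x: "\<And>i. i < n \<Longrightarrow> x i \<in> A"
  define s where "s = (\<Sum>i<n. c i)"
  define x' where "x' = (\<lambda>i. if i < n then x i else a)"
  define c' where "c' = (\<lambda>i. if i < n then c i else - s)"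
  have "0 \<ge> quad_form {..<Suc n} c' (\<lambda>i j. Q (x' i) (x' j))"
    by (rule negtype_onD[OF Q]) (auto simp: x'_def a x c'_def s_def)
  also have "quad_form {..<Suc n} c' (\<lambda>i j. Q (x' i) (x' j)) = quad_form {..<n} c (\<lambda>i j. Q (x i) (x j))
     + (\<Sum>i<n. c i * - s * Q (x i) a) + (\<Sum>i<n. - s * c i * Q a (x i))"
    using negtype_on_diag[OF Q a] by (simp add: quad_form_def x'_def c'_def sum.distrib sum_subtractf sum_negf)
  also have "(\<Sum>i<n. - s * c i * Q a (x i)) = (\<Sum>i<n. c i * - s * Q (x i) a)"
    by (intro sum.cong refl) (use negtype_on_sym[OF Q] a x in simp)
  also have "(\<Sum>i<n. c i * - s * Q (x i) a) = - (s * (\<Sum>i<n. c i * Q (x i) a))"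
    unfolding sum_distrib_left sum_negf[symmetric] by (intro sum.cong refl) simp
  finally have 1: "quad_form {..<n} c (\<lambda>i j. Q (x i) (x j)) \<le> 2 * (s * (\<Sum>i<n. c i * Q (x i) a))"
    by simp
  have "quad_form {..<n} c (\<lambda>i j. Q (x i) a + Q (x j) a - Q (x i) (x j))
    = quad_form {..<n} c (\<lambda>i j. Q (x i) a * 1) + quad_form {..<n} c (\<lambda>i j. 1 * Q (x j) a)
      - quad_form {..<n} c (\<lambda>i j. Q (x i) (x j))"
    by (simp add: quad_form_diff quad_form_add)
  also have "\<dots> = 2 * (s * (\<Sum>i<n. c i * Q (x i) a)) - quad_form {..<n} c (\<lambda>i j. Q (x i) (x j))"
    unfolding quad_form_rank1 s_def by simp
  finally show "0 \<le> quad_form {..<n} c (\<lambda>i j. Q (x i) a + Q (x j) a - Q (x i) (x j))"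
    using 1 by simp
qed

text \<open>After moving the base point to \<open>a\<close>, the Gaussian kernel is a rank one kernel times the exponential of a
positive semidefinite one.\<close>

lemma schoenberg:
  assumes Q: "negtype_on A Q"
  shows "psd_on A (\<lambda>x y. exp (- Q x y))"
proof (cases "A = {}")
  case True
  then show ?thesis by (auto simp: psd_on_def quad_form_def)
next
  case False
  then obtain a where a: "a \<in> A" by blast
  have "psd_on A (\<lambda>x y. (exp (- Q x a) * exp (- Q y a)) * exp (Q x a + Q y a - Q x y))"
    by (rule psd_on_mult[OF psd_on_rank1[where u = "\<lambda>x. exp (- Q x a)"]
          psd_on_exp[OF negtype_on_imp_psd_on[OF Q a]]])
  moreover have "(exp (- Q x a) * exp (- Q y a)) * exp (Q x a + Q y a - Q x y) = exp (- Q x y)" for x y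
    by (simp add: mult_exp_exp)
  ultimately show ?thesis by simp
qed

lemma negtype_on_of_psd_on:
  assumes K: "psd_on A K" and 1: "\<And>x. x \<in> A \<Longrightarrow> K x x = 1"
  shows "negtype_on A (\<lambda>x y. 1 - K x y)"
proof (rule negtype_onI)
  fix n :: nat and x and c :: "nat \<Rightarrow> real" assume x: "\<And>i. i < n \<Longrightarrow> x i \<in> A" and c: "(\<Sum>i<n. c i) = 0"
  have "quad_form {..<n} c (\<lambda>i j. 1 - K (x i) (x j))
     = quad_form {..<n} c (\<lambda>i j. 1 * 1) - quad_form {..<n} c (\<lambda>i j. K (x i) (x j))"
    by (simp add: quad_form_diff)
  also have "\<dots> \<le> 0" unfolding quad_form_rank1 using c psd_onD[OF K, of "{..<n}" x c] x by simp
  finally show "quad_form {..<n} c (\<lambda>i j. 1 - K (x i) (x j)) \<le> 0" .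
qed (use 1 psd_on_sym[OF K] in auto)

lemma negtype_on_one_minus_exp:
  assumes "negtype_on A Q"
  shows "negtype_on A (\<lambda>x y. 1 - exp (- Q x y))"
  using negtype_on_of_psd_on[OF schoenberg[OF assms]] negtype_on_diag[OF assms] by simp

section \<open>The norm of sequence spaces\<close>

lemma negtype_on_one_minus_cos: "negtype_on UNIV (\<lambda>u v. 1 - cos (s * (u - v)) :: real)"
proof -
  have "psd_on UNIV (\<lambda>u v. cos (s * u) * cos (s * v) + sin (s * u) * sin (s * v))"
    by (intro psd_on_add psd_on_rank1)
  then have "psd_on UNIV (\<lambda>u v. cos (s * (u - v)))"
    by (simp add: right_diff_distrib cos_diff)
  then show ?thesis by (rule negtype_on_of_psd_on) simp
qed

lemma one_minus_cos_le: "1 - cos (x::real) \<le> x\<^sup>2"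
proof -
  have "1 - cos x = 2 * (sin (x / 2))\<^sup>2" using cos_double_sin[of "x / 2"] by simp
  also have "\<dots> \<le> 2 * (x / 2)\<^sup>2"
    using abs_sin_x_le_abs_x[of "x / 2"] by (simp only: abs_le_square_iff)
  also have "\<dots> \<le> x\<^sup>2" by (simp add: power2_eq_square)
  finally show ?thesis .
qed

text \<open>The weight of the integral representation of \<open>|u|\<^sup>p\<close>: up to a constant, \<open>|u|\<^sup>p\<close> is the integral of
\<open>1 - cos (u s)\<close> against it over the positive half-line.\<close>

definition levy_density :: "real \<Rightarrow> real \<Rightarrow> real"
  where "levy_density p s = indicator {0<..} s * s powr (- 1 - p)"

text \<open>Near 0 the integrand is of order \<open>s\<^bsup>1 - p\<^esup>\<close>, integrable as \<open>p < 2\<close>; near infinity it is of order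
\<open>s\<^bsup>- 1 - p\<^esup>\<close>, integrable as \<open>p > 0\<close>.\<close>

lemma integrable_levy_one:
  assumes p: "0 < p" "p < 2"
  shows "integrable lborel (\<lambda>s. (1 - cos s) * levy_density p s)"
proof -
  let ?G = "\<lambda>s. (1 - cos s) * levy_density p s"
  let ?H = "\<lambda>s. indicator {0..1} s *\<^sub>R (s powr (1 - p)) + indicator {1..} s *\<^sub>R (2 * s powr (- 1 - p))"
  have "(\<lambda>s::real. s powr (1 - p)) absolutely_integrable_on {0..1}"
    using has_integral_powr_from_0[of "1 - p" 1] p
    by (intro nonnegative_absolutely_integrable_1) (auto simp: integrable_on_def)
  then have 1: "integrable lebesgue (\<lambda>s::real. indicator {0..1} s *\<^sub>R (s powr (1 - p)))"
    by (simp add: set_integrable_def)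
  have "(\<lambda>s::real. 2 * s powr (- 1 - p)) absolutely_integrable_on {1..}"
    using has_integral_mult_right[OF has_integral_powr_to_inf[of "- 1 - p" 1], of 2] p
    by (intro nonnegative_absolutely_integrable_1) (auto simp: integrable_on_def)
  then have 2: "integrable lebesgue (\<lambda>s::real. indicator {1..} s *\<^sub>R (2 * s powr (- 1 - p)))"
    by (simp add: set_integrable_def)
  have "integrable lebesgue ?H" by (rule Bochner_Integration.integrable_add[OF 1 2])
  then have H: "integrable lborel ?H" by (subst (asm) integrable_completion) auto
  show ?thesis
  proof (rule Bochner_Integration.integrable_bound[OF H])
    have "norm (?G s) \<le> norm (?H s)" for s
    proof (cases "0 < s")
      case True
      have H0: "0 \<le> ?H s" by simp
      have "?G s \<le> ?H s"
      proof (cases "s \<le> 1")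
        case t: True
        have "?G s \<le> s\<^sup>2 * s powr (- 1 - p)"
          using one_minus_cos_le[of s] True by (simp add: levy_density_def mult_right_mono)
        also have "\<dots> = s powr (1 - p)"
          using True by (simp flip: powr_numeral powr_add)
        also have "\<dots> \<le> ?H s" using t True by simp
        finally show ?thesis .
      next
        case False
        have "1 - cos s \<le> 2" using cos_ge_minus_one[of s] by linarith
        then have "?G s \<le> 2 * s powr (- 1 - p)"
          using True by (simp add: levy_density_def mult_right_mono)
        also have "\<dots> \<le> ?H s" using False by simp
        finally show ?thesis .
      qed
      moreover have "0 \<le> ?G s" by (simp add: levy_density_def)
      ultimately show ?thesis using H0 by simp
    qed (simp add: levy_density_def)
    then show "AE s in lborel. norm (?G s) \<le> norm (?H s)" by simp
  qed (simp add: levy_density_def)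
qed

lemma levy_scaling:
  assumes "u \<noteq> 0"
  shows "(1 - cos (u * s)) * levy_density p s
    = \<bar>u\<bar> powr (1 + p) * ((1 - cos (\<bar>u\<bar> * s)) * levy_density p (\<bar>u\<bar> * s))"
proof (cases "0 < s")
  case True
  have "levy_density p (\<bar>u\<bar> * s) = \<bar>u\<bar> powr (- 1 - p) * levy_density p s"
    using True assms by (simp add: levy_density_def powr_mult)
  moreover have "\<bar>u\<bar> powr (1 + p) * \<bar>u\<bar> powr (- 1 - p) = 1"
    using assms by (simp flip: powr_add)
  moreover have "\<bar>u\<bar> powr (1 + p) * ((1 - cos (\<bar>u\<bar> * s)) * (\<bar>u\<bar> powr (- 1 - p) * levy_density p s))
      = (\<bar>u\<bar> powr (1 + p) * \<bar>u\<bar> powr (- 1 - p)) * ((1 - cos (\<bar>u\<bar> * s)) * levy_density p s)"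
    by (simp only: mult_ac)
  moreover have "cos (\<bar>u\<bar> * s) = cos (u * s)" by (simp add: abs_if)
  ultimately show ?thesis by simp
qed (use assms in \<open>simp add: levy_density_def zero_less_mult_iff\<close>)

lemma integrable_levy:
  assumes p: "0 < p" "p < 2"
  shows "integrable lborel (\<lambda>s. (1 - cos (u * s)) * levy_density p s)"
proof (cases "u = 0")
  case False
  show ?thesis unfolding levy_scaling[OF False]
    using lborel_integrable_real_affine[OF integrable_levy_one[OF p], of "\<bar>u\<bar>" 0] False
    by (intro integrable_mult_right) auto
qed simp

lemma integral_levy:
  assumes p: "0 < p" "p < 2"
  shows "(\<integral>s. (1 - cos (u * s)) * levy_density p s \<partial>lborel)
    = \<bar>u\<bar> powr p * (\<integral>s. (1 - cos s) * levy_density p s \<partial>lborel)"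
proof (cases "u = 0")
  case False
  let ?G = "\<lambda>s. (1 - cos s) * levy_density p s"
  have "(\<integral>s. (1 - cos (u * s)) * levy_density p s \<partial>lborel)
     = \<bar>u\<bar> powr (1 + p) * (\<integral>s. ?G (\<bar>u\<bar> * s) \<partial>lborel)"
    unfolding levy_scaling[OF False] by simp
  also have "\<bar>u\<bar> powr (1 + p) = \<bar>u\<bar> powr p * \<bar>u\<bar>"
    using False by (simp add: powr_add mult.commute)
  also have "\<bar>u\<bar> powr p * \<bar>u\<bar> * (\<integral>s. ?G (\<bar>u\<bar> * s) \<partial>lborel) = \<bar>u\<bar> powr p * (\<integral>s. ?G s \<partial>lborel)"
    using lborel_integral_real_affine[of "\<bar>u\<bar>" ?G 0] False by simp
  finally show ?thesis .
qed simp

lemma integral_levy_pos: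
  assumes p: "0 < p" "p < 2"
  shows "0 < (\<integral>s. (1 - cos s) * levy_density p s \<partial>lborel)"
proof -
  define b where "b = (1 - cos 1) * 2 powr (- 1 - p)"
  have "cos 1 < cos (0::real)" using pi_gt3 by (intro cos_monotone_0_pi) auto
  then have b: "0 < b" by (simp add: b_def)
  have "b = (\<integral>s. b * indicator {1..2::real} s \<partial>lborel)" by simp
  also have "\<dots> \<le> (\<integral>s. (1 - cos s) * levy_density p s \<partial>lborel)"
  proof (rule integral_mono[OF _ integrable_levy_one[OF p]])
    show "integrable lborel (\<lambda>s. b * indicator {1..2::real} s)" by simp
    fix s :: real
    show "b * indicator {1..2} s \<le> (1 - cos s) * levy_density p s"
    proof (cases "s \<in> {1..2}")
      case True
      have "cos s \<le> cos 1" using True pi_gt3 by (intro cos_monotone_0_pi_le) auto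
      moreover have "2 powr (- 1 - p) \<le> s powr (- 1 - p)"
        using True p by (intro powr_mono2') auto
      ultimately have "b \<le> (1 - cos s) * s powr (- 1 - p)"
        unfolding b_def using cos_le_one[of 1] by (intro mult_mono) auto
      then show ?thesis using True by (simp add: levy_density_def)
    qed (simp add: levy_density_def)
  qed
  finally show ?thesis using b by simp
qed

text \<open>For \<open>p < 2\<close> this is a mixture of the kernels \<open>1 - cos (s (u - v))\<close> with the positive weight
\<^const>\<open>levy_density\<close>. For \<open>p = 2\<close> the integral diverges, but the kernel is the squared distance.\<close>

lemma negtype_on_abs_powr:
  assumes p: "0 < p" "p \<le> 2"
  shows "negtype_on UNIV (\<lambda>u v::real. \<bar>u - v\<bar> powr p)"
proof (cases "p = 2")
  case True
  show ?thesis
  proof (rule negtype_onI)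
    fix n :: nat and x c :: "nat \<Rightarrow> real" assume c: "(\<Sum>i<n. c i) = 0"
    have "quad_form {..<n} c (\<lambda>i j. \<bar>x i - x j\<bar> powr p)
       = quad_form {..<n} c (\<lambda>i j. (x i)\<^sup>2 * 1 + 1 * (x j)\<^sup>2 - 2 * (x i * x j))"
      by (intro quad_form_cong) (simp add: True power2_eq_square algebra_simps)
    also have "\<dots> \<le> 0"
      unfolding quad_form_diff quad_form_add quad_form_scale[where a = 2] quad_form_rank1[where u = "\<lambda>i. (x i)\<^sup>2" and v = "\<lambda>_. 1"]
        quad_form_rank1[where u = "\<lambda>_. 1"] quad_form_rank1[where u = x and v = x]
      using c by simp
    finally show "quad_form {..<n} c (\<lambda>i j. \<bar>x i - x j\<bar> powr p) \<le> 0" .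
  qed (use p in \<open>auto simp: abs_minus_commute\<close>)
next
  case False
  with p have p: "0 < p" "p < 2" by auto
  define I where "I = (\<integral>s. (1 - cos s) * levy_density p s \<partial>lborel)"
  have I: "0 < I" using integral_levy_pos[OF p] by (simp add: I_def)
  show ?thesis
  proof (rule negtype_onI)
    fix n :: nat and x c :: "nat \<Rightarrow> real" assume c: "(\<Sum>i<n. c i) = 0"
    let ?M = "\<lambda>s i j. (1 - cos ((x i - x j) * s)) * levy_density p s"
    have "quad_form {..<n} c (\<lambda>i j. \<bar>x i - x j\<bar> powr p) * I
       = quad_form {..<n} c (\<lambda>i j. \<integral>s. ?M s i j \<partial>lborel)"
      by (simp add: integral_levy[OF p] quad_form_def sum_distrib_right I_def mult.assoc)
    also have "\<dots> = (\<integral>s. quad_form {..<n} c (?M s) \<partial>lborel)"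
      unfolding quad_form_def
      by (subst Bochner_Integration.integral_sum | intro integrable_levy[OF p] integrable_mult_right
          Bochner_Integration.integrable_sum sum.cong refl integral_mult_right_zero[symmetric])+
    also have "\<dots> \<le> 0"
    proof -
      have "quad_form {..<n} c (?M s) \<le> 0" for s
      proof -
      have "quad_form {..<n} c (?M s) = levy_density p s * quad_form {..<n} c (\<lambda>i j. 1 - cos (s * (x i - x j)))"
        by (subst quad_form_scale[symmetric]) (simp add: mult.commute)
      also have "\<dots> \<le> 0"
        using negtype_onD[OF negtype_on_one_minus_cos, of "{..<n}" x c s] c
        by (intro mult_nonneg_nonpos) (auto simp: levy_density_def)
      finally show ?thesis .
      qed
      then have "0 \<le> (\<integral>s. - quad_form {..<n} c (?M s) \<partial>lborel)"
        by (intro Bochner_Integration.integral_nonneg) simp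
      then show ?thesis by simp
    qed
    finally show "quad_form {..<n} c (\<lambda>i j. \<bar>x i - x j\<bar> powr p) \<le> 0"
      using I by (simp add: mult_le_0_iff)
  qed (use p in \<open>auto simp: abs_minus_commute\<close>)
qed

lemma negtype_on_lp:
  assumes p: "1 \<le> p" "p \<le> 2"
  shows "negtype_on (lp_carrier p) (\<lambda>x y. lp_norm p (\<lambda>n. x n - y n) powr p)"
proof -
  have "negtype_on (lp_carrier p) (\<lambda>x y. \<Sum>n. \<bar>x n - y n\<bar> powr p)"
  proof (rule negtype_on_suminf)
    show "negtype_on (lp_carrier p) (\<lambda>x y. \<bar>x n - y n\<bar> powr p)" for n
      using p by (intro negtype_on_pullback[OF negtype_on_abs_powr]) auto
    show "summable (\<lambda>n. \<bar>x n - y n\<bar> powr p)" if "x \<in> lp_carrier p" "y \<in> lp_carrier p" for x y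
      using lp_diff_mem[OF p(1) that] by (simp add: lp_carrier_def)
  qed
  moreover have "lp_norm p (\<lambda>n. x n - y n) powr p = (\<Sum>n. \<bar>x n - y n\<bar> powr p)"
    if "x \<in> lp_carrier p" "y \<in> lp_carrier p" for x y
    by (rule lp_norm_powr[OF p(1) lp_diff_mem[OF p(1) that]])
  ultimately show ?thesis by (simp cong: negtype_on_cong)
qed

section \<open>Extension and smoothing of kernels\<close>

lemma compact_box:
  fixes S :: "'a \<Rightarrow> 'b::topological_space set"
  assumes "\<And>x. compact (S x)"
  shows "compact {f. \<forall>x. f x \<in> S x}"
proof -
  have "compactin (product_topology (\<lambda>_. euclidean) UNIV) (PiE UNIV S)"
    using assms by (simp add: compactin_PiE)
  moreover have "PiE UNIV S = {f. \<forall>x. f x \<in> S x}" by auto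
  ultimately show ?thesis by (simp add: euclidean_product_topology)
qed

lemma continuous_on_apply2: "continuous_on UNIV (\<lambda>Q::'a \<Rightarrow> 'b \<Rightarrow> real. Q x y)"
  using continuous_on_compose2[OF continuous_on_product_coordinates[of y] continuous_on_product_coordinates[of x]]
  by simp

lemma continuous_on_quad_form: "continuous_on UNIV (\<lambda>Q. quad_form I c (\<lambda>i j. Q (x i) (x j)))"
  unfolding quad_form_def by (intro continuous_intros continuous_on_apply2)

lemma closed_negtype: "closed {Q. negtype_on A Q}"
  unfolding negtype_on_def Ball_def
  by (intro closed_Collect_conj closed_Collect_all closed_Collect_imp closed_Collect_le
      closed_Collect_eq continuous_on_quad_form continuous_on_apply2 continuous_intros open_Collect_const)

text \<open>Read \<open>Q x y\<close> as the squared distance of two vectors, so that \<open>\<Sum>x. c x * Q x y - quad_form F c Q / 2\<close> is the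
squared distance of the vector of \<open>y\<close> from the barycentre with weights \<open>c\<close>. Asked for is a point whose
squared distance from the vector of each \<open>y\<close> is at most \<open>r y\<close>. The dual problem is to maximise a
quadratic function over the simplex. Its maximum is nonpositive by the hypothesis on \<open>r\<close>, and the first
order condition at a maximiser says that the barycentre solves the original problem.\<close>

lemma optimal_weights:
  fixes Q :: "'a \<Rightarrow> 'a \<Rightarrow> real"
  assumes F: "finite F" "F \<noteq> {}"
    and sym: "\<And>x y. x \<in> F \<Longrightarrow> y \<in> F \<Longrightarrow> Q x y = Q y x"
    and r: "\<And>x y. x \<in> F \<Longrightarrow> y \<in> F \<Longrightarrow> Q x y \<le> r x + r y"
  obtains c where "(\<Sum>x\<in>F. c x) = 1"
    "\<And>y. y \<in> F \<Longrightarrow> (\<Sum>x\<in>F. c x * Q x y) - quad_form F c Q / 2 \<le> r y"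
proof -
  define \<Delta> where "\<Delta> = {c. \<forall>x. c x \<in> {0..1::real}} \<inter> {c. (\<Sum>x\<in>F. c x) = 1}"
  define h where "h c = quad_form F c Q / 2 - (\<Sum>x\<in>F. c x * r x)" for c
  have "compact \<Delta>" unfolding \<Delta>_def
    by (intro compact_Int_closed compact_box closed_Collect_eq continuous_intros continuous_on_product_coordinates) auto
  obtain a where a: "a \<in> F" using F by blast
  have "(\<lambda>x. if x = a then 1 else 0) \<in> \<Delta>" using a F by (auto simp: \<Delta>_def)
  then have "\<Delta> \<noteq> {}" by blast
  have "continuous_on UNIV h"
    unfolding h_def quad_form_def by (intro continuous_intros continuous_on_product_coordinates) auto
  then obtain c where c: "c \<in> \<Delta>" and max: "\<And>d. d \<in> \<Delta> \<Longrightarrow> h d \<le> h c"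
    using continuous_attains_sup[OF \<open>compact \<Delta>\<close> \<open>\<Delta> \<noteq> {}\<close>] continuous_on_subset by (metis subset_UNIV)
  define S where "S = quad_form F c Q"
  define \<rho> where "\<rho> = (\<Sum>x\<in>F. c x * r x)"
  have c0: "0 \<le> c x" "c x \<le> 1" for x using c by (auto simp: \<Delta>_def)
  have c1: "(\<Sum>x\<in>F. c x) = 1" using c by (auto simp: \<Delta>_def)
  have "S \<le> quad_form F c (\<lambda>x y. r x * 1 + 1 * r y)"
    unfolding S_def quad_form_def using r c0 by (intro sum_mono mult_left_mono) auto
  also have "\<dots> = 2 * \<rho>"
    unfolding quad_form_add quad_form_rank1 using c1 by (simp add: \<rho>_def)
  finally have S: "S \<le> 2 * \<rho>" .
  have "(\<Sum>x\<in>F. c x * Q x y) - S / 2 \<le> r y" if y: "y \<in> F" for y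
  proof -
    define T where "T = (\<Sum>x\<in>F. c x * Q x y)"
    \<comment> \<open>First order condition: compare the maximiser with the weights moved by \<open>e\<close> towards the vertex \<open>y\<close>.\<close>
    have le: "T - r y - (S - \<rho>) \<le> e * (T - S / 2 - Q y y / 2)" if e: "0 < e" "e \<le> 1" for e
    proof -
      define d where "d = (\<lambda>x. (1 - e) * c x + e * (if x = y then 1 else 0))"
      have delta: "(\<Sum>x\<in>F. (if x = y then 1 else 0) * g x) = g y" for g :: "'a \<Rightarrow> real"
        using y F by (simp add: if_distrib[of "\<lambda>z. z * _"] cong: if_cong)
      have "(\<Sum>x\<in>F. d x) = (1 - e) * (\<Sum>x\<in>F. c x) + e * (\<Sum>x\<in>F. (if x = y then 1 else 0) * 1)"
        unfolding d_def by (simp add: sum.distrib sum_distrib_left)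
      then have d1: "(\<Sum>x\<in>F. d x) = 1" unfolding delta using c1 by simp
      have "0 \<le> d x \<and> d x \<le> 1" for x
      proof -
        have "d x \<le> (1 - e) * 1 + e * 1"
          unfolding d_def using e c0 by (intro add_mono mult_left_mono) auto
        then show ?thesis unfolding d_def using e c0 by auto
      qed
      then have "d \<in> \<Delta>" using d1 by (auto simp: \<Delta>_def)
      then have "h d \<le> h c" by (rule max)
      have Ty: "(\<Sum>x\<in>F. c x * Q y x) = T"
        unfolding T_def using y sym by (intro sum.cong refl) auto
      have lin: "(\<Sum>x\<in>F. d x * g x) = (1 - e) * (\<Sum>x\<in>F. c x * g x) + e * g y" for g
      proof -
        have "(\<Sum>x\<in>F. d x * g x) = (1 - e) * (\<Sum>x\<in>F. c x * g x) + e * (\<Sum>x\<in>F. (if x = y then 1 else 0) * g x)"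
          unfolding d_def sum_distrib_left sum.distrib[symmetric]
          by (intro sum.cong refl) (simp add: algebra_simps)
        then show ?thesis unfolding delta .
      qed
      have qf: "quad_form F b Q = (\<Sum>x\<in>F. b x * (\<Sum>z\<in>F. b z * Q x z))" for b
        unfolding quad_form_def sum_distrib_left by (intro sum.cong refl) (simp add: mult.assoc)
      have "quad_form F d Q = (\<Sum>x\<in>F. d x * ((1 - e) * (\<Sum>z\<in>F. c z * Q x z) + e * Q x y))"
        unfolding qf lin ..
      also have "\<dots> = (1 - e) * (\<Sum>x\<in>F. c x * ((1 - e) * (\<Sum>z\<in>F. c z * Q x z) + e * Q x y))
          + e * ((1 - e) * T + e * Q y y)"
        unfolding lin Ty ..
      also have "(\<Sum>x\<in>F. c x * ((1 - e) * (\<Sum>z\<in>F. c z * Q x z) + e * Q x y)) = (1 - e) * S + e * T"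
      proof -
        have "(\<Sum>x\<in>F. c x * ((1 - e) * (\<Sum>z\<in>F. c z * Q x z) + e * Q x y))
          = (\<Sum>x\<in>F. (1 - e) * (c x * (\<Sum>z\<in>F. c z * Q x z)) + e * (c x * Q x y))"
          by (intro sum.cong refl) (simp add: distrib_left mult.left_commute)
        then show ?thesis unfolding S_def qf T_def by (simp add: sum.distrib sum_distrib_left)
      qed
      finally have "h d = ((1 - e) * ((1 - e) * S + e * T) + e * ((1 - e) * T + e * Q y y)) / 2
          - ((1 - e) * \<rho> + e * r y)"
        unfolding h_def lin \<rho>_def by simp
      with \<open>h d \<le> h c\<close>
      have "e * (T - r y - (S - \<rho>)) \<le> e * (e * (T - S / 2 - Q y y / 2))"
        unfolding h_def S_def[symmetric] \<rho>_def[symmetric] by (simp add: field_simps)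
      then show ?thesis using e by simp
    qed
    have "T - r y - (S - \<rho>) \<le> 0"
    proof (rule tendsto_lowerbound)
      show "((\<lambda>e. e * (T - S / 2 - Q y y / 2)) \<longlongrightarrow> 0) (at_right 0)"
        by (intro tendsto_mult_left_zero tendsto_ident_at)
      show "\<forall>\<^sub>F e in at_right 0. T - r y - (S - \<rho>) \<le> e * (T - S / 2 - Q y y / 2)"
        unfolding eventually_at_right_field by (rule exI[of _ 1]) (use le in auto)
    qed simp
    then show ?thesis using S unfolding T_def by linarith
  qed
  with that c1 show thesis by (simp add: S_def)
qed

text \<open>The one-point extension theorem for 1/2-Hoelder maps into Hilbert space. The image of the new point is a
barycentre of the given vectors, so the extended kernel is again a combination of values of \<open>Q\<close>.\<close>

lemma negtype_extend_point:
  assumes F: "finite F" "F \<noteq> {}" and z: "z \<notin> F" and Q: "negtype_on F Q"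
    and r: "\<And>x y. x \<in> F \<Longrightarrow> y \<in> F \<Longrightarrow> Q x y \<le> r x + r y"
  obtains Q' where "negtype_on (insert z F) Q'" "\<And>x y. x \<in> F \<Longrightarrow> y \<in> F \<Longrightarrow> Q' x y = Q x y"
    "\<And>y. y \<in> F \<Longrightarrow> Q' z y \<le> r y"
proof -
  obtain c where c1: "(\<Sum>x\<in>F. c x) = 1"
    and c: "\<And>y. y \<in> F \<Longrightarrow> (\<Sum>x\<in>F. c x * Q x y) - quad_form F c Q / 2 \<le> r y"
    by (rule optimal_weights[of F Q r]) (use F negtype_on_sym[OF Q] r in auto)
  \<comment> \<open>\<open>m x\<close> are the weights of the vector of \<open>x\<close>: a unit mass for an old point, \<open>c\<close> for \<open>z\<close>. In terms of them
the quadratic form of the new kernel is that of \<open>Q\<close> at a vector of total weight 0.\<close>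
  define m where "m x u = (if x = z then c u else if u = x then 1 else 0)" for x u
  define B where "B x y = (\<Sum>u\<in>F. \<Sum>v\<in>F. m x u * m y v * Q u v)" for x y
  define Q' where "Q' x y = B x y - (B x x / 2 + B y y / 2)" for x y
  have m1: "(\<Sum>u\<in>F. m x u) = 1" if "x \<in> insert z F" for x
    using that F c1 z by (cases "x = z") (auto simp: m_def)
  have mF: "(\<Sum>u\<in>F. m x u * g u) = g x" if "x \<in> F" for x and g :: "'a \<Rightarrow> real"
    using that F z by (cases "x = z") (auto simp: m_def if_distrib[of "\<lambda>z. z * _"] cong: if_cong)
  have B': "B x y = (\<Sum>u\<in>F. m x u * (\<Sum>v\<in>F. m y v * Q u v))" for x y
    unfolding B_def sum_distrib_left by (intro sum.cong refl) (simp add: mult.assoc)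
  have BF: "B x y = Q x y" if "x \<in> F" "y \<in> F" for x y
    unfolding B' using that by (simp add: mF)
  have Bz: "B z y = (\<Sum>x\<in>F. c x * Q x y)" if "y \<in> F" for y
    unfolding B' using that by (simp add: mF) (simp add: m_def)
  have Bzz: "B z z = quad_form F c Q"
    unfolding B_def quad_form_def by (simp add: m_def)
  have Bsym: "B x y = B y x" for x y
    unfolding B_def by (subst sum.swap, intro sum.cong refl) (use negtype_on_sym[OF Q] in simp)
  have "negtype_on (insert z F) Q'"
  proof (rule negtype_onI)
    fix n :: nat and x and b :: "nat \<Rightarrow> real" assume x: "\<And>i. i < n \<Longrightarrow> x i \<in> insert z F" and b: "(\<Sum>i<n. b i) = 0"
    define \<beta> where "\<beta> u = (\<Sum>i<n. b i * m (x i) u)" for u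
    have "(\<Sum>u\<in>F. \<beta> u) = (\<Sum>i<n. b i * (\<Sum>u\<in>F. m (x i) u))"
      unfolding \<beta>_def sum_distrib_left by (rule sum.swap)
    also have "\<dots> = 0" using m1 x b by simp
    finally have \<beta>: "(\<Sum>u\<in>F. \<beta> u) = 0" .
    have "quad_form {..<n} b (\<lambda>i j. Q' (x i) (x j)) = quad_form {..<n} b (\<lambda>i j. B (x i) (x j))
      - (quad_form {..<n} b (\<lambda>i j. B (x i) (x i) / 2 * 1) + quad_form {..<n} b (\<lambda>i j. 1 * (B (x j) (x j) / 2)))"
      unfolding Q'_def quad_form_diff quad_form_add by simp
    also have "\<dots> = quad_form {..<n} b (\<lambda>i j. B (x i) (x j))"
      unfolding quad_form_rank1 using b by simp
    also have "\<dots> = (\<Sum>u\<in>F. \<Sum>v\<in>F. quad_form {..<n} b (\<lambda>i j. Q u v * (m (x i) u * m (x j) v)))"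
      unfolding B_def quad_form_sum by (simp add: mult.commute)
    also have "\<dots> = quad_form F \<beta> Q"
      unfolding quad_form_scale quad_form_rank1 \<beta>_def[symmetric] by (simp add: quad_form_def mult.commute)
    also have "\<dots> \<le> 0"
      using negtype_onD[OF Q F(1), of "\<lambda>u. u" \<beta>] \<beta> by simp
    finally show "quad_form {..<n} b (\<lambda>i j. Q' (x i) (x j)) \<le> 0" .
  qed (use Bsym in \<open>auto simp: Q'_def\<close>)
  moreover have "Q' x y = Q x y" if "x \<in> F" "y \<in> F" for x y
    unfolding Q'_def using that BF negtype_on_diag[OF Q] by simp
  moreover have "Q' z y \<le> r y" if "y \<in> F" for y
    unfolding Q'_def Bz[OF that] Bzz BF[OF that that] using c[OF that] negtype_on_diag[OF Q that] by simp
  ultimately show thesis using that by blast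
qed

lemma negtype_extend_finite:
  fixes Q :: "'a::metric_space \<Rightarrow> 'a \<Rightarrow> real"
  assumes "finite G" "finite N" "negtype_on N Q" "0 \<le> k"
    and "\<And>x y. x \<in> N \<Longrightarrow> y \<in> N \<Longrightarrow> Q x y \<le> k * dist x y"
  shows "\<exists>Q'. negtype_on (N \<union> G) Q' \<and> (\<forall>x\<in>N. \<forall>y\<in>N. Q' x y = Q x y) \<and>
    (\<forall>x\<in>N \<union> G. \<forall>y\<in>N \<union> G. Q' x y \<le> k * dist x y)"
  using assms(1)
proof (induction G rule: finite_induct)
  case empty
  then show ?case using assms by auto
next
  case (insert z G)
  let ?F = "N \<union> G"
  obtain R where R: "negtype_on ?F R" "\<forall>x\<in>N. \<forall>y\<in>N. R x y = Q x y"
    "\<forall>x\<in>?F. \<forall>y\<in>?F. R x y \<le> k * dist x y"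
    using insert.IH by blast
  show ?case
  proof (cases "z \<in> ?F \<or> ?F = {}")
    case True
    then show ?thesis
    proof
      assume "z \<in> ?F"
      then have "N \<union> insert z G = ?F" by auto
      then show ?thesis using R by auto
    next
      assume "?F = {}"
      then show ?thesis using negtype_on_zero[of "N \<union> insert z G"] assms(4)
        by (intro exI[of _ "\<lambda>_ _. 0"]) auto
    qed
  next
    case False
    have fin: "finite ?F" using insert assms(2) by simp
    have tri: "R x y \<le> k * dist z x + k * dist z y" if "x \<in> ?F" "y \<in> ?F" for x y
    proof -
      have "R x y \<le> k * dist x y" using R that by blast
      also have "\<dots> \<le> k * (dist z x + dist z y)"
        using assms(4) dist_triangle3 by (intro mult_left_mono) auto
      finally show ?thesis by (simp add: distrib_left)
    qed
    obtain R' where R': "negtype_on (insert z ?F) R'" "\<And>x y. x \<in> ?F \<Longrightarrow> y \<in> ?F \<Longrightarrow> R' x y = R x y"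
      "\<And>y. y \<in> ?F \<Longrightarrow> R' z y \<le> k * dist z y"
      using negtype_extend_point[OF fin _ _ R(1), of z "\<lambda>y. k * dist z y"] tri False by blast
    have "R' x y \<le> k * dist x y" if xy: "x \<in> insert z ?F" "y \<in> insert z ?F" for x y
    proof -
      consider "x = z" "y = z" | "x = z" "y \<in> ?F" | "x \<in> ?F" "y = z" | "x \<in> ?F" "y \<in> ?F"
        using xy by blast
      then show ?thesis
      proof cases
        case 3
        have "R' x y = R' z x" using negtype_on_sym[OF R'(1)] 3 by blast
        then show ?thesis using R'(3)[OF 3(1)] 3 by (simp add: dist_commute)
      qed (use R' R(3) negtype_on_diag[OF R'(1)] in auto)
    qed
    then show ?thesis using R R' by (intro exI[of _ R']) auto
  qed
qed

lemma finite_separated_net: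
  fixes F :: "'a::metric_space set"
  assumes "finite F"
  shows "\<exists>N\<subseteq>F. (\<forall>x\<in>N. \<forall>y\<in>N. x \<noteq> y \<longrightarrow> 1 \<le> dist x y) \<and> (\<forall>x\<in>F. \<exists>y\<in>N. dist x y < 1)"
  using assms
proof (induction F rule: finite_induct)
  case (insert z F)
  then obtain N where N: "N \<subseteq> F" "\<forall>x\<in>N. \<forall>y\<in>N. x \<noteq> y \<longrightarrow> 1 \<le> dist x y" "\<forall>x\<in>F. \<exists>y\<in>N. dist x y < 1"
    by blast
  show ?case
  proof (cases "\<exists>y\<in>N. dist z y < 1")
    case True
    then show ?thesis using N by (intro exI[of _ N]) auto
  next
    case False
    then have "\<forall>y\<in>N. 1 \<le> dist z y \<and> 1 \<le> dist y z" by (auto simp: dist_commute not_less)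
    then show ?thesis using N by (intro exI[of _ "insert z N"]) fastforce
  qed
qed auto


text \<open>On a finite set \<open>F\<close>, the kernel \<open>1 - exp (- N)\<close> restricted to a maximal 1-separated subset is at most
\<open>dist x y / 24\<close>: for distances up to 24 by the bound on \<open>N\<close>, beyond that because the kernel is at most 1. It
extends to \<open>F\<close> with the same bound. Two points at distance \<open>t\<close> have neighbours in the subset at a distance
within 2 of \<open>t\<close>, where the kernel is at least 1/2, and moving to the neighbours costs little.
Compactness passes from finite sets to the whole space.\<close>

lemma negtype_smoothing:
  fixes N :: "'a::metric_space \<Rightarrow> 'a \<Rightarrow> real"
  assumes N: "negtype_on UNIV N"
    and up: "\<And>x y. dist x y \<le> 24 \<Longrightarrow> N x y \<le> 1 / 24"
    and low: "\<And>x y. \<bar>dist x y - t\<bar> \<le> 2 \<Longrightarrow> 1 \<le> N x y"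
  obtains Q :: "'a \<Rightarrow> 'a \<Rightarrow> real"
  where "negtype_on UNIV Q" "\<And>x y. Q x y \<le> dist x y / 24"
    "\<And>x y. dist x y = t \<Longrightarrow> 1 / 16 \<le> Q x y"
proof -
  define Q0 where "Q0 x y = 1 - exp (- N x y)" for x y
  have Q0: "negtype_on UNIV Q0" unfolding Q0_def by (rule negtype_on_one_minus_exp[OF N])
  have N0: "0 \<le> N x y" for x y using negtype_on_nonneg[OF N] by simp
  have Q0_le: "Q0 x y \<le> 1" "Q0 x y \<le> N x y" for x y
    using exp_ge_add_one_self[of "- N x y"] unfolding Q0_def by auto
  have Q0_ge: "1 / 2 \<le> Q0 x y" if "1 \<le> N x y" for x y
  proof -
    have "2 \<le> exp (N x y)" using exp_ge_add_one_self[of "N x y"] that by linarith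
    then have "exp (- N x y) \<le> inverse 2" unfolding exp_minus by (intro le_imp_inverse_le) auto
    then show ?thesis unfolding Q0_def by simp
  qed
  define D where "D F = {Q. negtype_on F Q} \<inter> {Q. \<forall>x\<in>F. \<forall>y\<in>F. dist x y = t \<longrightarrow> 1 / 16 \<le> Q x y}" for F :: "'a set"
  define S where "S = {Q. \<forall>x::'a. Q x \<in> {q. \<forall>y. q y \<in> {0..dist x y / 24}}}"
  have D: "\<exists>Q\<in>S. Q \<in> D F" if F: "finite F" for F
  proof -
    obtain M where M: "M \<subseteq> F" "\<forall>x\<in>M. \<forall>y\<in>M. x \<noteq> y \<longrightarrow> 1 \<le> dist x y" "\<forall>x\<in>F. \<exists>y\<in>M. dist x y < 1"
      using finite_separated_net[OF F] by blast
    have 1: "Q0 x y \<le> 1 / 24 * dist x y" if "x \<in> M" "y \<in> M" for x y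
    proof (cases "x = y")
      case True
      then show ?thesis using negtype_on_diag[OF Q0] by simp
    next
      case False
      then have "1 \<le> dist x y" using M that by blast
      then show ?thesis using up[of x y] Q0_le[of x y] by (cases "dist x y \<le> 24") auto
    qed
    obtain R where R: "negtype_on (M \<union> F) R" "\<forall>x\<in>M. \<forall>y\<in>M. R x y = Q0 x y"
      "\<forall>x\<in>M \<union> F. \<forall>y\<in>M \<union> F. R x y \<le> 1 / 24 * dist x y"
      using negtype_extend_finite[OF F finite_subset[OF M(1) F] negtype_on_subset[OF Q0 subset_UNIV], of "1 / 24"] 1
      by auto
    have MF: "M \<union> F = F" using M by auto
    note R = R[unfolded MF]
    have low_R: "1 / 16 \<le> R x y" if xy: "x \<in> F" "y \<in> F" "dist x y = t" for x y
    proof -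
      obtain x' y' where x': "x' \<in> M" "dist x x' < 1" and y': "y' \<in> M" "dist y y' < 1"
        using bspec[OF M(3) xy(1)] bspec[OF M(3) xy(2)] by blast
      have in_F: "x' \<in> F" "y' \<in> F" using M x' y' by auto
      have "\<bar>dist x' y' - t\<bar> \<le> 2"
        using x' y' xy(3) dist_triangle[of x y x'] dist_triangle[of x' y y'] dist_triangle[of x' y' x] dist_triangle[of x y' y]
        by (auto simp: dist_commute)
      then have "1 / 2 \<le> R x' y'" using low Q0_ge R(2) x' y' by simp
      also have "\<dots> \<le> 2 * R x' x + 2 * R x y'"
        by (rule negtype_on_triangle[OF R(1)]) (use in_F xy in auto)
      also have "R x y' \<le> 2 * R x y + 2 * R y y'"
        by (rule negtype_on_triangle[OF R(1)]) (use in_F xy in auto)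
      finally have "1 / 2 \<le> 2 * R x' x + (4 * R x y + 4 * R y y')" by simp
      moreover have "R x' x \<le> 1 / 24 * dist x' x" "R y y' \<le> 1 / 24 * dist y y'" using R(3) in_F xy by blast+
      ultimately show ?thesis using x' y' by (simp add: dist_commute)
    qed
    define Q where "Q x y = (if x \<in> F \<and> y \<in> F then R x y else 0)" for x y
    have "negtype_on F Q" using R(1) unfolding Q_def by (simp cong: negtype_on_cong)
    then have "Q \<in> D F" using low_R by (auto simp: D_def Q_def)
    moreover have "Q \<in> S" using R(3) negtype_on_nonneg[OF R(1)] by (auto simp: S_def Q_def)
    ultimately show ?thesis by blast
  qed
  have "compact S" unfolding S_def by (intro compact_box) auto
  have "S \<inter> (\<Inter>F\<in>{F. finite F}. D F) \<noteq> {}"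
  proof (rule compact_imp_fip_image[OF \<open>compact S\<close>])
    show "closed (D F)" for F unfolding D_def Ball_def
      by (intro closed_Int closed_negtype closed_Collect_all closed_Collect_imp open_Collect_const
          closed_Collect_le continuous_intros continuous_on_apply2)
    fix I assume I: "finite I" "I \<subseteq> {F::'a set. finite F}"
    then obtain Q where Q: "Q \<in> S" "Q \<in> D (\<Union>I)" using D[of "\<Union>I"] by auto
    have "Q \<in> D F" if "F \<in> I" for F
      using Q(2) that negtype_on_subset[of "\<Union>I" Q F] unfolding D_def by blast
    then show "S \<inter> (\<Inter>F\<in>I. D F) \<noteq> {}" using Q by blast
  qed
  then obtain Q where Q: "Q \<in> S" "\<And>F. finite F \<Longrightarrow> Q \<in> D F" by auto
  have "negtype_on UNIV Q"
  proof (rule negtype_onI)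
    fix x y show "Q x x = 0" "Q x y = Q y x"
      using Q(2)[of "{x, y}"] by (auto simp: D_def dest: negtype_on_diag negtype_on_sym)
  next
    fix n :: nat and x and c :: "nat \<Rightarrow> real" assume c: "(\<Sum>i<n. c i) = 0"
    have "negtype_on (x ` {..<n}) Q" using Q(2)[of "x ` {..<n}"] by (simp add: D_def)
    then show "quad_form {..<n} c (\<lambda>i j. Q (x i) (x j)) \<le> 0"
      by (rule negtype_onD) (use c in auto)
  qed
  moreover have "Q x y \<le> dist x y / 24" for x y using Q(1) by (auto simp: S_def)
  moreover have "1 / 16 \<le> Q x y" if "dist x y = t" for x y
    using Q(2)[of "{x, y}"] that by (auto simp: D_def)
  ultimately show thesis by (rule that)
qed

section \<open>Translation invariant kernels\<close>

definition translate_avg :: "'a::real_vector \<Rightarrow> nat \<Rightarrow> ('a \<Rightarrow> 'a \<Rightarrow> real) \<Rightarrow> 'a \<Rightarrow> 'a \<Rightarrow> real"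
  where "translate_avg g n Q x y = (\<Sum>i\<le>n. Q (x + real i *\<^sub>R g) (y + real i *\<^sub>R g)) / real (Suc n)"

lemma translate_avg_commute:
  "translate_avg g n (translate_avg h m Q) = translate_avg h m (translate_avg g n Q)"
proof (intro ext)
  fix x y
  let ?q = "\<lambda>i j. Q (x + real i *\<^sub>R g + real j *\<^sub>R h) (y + real i *\<^sub>R g + real j *\<^sub>R h)"
  have "translate_avg g n (translate_avg h m Q) x y = (\<Sum>i\<le>n. \<Sum>j\<le>m. ?q i j) / real (Suc m) / real (Suc n)"
    by (simp add: translate_avg_def sum_divide_distrib)
  also have "\<dots> = (\<Sum>j\<le>m. \<Sum>i\<le>n. ?q i j) / real (Suc n) / real (Suc m)"
    by (subst sum.swap) (simp add: mult.commute)
  also have "\<dots> = translate_avg h m (translate_avg g n Q) x y"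
    by (simp add: translate_avg_def sum_divide_distrib add_ac)
  finally show "translate_avg g n (translate_avg h m Q) x y = translate_avg h m (translate_avg g n Q) x y" .
qed

lemma translate_avg_mem:
  assumes convex: "\<And>P Q u. P \<in> C \<Longrightarrow> Q \<in> C \<Longrightarrow> 0 \<le> u \<Longrightarrow> u \<le> 1 \<Longrightarrow> (\<lambda>x y. (1 - u) * P x y + u * Q x y) \<in> C"
    and trans: "\<And>Q g. Q \<in> C \<Longrightarrow> (\<lambda>x y. Q (x + g) (y + g)) \<in> C"
    and Q: "Q \<in> C"
  shows "translate_avg g n Q \<in> C"
proof (induction n)
  case 0
  then show ?case using Q by (simp add: translate_avg_def)
next
  case (Suc n)
  define u where "u = 1 / real (Suc (Suc n))"
  have mem: "(\<lambda>x y. (1 - u) * translate_avg g n Q x y + u * Q (x + real (Suc n) *\<^sub>R g) (y + real (Suc n) *\<^sub>R g)) \<in> C"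
    by (intro convex Suc trans Q) (auto simp: u_def)
  have eq: "(1 - u) * translate_avg g n Q x y + u * Q (x + real (Suc n) *\<^sub>R g) (y + real (Suc n) *\<^sub>R g)
      = translate_avg g (Suc n) Q x y" for x y
  proof -
    have "1 - u = real (Suc n) / real (Suc (Suc n))" by (simp add: u_def field_simps)
    then have "(1 - u) * translate_avg g n Q x y = (\<Sum>i\<le>n. Q (x + real i *\<^sub>R g) (y + real i *\<^sub>R g)) / real (Suc (Suc n))"
      by (simp add: translate_avg_def del: of_nat_Suc)
    then show ?thesis by (simp add: translate_avg_def u_def add_divide_distrib del: of_nat_Suc)
  qed
  show ?case using mem unfolding eq .
qed

lemma translate_avg_almost_invariant:
  assumes "\<And>x y. \<bar>Q x y\<bar> \<le> b (x - y)"
  shows "\<bar>translate_avg g n Q (x + g) (y + g) - translate_avg g n Q x y\<bar> \<le> 2 * b (x - y) / real (Suc n)"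
proof -
  define q where "q i = Q (x + real i *\<^sub>R g) (y + real i *\<^sub>R g)" for i :: nat
  have "translate_avg g n Q (x + g) (y + g) = (\<Sum>i\<le>n. q (Suc i)) / real (Suc n)"
    by (simp add: translate_avg_def q_def algebra_simps)
  moreover have "translate_avg g n Q x y = (\<Sum>i\<le>n. q i) / real (Suc n)"
    by (simp add: translate_avg_def q_def)
  moreover have "(\<Sum>i\<le>n. q (Suc i)) - (\<Sum>i\<le>n. q i) = q (Suc n) - q 0"
    by (simp add: sum_subtractf[symmetric] sum_telescope'' atMost_atLeast0 sum_Suc_diff)
  ultimately have "translate_avg g n Q (x + g) (y + g) - translate_avg g n Q x y = (q (Suc n) - q 0) / real (Suc n)"
    by (metis diff_divide_distrib)
  moreover have "\<bar>q (Suc n) - q 0\<bar> \<le> 2 * b (x - y)"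
    using assms[of "x + real (Suc n) *\<^sub>R g" "y + real (Suc n) *\<^sub>R g"] assms[of x y]
    unfolding q_def by simp
  ultimately show ?thesis by (simp add: divide_right_mono del: of_nat_Suc)
qed

text \<open>The fixed point theorem of Markov and Kakutani for the translations. Averages along a direction \<open>g\<close> map \<open>C\<close>
into itself, commute, and produce kernels that are nearly invariant under \<open>g\<close>. Composing finitely many of
them gives a kernel nearly invariant in finitely many directions; compactness does the rest.\<close>

lemma invariant_kernel:
  fixes C :: "('a::real_vector \<Rightarrow> 'a \<Rightarrow> real) set"
  assumes closed: "closed C" and ne: "C \<noteq> {}"
    and convex: "\<And>P Q u. P \<in> C \<Longrightarrow> Q \<in> C \<Longrightarrow> 0 \<le> u \<Longrightarrow> u \<le> 1 \<Longrightarrow> (\<lambda>x y. (1 - u) * P x y + u * Q x y) \<in> C"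
    and trans: "\<And>Q g. Q \<in> C \<Longrightarrow> (\<lambda>x y. Q (x + g) (y + g)) \<in> C"
    and bound: "\<And>Q x y. Q \<in> C \<Longrightarrow> \<bar>Q x y\<bar> \<le> b (x - y)"
  obtains Q where "Q \<in> C" "\<And>x y g. Q (x + g) (y + g) = Q x y"
proof -
  define S where "S = {Q. \<forall>x::'a. Q x \<in> {q. \<forall>y. q y \<in> {- b (x - y)..b (x - y)}}} \<inter> C"
  define D where "D i = {Q. \<forall>x y. \<bar>Q (x + fst i) (y + fst i) - Q x y\<bar> \<le> 2 * b (x - y) / real (Suc (snd i))}"
    for i :: "'a \<times> nat"
  have "- b (x - y) \<le> Q x y \<and> Q x y \<le> b (x - y)" if "Q \<in> C" for Q x y
    using bound[OF that, of x y] by linarith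
  then have SC: "S = C" by (auto simp: S_def)
  have "compact S" unfolding S_def
    by (intro compact_Int_closed closed compact_box) auto
  then have "compact C" unfolding SC .
  have "C \<inter> (\<Inter>i\<in>UNIV. D i) \<noteq> {}"
  proof (rule compact_imp_fip_image[OF \<open>compact C\<close>])
    show "closed (D i)" for i unfolding D_def
      by (intro closed_Collect_all closed_Collect_le continuous_intros continuous_on_apply2)
    fix I :: "('a \<times> nat) set" assume "finite I"
    then have "\<exists>Q\<in>C. \<forall>i\<in>I. \<exists>R\<in>C. Q = translate_avg (fst i) (snd i) R"
    proof (induction I rule: finite_induct)
      case empty
      then show ?case using ne by blast
    next
      case (insert j I)
      then obtain Q where Q: "Q \<in> C" "\<And>i. i \<in> I \<Longrightarrow> \<exists>R\<in>C. Q = translate_avg (fst i) (snd i) R" by blast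
      let ?T = "translate_avg (fst j) (snd j)"
      have mem: "?T R \<in> C" if "R \<in> C" for R by (rule translate_avg_mem[OF convex trans that])
      have "\<exists>R\<in>C. ?T Q = translate_avg (fst i) (snd i) R" if "i \<in> I" for i
        using Q(2)[OF that] mem translate_avg_commute by metis
      then show ?case using Q(1) mem by (intro bexI[of _ "?T Q"]) auto
    qed
    then obtain Q where Q: "Q \<in> C" "\<forall>i\<in>I. \<exists>R\<in>C. Q = translate_avg (fst i) (snd i) R" by blast
    have "Q \<in> D i" if i: "i \<in> I" for i
    proof -
      obtain R where R: "R \<in> C" "Q = translate_avg (fst i) (snd i) R" using Q(2) i by blast
      show ?thesis unfolding D_def R(2)
        using translate_avg_almost_invariant[of R b, OF bound[OF R(1)]] by blast
    qed
    then show "C \<inter> (\<Inter>i\<in>I. D i) \<noteq> {}" using Q by blast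
  qed
  then obtain Q where Q: "Q \<in> C" "\<And>i. Q \<in> D i" by auto
  have "Q (x + g) (y + g) = Q x y" for x y g
  proof -
    have "\<bar>Q (x + g) (y + g) - Q x y\<bar> \<le> 2 * b (x - y) / real (Suc n)" for n
      using Q(2)[of "(g, n)"] by (simp add: D_def)
    moreover have "(\<lambda>n. 2 * b (x - y) / real (Suc n)) \<longlonglongrightarrow> 0"
      by (rule LIMSEQ_Suc) (rule lim_const_over_n)
    ultimately have "\<bar>Q (x + g) (y + g) - Q x y\<bar> \<le> 0"
      by (intro tendsto_lowerbound[of "\<lambda>n. 2 * b (x - y) / real (Suc n)" 0 sequentially]) auto
    then show ?thesis by simp
  qed
  with Q(1) that show thesis by blast
qed

text \<open>The conditions on the kernel are convex, pointwise closed and invariant under translations, so the fixed point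
theorem applies to the set of kernels satisfying them.\<close>

lemma translation_invariant_negtype:
  fixes Q :: "'a::real_normed_vector \<Rightarrow> 'a \<Rightarrow> real"
  assumes Q: "negtype_on UNIV Q" and up: "\<And>x y. Q x y \<le> w (norm (x - y))"
    and low: "\<And>x y. norm (x - y) = t \<Longrightarrow> c \<le> Q x y"
  obtains q where "negtype_on UNIV (\<lambda>x y::'a. q (x - y))" "\<And>x. q x \<le> w (norm x)"
    "\<And>x. norm x = t \<Longrightarrow> c \<le> q x"
proof -
  define C where "C = {R. negtype_on UNIV R} \<inter> {R. \<forall>x y. R x y \<le> w (norm (x - y))}
    \<inter> {R. \<forall>x y::'a. norm (x - y) = t \<longrightarrow> c \<le> R x y}"
  have cl: "closed C" unfolding C_def
    by (intro closed_Int closed_negtype closed_Collect_all closed_Collect_imp open_Collect_const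
          closed_Collect_le continuous_intros continuous_on_apply2)
  have ne: "C \<noteq> {}" using assms by (auto simp: C_def)
  have conv: "(\<lambda>x y. (1 - u) * P x y + u * R x y) \<in> C"
    if "P \<in> C" "R \<in> C" "0 \<le> u" "u \<le> 1" for P R u
  proof -
    have "(1 - u) * P x y + u * R x y \<le> (1 - u) * w (norm (x - y)) + u * w (norm (x - y))" for x y
      using that by (intro add_mono mult_left_mono) (auto simp: C_def)
    moreover have "(1 - u) * c + u * c \<le> (1 - u) * P x y + u * R x y" if "norm (x - y) = t" for x y
      using that \<open>P \<in> C\<close> \<open>R \<in> C\<close> \<open>0 \<le> u\<close> \<open>u \<le> 1\<close> by (intro add_mono mult_left_mono) (auto simp: C_def)
    moreover have "(1 - u) * z + u * z = z" for z :: real by (simp add: algebra_simps)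
    ultimately show ?thesis
      using that by (auto simp: C_def intro!: negtype_on_add negtype_on_scale)
  qed
  have trans: "(\<lambda>x y. R (x + g) (y + g)) \<in> C" if R: "R \<in> C" for R g
  proof -
    have "R (x + g) (y + g) \<le> w (norm (x - y))" for x y
      using R unfolding C_def by (metis (mono_tags, lifting) Int_iff mem_Collect_eq add_diff_cancel_right)
    moreover have "c \<le> R (x + g) (y + g)" if "norm (x - y) = t" for x y
      using R that unfolding C_def by (metis (mono_tags, lifting) Int_iff mem_Collect_eq add_diff_cancel_right)
    moreover have "negtype_on UNIV (\<lambda>x y. R (x + g) (y + g))"
      by (rule negtype_on_pullback[of UNIV]) (use R in \<open>auto simp: C_def\<close>)
    ultimately show ?thesis by (auto simp: C_def)
  qed
  have bound: "\<bar>R x y\<bar> \<le> w (norm (x - y))" if "R \<in> C" for R x y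
    using that negtype_on_nonneg[of UNIV R x y] by (auto simp: C_def)
  obtain R where R: "R \<in> C" "\<And>x y g. R (x + g) (y + g) = R x y"
    using invariant_kernel[OF cl ne conv trans, of "\<lambda>z. w (norm z)"] bound by blast
  have eq: "R x y = R (x - y) 0" for x y using R(2)[of "x - y" y 0] by simp
  have "negtype_on UNIV (\<lambda>x y. R (x - y) 0)" using R(1) unfolding eq[symmetric] C_def by simp
  moreover have "R x 0 \<le> w (norm x)" for x using R(1) unfolding C_def by (metis (mono_tags, lifting) Int_iff mem_Collect_eq diff_zero)
  moreover have "c \<le> R x 0" if "norm x = t" for x using R(1) that unfolding C_def by (metis (mono_tags, lifting) Int_iff mem_Collect_eq diff_zero)
  ultimately show thesis by (rule that)
qed

section \<open>Means along rays\<close>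

text \<open>The second condition is continuity at 0, since \<open>q\<close> is nonnegative and vanishes at 0.\<close>

locale negtype_function =
  fixes q :: "'a::real_normed_vector \<Rightarrow> real"
  assumes negtype: "negtype_on UNIV (\<lambda>x y. q (x - y))"
    and small: "\<And>e. 0 < e \<Longrightarrow> \<exists>d>0. \<forall>x. norm x < d \<longrightarrow> q x \<le> e"
begin

lemma nonneg: "0 \<le> q x"
  using negtype_on_nonneg[OF negtype, of x 0] by simp

lemma minus: "q (- x) = q x"
  using negtype_on_sym[OF negtype, of x 0] by simp

lemma add_le: "q (x + y) \<le> 2 * q x + 2 * q y"
  using negtype_on_triangle[OF negtype, of "x + y" y 0] by simp

lemma power2_le: "q (2 ^ j *\<^sub>R x) \<le> 4 ^ j * q x"
proof (induction j)
  case (Suc j)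
  have "q (2 ^ Suc j *\<^sub>R x) \<le> 4 * q (2 ^ j *\<^sub>R x)"
    using add_le[of "2 ^ j *\<^sub>R x" "2 ^ j *\<^sub>R x"] by (simp flip: scaleR_add_left)
  then show ?case using Suc by simp
qed simp

lemma continuous: "continuous_on UNIV q"
  unfolding continuous_on_iff
proof (intro ballI allI impI)
  fix x :: 'a and \<eta> :: real assume \<eta>: "0 < \<eta>"
  define e where "e = \<eta> / (8 * (q x + 1))"
  have e: "0 < e" "e * (2 * q x + 2) = \<eta> / 4" using \<eta> nonneg[of x] by (simp_all add: e_def field_simps)
  define b where "b = min 1 (\<eta> / (2 * (1 + 1 / e)))"
  have b: "0 < b" "b \<le> 1" "(1 + 1 / e) * b \<le> \<eta> / 2"
  proof -
    have "(1 + 1 / e) * b \<le> (1 + 1 / e) * (\<eta> / (2 * (1 + 1 / e)))"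
      unfolding b_def using e by (intro mult_left_mono) auto
    also have "\<dots> = \<eta> / 2"
    proof -
      have "k * (\<eta> / (2 * k)) = \<eta> / 2" if "0 < k" for k using that by simp
      then show ?thesis using e by (simp only: add_pos_pos zero_less_one zero_less_divide_1_iff)
    qed
    finally show "(1 + 1 / e) * b \<le> \<eta> / 2" .
    show "0 < b" "b \<le> 1" using e \<eta> by (auto simp: b_def add_pos_pos)
  qed
  obtain d where d: "d > 0" "\<And>z. norm z < d \<Longrightarrow> q z \<le> b" using small[OF b(1)] by blast
  have "dist (q y) (q x) < \<eta>" if "dist y x < d" for y
  proof -
    have xy: "q (x - y) \<le> b" using d(2)[of "x - y"] that by (simp add: dist_norm norm_minus_commute)
    then have yx: "q (y - x) \<le> b" using minus[of "x - y"] by simp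
    have "q y \<le> (1 + e) * q x + (1 + 1 / e) * q (y - x)"
      using negtype_on_triangle_weighted[OF negtype, of y x 0 e] e by simp
    also have "\<dots> \<le> (1 + e) * q x + \<eta> / 2"
      using yx b e by (smt (verit) mult_left_mono divide_nonneg_pos)
    finally have 1: "q y - q x \<le> e * q x + \<eta> / 2" by (simp add: algebra_simps)
    have "q y \<le> 2 * q x + 2 * b" using add_le[of x "y - x"] yx by simp
    then have qy: "e * q y \<le> \<eta> / 4" using e b by (smt (verit) mult_left_mono)
    have "q x \<le> (1 + e) * q y + (1 + 1 / e) * q (x - y)"
      using negtype_on_triangle_weighted[OF negtype, of x y 0 e] e by simp
    also have "\<dots> \<le> (1 + e) * q y + \<eta> / 2"
      using xy b e by (smt (verit) mult_left_mono divide_nonneg_pos)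
    finally have 2: "q x - q y \<le> e * q y + \<eta> / 2" by (simp add: algebra_simps)
    have "e * q x \<le> \<eta> / 4" using e nonneg[of x] by (smt (verit) mult_left_mono)
    then show ?thesis using 1 2 qy \<eta> by (simp add: dist_real_def)
  qed
  then show "\<exists>d>0. \<forall>y\<in>UNIV. dist y x < d \<longrightarrow> dist (q y) (q x) < \<eta>" using d by blast
qed

definition ray_avg :: "'a \<Rightarrow> real"
  where "ray_avg x = integral {0..1} (\<lambda>s. q (s *\<^sub>R x))"

lemma continuous_on_ray: "continuous_on S (\<lambda>s. q (s *\<^sub>R x))"
  by (intro continuous_on_compose2[OF continuous] continuous_intros) auto

lemma integrable_ray: "(\<lambda>s. q (s *\<^sub>R x)) integrable_on {a..b}"
  by (intro integrable_continuous_interval continuous_on_ray)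

text \<open>Points \<open>s x\<close> and \<open>(s + h) x\<close> differ by \<open>h x\<close>, so \<open>q\<close> cannot be small at both of them when \<open>q (h x)\<close> is
not. Integrate this over the first half of the segment.\<close>

lemma ray_avg_ge:
  assumes "0 \<le> h" "h \<le> 1 / 2"
  shows "q (h *\<^sub>R x) / 8 \<le> ray_avg x"
proof -
  let ?f = "\<lambda>s. q (s *\<^sub>R x)"
  have sub: "integral {a..b} ?f \<le> ray_avg x" if "0 \<le> a" "b \<le> 1" for a b
    unfolding ray_avg_def using that by (intro integral_subset_le integrable_ray) (auto simp: nonneg)
  have shift: "integral {0..1 / 2} (\<lambda>s. ?f (s + h)) = integral {h..1 / 2 + h} ?f"
    using integral_shift_real_ivl[of h h "1 / 2 + h" ?f] by simp
  have int: "(\<lambda>s. ?f (s + h)) integrable_on {0..1 / 2}"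
    by (intro integrable_continuous_interval continuous_on_compose2[OF continuous] continuous_intros) auto
  have "q (h *\<^sub>R x) / 2 = integral {0..1 / 2} (\<lambda>s::real. q (h *\<^sub>R x))" by simp
  also have "\<dots> \<le> integral {0..1 / 2} (\<lambda>s. 2 * ?f (s + h) + 2 * ?f s)"
  proof (rule integral_le)
    fix s show "q (h *\<^sub>R x) \<le> 2 * ?f (s + h) + 2 * ?f s"
      using add_le[of "(s + h) *\<^sub>R x" "- (s *\<^sub>R x)"] by (simp add: minus algebra_simps)
  qed (intro integrable_ray int integrable_add integrable_on_mult_right integrable_const_ivl)+
  also have "\<dots> = 2 * integral {h..1 / 2 + h} ?f + 2 * integral {0..1 / 2} ?f"
    using int integrable_ray by (simp add: integral_add integrable_on_mult_right shift)
  also have "\<dots> \<le> 2 * ray_avg x + 2 * ray_avg x"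
    using assms by (intro add_mono mult_left_mono sub) auto
  finally show ?thesis by simp
qed

text \<open>Halving \<open>j\<close> times a vector of length \<open>t\<close> costs at most a factor \<open>4 ^ j\<close> in the value of \<open>q\<close>. Choose \<open>j\<close>
so large that the halved vectors have length at most \<open>r / 2\<close>, and apply the previous estimate. The bound does
not depend on the length of \<open>x\<close>.\<close>

lemma ray_avg_lower:
  assumes t: "0 < t" and c: "0 < c" "\<And>x. norm x = t \<Longrightarrow> c \<le> q x" and r: "0 < r"
  obtains b where "0 < b" "\<And>x. r \<le> norm x \<Longrightarrow> b \<le> ray_avg x"
proof -
  obtain j :: nat where j: "2 * t / r < 2 ^ j" using real_arch_pow[of 2] by auto
  have "c / (8 * 4 ^ j) \<le> ray_avg x" if x: "r \<le> norm x" for x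
  proof -
    define h where "h = t / (2 ^ j * norm x)"
    have nx: "0 < norm x" using x r by linarith
    have "2 * t \<le> 2 ^ j * r" using j r by (simp add: field_simps)
    also have "\<dots> \<le> 2 ^ j * norm x" using x by simp
    finally have h: "0 \<le> h" "h \<le> 1 / 2" using nx t by (simp_all add: h_def field_simps)
    have "norm (2 ^ j *\<^sub>R (h *\<^sub>R x)) = t" using nx t by (simp add: h_def)
    then have "c \<le> 4 ^ j * q (h *\<^sub>R x)" using c(2) power2_le[of j "h *\<^sub>R x"] by fastforce
    then have "c / (8 * 4 ^ j) \<le> q (h *\<^sub>R x) / 8" by (simp add: field_simps)
    then show ?thesis using ray_avg_ge[OF h, of x] by linarith
  qed
  then show thesis using that[of "c / (8 * 4 ^ j)"] c by simp
qed

lemma negtype_function_ray_avg: "negtype_function ray_avg"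
proof
  show "negtype_on UNIV (\<lambda>x y. ray_avg (x - y))"
  proof (rule negtype_onI)
    show "ray_avg (x - x) = 0" for x using negtype_on_diag[OF negtype, of 0] by (simp add: ray_avg_def)
    show "ray_avg (x - y) = ray_avg (y - x)" for x y
    proof -
      have "q (s *\<^sub>R (x - y)) = q (s *\<^sub>R (y - x))" for s
        using minus[of "s *\<^sub>R (x - y)"] by (simp flip: scaleR_minus_right)
      then show ?thesis by (simp add: ray_avg_def)
    qed
    fix n :: nat and x :: "nat \<Rightarrow> 'a" and c :: "nat \<Rightarrow> real" assume c: "(\<Sum>i<n. c i) = 0"
    have "quad_form {..<n} c (\<lambda>i j. ray_avg (x i - x j))
      = integral {0..1} (\<lambda>s. quad_form {..<n} c (\<lambda>i j. q (s *\<^sub>R x i - s *\<^sub>R x j)))"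
      unfolding quad_form_def ray_avg_def scaleR_diff_right[symmetric]
      by (simp add: integral_sum integrable_sum integrable_ray integrable_on_mult_right)
    also have "\<dots> \<le> integral {0..1::real} (\<lambda>s. 0)"
    proof (rule integral_le)
      show "(\<lambda>s. quad_form {..<n} c (\<lambda>i j. q (s *\<^sub>R x i - s *\<^sub>R x j))) integrable_on {0..1}"
        unfolding quad_form_def scaleR_diff_right[symmetric]
        by (intro integrable_sum integrable_ray integrable_on_mult_right finite_lessThan)
      fix s show "quad_form {..<n} c (\<lambda>i j. q (s *\<^sub>R x i - s *\<^sub>R x j)) \<le> 0"
        by (rule negtype_onD[OF negtype, of "{..<n}" "\<lambda>i. s *\<^sub>R x i"]) (use c in auto)
    qed auto
    finally show "quad_form {..<n} c (\<lambda>i j. ray_avg (x i - x j)) \<le> 0" by simp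
  qed
  fix e :: real assume "0 < e"
  then obtain d where d: "d > 0" "\<And>x. norm x < d \<Longrightarrow> q x \<le> e" using small by blast
  have "ray_avg x \<le> e" if "norm x < d" for x
  proof -
    have "ray_avg x \<le> integral {0..1::real} (\<lambda>s. e)" unfolding ray_avg_def
    proof (rule integral_le)
      fix s :: real assume s: "s \<in> {0..1}"
      then have "norm (s *\<^sub>R x) \<le> norm x" by (simp add: mult_left_le_one_le)
      then show "q (s *\<^sub>R x) \<le> e" using that by (intro d) auto
    qed (auto intro: integrable_ray)
    then show ?thesis by simp
  qed
  then show "\<exists>d>0. \<forall>x. norm x < d \<longrightarrow> ray_avg x \<le> e" using d(1) by blast
qed

end

section \<open>Separability\<close>

text \<open>Separability of \<open>\<ell>\<^sub>p\<close> in the form needed for a pigeonhole argument. The label of \<open>x\<close> records where the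
tail of \<open>x\<close> becomes small and the entries before it, rounded on a grid.\<close>

lemma lp_countable_partition:
  assumes p: "1 \<le> p" and d: "0 < d"
  obtains L :: "(nat \<Rightarrow> real) \<Rightarrow> nat \<times> int list"
  where "\<And>x y. x \<in> lp_carrier p \<Longrightarrow> y \<in> lp_carrier p \<Longrightarrow> L x = L y \<Longrightarrow> lp_norm p (\<lambda>n. x n - y n) < d"
proof -
  define k where "k = 1 + 2 * 2 powr p"
  have k: "0 < k" by (simp add: k_def add_pos_nonneg)
  define e where "e = d powr p / (2 * k)"
  have e: "0 < e" "e * k < d powr p" using d k by (simp_all add: e_def)
  have "\<exists>m. (\<Sum>n. \<bar>x (n + m)\<bar> powr p) < e" if x: "x \<in> lp_carrier p" for x
    using suminf_exist_split[OF e(1), of "\<lambda>n. \<bar>x n\<bar> powr p"] x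
    by (fastforce simp: lp_carrier_def abs_less_iff)
  then obtain m where m: "\<And>x. x \<in> lp_carrier p \<Longrightarrow> (\<Sum>n. \<bar>x (n + m x)\<bar> powr p) < e" by metis
  \<comment> \<open>The mesh \<open>1 / K k\<close> is fine enough for \<open>k\<close> rounding errors to have a sum of \<open>p\<close>-th powers of at most \<open>e\<close>.\<close>
  define K where "K k = max 1 (real k / e)" for k :: nat
  define L where "L x = (m x, map (\<lambda>n. \<lfloor>x n * K (m x)\<rfloor>) [0..<m x])" for x
  have "lp_norm p (\<lambda>n. x n - y n) < d" if x: "x \<in> lp_carrier p" and y: "y \<in> lp_carrier p" and L: "L x = L y" for x y
  proof -
    define M where "M = m x"
    have M: "m y = M" using L by (simp add: L_def M_def)
    have K: "1 \<le> K M" "real M \<le> e * K M" using e by (auto simp: K_def field_simps max_def)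
    have fl: "\<lfloor>x n * K M\<rfloor> = \<lfloor>y n * K M\<rfloor>" if "n < M" for n
      using L M that by (simp add: L_def M_def[symmetric])
    let ?s = "\<lambda>n. \<bar>x n - y n\<bar> powr p"
    have head: "?s n \<le> 1 / K M" if "n < M" for n
    proof -
      have "\<bar>x n * K M - y n * K M\<bar> \<le> 1" using fl[OF that] by linarith
      then have "\<bar>x n - y n\<bar> * K M \<le> 1" using K by (simp add: abs_mult flip: left_diff_distrib)
      then have 1: "\<bar>x n - y n\<bar> \<le> 1 / K M" using K by (simp add: field_simps)
      also have "\<dots> \<le> 1" using K by simp
      finally have "?s n \<le> \<bar>x n - y n\<bar> powr 1" using p by (intro powr_mono') auto
      then show ?thesis using 1 by simp
    qed
    have tail: "?s n \<le> 2 powr p * (\<bar>x n\<bar> powr p + \<bar>y n\<bar> powr p)" for n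
    proof -
      have "?s n \<le> (2 * max \<bar>x n\<bar> \<bar>y n\<bar>) powr p" using p by (intro powr_mono2) auto
      also have "\<dots> = 2 powr p * max \<bar>x n\<bar> \<bar>y n\<bar> powr p" by (simp add: powr_mult)
      also have "\<dots> \<le> 2 powr p * (\<bar>x n\<bar> powr p + \<bar>y n\<bar> powr p)" by (intro mult_left_mono) (auto simp: max_def)
      finally show ?thesis .
    qed
    have sx: "summable (\<lambda>n. \<bar>x n\<bar> powr p)" and sy: "summable (\<lambda>n. \<bar>y n\<bar> powr p)" and ss: "summable ?s"
      using x y lp_diff_mem[OF p x y] by (auto simp: lp_carrier_def)
    have sx': "summable (\<lambda>n. \<bar>x (n + M)\<bar> powr p)" and sy': "summable (\<lambda>n. \<bar>y (n + M)\<bar> powr p)"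
      and ss': "summable (\<lambda>n. ?s (n + M))"
      using sx sy ss by (simp_all only: summable_iff_shift[where f = "\<lambda>n. \<bar>x n\<bar> powr p"]
          summable_iff_shift[where f = "\<lambda>n. \<bar>y n\<bar> powr p"] summable_iff_shift[where f = ?s])
    have "(\<Sum>n. ?s (n + M)) \<le> (\<Sum>n. 2 powr p * (\<bar>x (n + M)\<bar> powr p + \<bar>y (n + M)\<bar> powr p))"
      by (intro suminf_le ss' summable_mult summable_add sx' sy' tail)
    also have "\<dots> = 2 powr p * ((\<Sum>n. \<bar>x (n + M)\<bar> powr p) + (\<Sum>n. \<bar>y (n + M)\<bar> powr p))"
      by (simp add: suminf_mult suminf_add summable_add sx' sy')
    also have "\<dots> \<le> 2 powr p * (e + e)"
      using m[OF x] m[OF y] M by (intro mult_left_mono add_mono) (auto simp: M_def)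
    finally have T: "(\<Sum>n. ?s (n + M)) \<le> 2 powr p * (e + e)" .
    have "(\<Sum>n<M. ?s n) \<le> (\<Sum>n<M. 1 / K M)" by (intro sum_mono head) auto
    also have "\<dots> \<le> e" using K by (simp add: field_simps)
    finally have "(\<Sum>n. ?s n) \<le> e * k"
      using T suminf_split_initial_segment[OF ss, of M] by (simp add: k_def algebra_simps)
    then have "lp_norm p (\<lambda>n. x n - y n) powr p < d powr p"
      using e(2) lp_norm_powr[OF p lp_diff_mem[OF p x y]] by simp
    then show ?thesis using p d by (meson lp_norm_nonneg not_less powr_mono2 order_trans zero_le_one less_imp_le)
  qed
  then show thesis by (rule that)
qed

lemma maximal_separated_set:
  fixes B :: "'a::metric_space set"
  obtains M where "M \<subseteq> B" "\<And>x y. x \<in> M \<Longrightarrow> y \<in> M \<Longrightarrow> x \<noteq> y \<Longrightarrow> r \<le> dist x y"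
    "\<And>x. x \<in> B \<Longrightarrow> 0 < r \<Longrightarrow> \<exists>y\<in>M. dist x y < r"
proof -
  define A where "A = {M. M \<subseteq> B \<and> (\<forall>x\<in>M. \<forall>y\<in>M. x \<noteq> y \<longrightarrow> r \<le> dist x y)}"
  have "\<exists>M\<in>A. \<forall>X\<in>A. M \<subseteq> X \<longrightarrow> X = M"
  proof (rule subset_Zorn')
    fix C assume C: "subset.chain A C"
    have "r \<le> dist x y" if "X \<in> C" "Y \<in> C" "x \<in> X" "y \<in> Y" "x \<noteq> y" for x y X Y
    proof -
      have "X \<subseteq> Y \<or> Y \<subseteq> X" and "X \<in> A" "Y \<in> A"
        using C that by (auto simp: subset.chain_def)
      then show ?thesis using that by (auto simp: A_def)
    qed
    moreover have "\<Union>C \<subseteq> B" using C by (auto simp: subset.chain_def A_def)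
    ultimately show "\<Union>C \<in> A" by (auto simp: A_def)
  qed
  then obtain M where M: "M \<in> A" "\<And>X. X \<in> A \<Longrightarrow> M \<subseteq> X \<Longrightarrow> X = M" by blast
  have "\<exists>y\<in>M. dist x y < r" if x: "x \<in> B" "0 < r" for x
  proof (rule ccontr)
    assume "\<not> ?thesis"
    then have far: "\<forall>y\<in>M. r \<le> dist x y \<and> r \<le> dist y x" by (auto simp: not_less dist_commute)
    then have "insert x M \<in> A" using M(1) x by (auto simp: A_def)
    then have "x \<in> M" using M(2)[of "insert x M"] by blast
    then show False using far x by auto
  qed
  with M(1) that show thesis by (auto simp: A_def)
qed

text \<open>Otherwise the countable maximal separated subsets of the ball, for finer and finer separation, form a countable
dense subset of the ball, whose integer multiples are dense in the whole space.\<close>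

lemma nonseparable_imp_separated:
  assumes ns: "\<not> (\<exists>D::'a::real_normed_vector set. countable D \<and> closure D = UNIV)"
  obtains r :: real and S :: "'a::real_normed_vector set" where "0 < r" "uncountable S" "S \<subseteq> cball 0 1"
    "\<And>x y. x \<in> S \<Longrightarrow> y \<in> S \<Longrightarrow> x \<noteq> y \<Longrightarrow> r \<le> dist x y"
proof -
  have "\<exists>r>0. \<exists>S\<subseteq>cball (0::'a) 1. uncountable S \<and> (\<forall>x\<in>S. \<forall>y\<in>S. x \<noteq> y \<longrightarrow> r \<le> dist x y)"
  proof (rule ccontr)
    assume none: "\<not> ?thesis"
    have "\<exists>M\<subseteq>cball (0::'a) 1. countable M \<and> (\<forall>x\<in>cball 0 1. \<exists>y\<in>M. dist x y < 1 / real (Suc n))" for n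
    proof -
      obtain M where M: "M \<subseteq> cball (0::'a) 1" "\<And>x y. x \<in> M \<Longrightarrow> y \<in> M \<Longrightarrow> x \<noteq> y \<Longrightarrow> 1 / real (Suc n) \<le> dist x y"
        "\<And>x. x \<in> cball 0 1 \<Longrightarrow> 0 < 1 / real (Suc n) \<Longrightarrow> \<exists>y\<in>M. dist x y < 1 / real (Suc n)"
        using maximal_separated_set[of "cball (0::'a) 1" "1 / real (Suc n)"] by blast
      have "countable M"
      proof (rule ccontr)
        assume "uncountable M"
        moreover have "0 < 1 / real (Suc n)" by simp
        ultimately show False using none M(1,2) by blast
      qed
      then show ?thesis using M by (intro exI[of _ M]) auto
    qed
    then obtain M where M: "\<And>n. countable (M n)"
      "\<And>n x::'a. x \<in> cball 0 1 \<Longrightarrow> \<exists>y\<in>M n. dist x y < 1 / real (Suc n)" by metis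
    define D where "D = (\<Union>k. \<Union>n. (\<lambda>y. real k *\<^sub>R y) ` M n)"
    have "countable D" unfolding D_def using M by (intro countable_UN countable_image) auto
    moreover have "x \<in> closure D" for x
      unfolding closure_approachable
    proof (intro allI impI)
      fix e :: real assume e: "0 < e"
      obtain k :: nat where k: "norm x < real k" using reals_Archimedean2 by blast
      then have k0: "0 < real k" using norm_ge_zero[of x] by linarith
      obtain n where n: "real k / e < real n" using reals_Archimedean2 by blast
      have "(1 / real k) *\<^sub>R x \<in> cball 0 1" using k k0 by (simp add: field_simps)
      then obtain y where y: "y \<in> M n" "dist ((1 / real k) *\<^sub>R x) y < 1 / real (Suc n)" using M(2) by blast
      have "dist (real k *\<^sub>R y) x = real k * dist ((1 / real k) *\<^sub>R x) y"
      proof -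
        have "x = real k *\<^sub>R ((1 / real k) *\<^sub>R x)" using k0 by simp
        then have "dist (real k *\<^sub>R y) x = norm (real k *\<^sub>R (y - (1 / real k) *\<^sub>R x))"
          by (metis dist_norm scaleR_diff_right)
        then show ?thesis by (simp add: dist_norm norm_minus_commute)
      qed
      also have "\<dots> < real k * (1 / real (Suc n))" using y k0 by (intro mult_strict_left_mono)
      also have "\<dots> < e" using n e by (simp add: field_simps)
      finally show "\<exists>y\<in>D. dist y x < e" using y unfolding D_def by blast
    qed
    ultimately show False using ns by blast
  qed
  then show thesis using that by blast
qed

text \<open>Suppose the space is not separable, and let \<open>r\<close> be nearly the largest number for which the unit ball has an
uncountable \<open>r\<close>-separated subset \<open>S\<close>. No uncountable subset of \<open>S\<close> is separated by a slightly larger number,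
so each of them has a pair of points at a distance just above \<open>r\<close>. Scale \<open>S\<close> so that \<open>r\<close> becomes \<open>t\<close>. As
\<open>\<ell>\<^sub>p\<close> is separable, \<open>f\<close> maps some uncountable subset into a set of diameter less than \<open>d\<close>, which contradicts
the lower bound for pairs at distances just above \<open>t\<close>.\<close>

lemma separable_of_uncollapsed:
  fixes f :: "'a::real_normed_vector \<Rightarrow> nat \<Rightarrow> real"
  assumes p: "1 \<le> p" and f: "\<And>x. f x \<in> lp_carrier p" and pos: "0 < t" "0 < \<eta>" "0 < d"
    and low: "\<And>x y. dist x y \<in> {t..t + \<eta>} \<Longrightarrow> d \<le> lp_norm p (\<lambda>n. f x n - f y n)"
  shows "\<exists>D::'a set. countable D \<and> closure D = UNIV"
proof (rule ccontr)
  assume "\<not> ?thesis"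
  then obtain r0 and S0 :: "'a set" where S0: "0 < r0" "uncountable S0" "S0 \<subseteq> cball 0 1"
    "\<And>x y. x \<in> S0 \<Longrightarrow> y \<in> S0 \<Longrightarrow> x \<noteq> y \<Longrightarrow> r0 \<le> dist x y"
    by (rule nonseparable_imp_separated) blast
  define T where "T = {r. 0 < r \<and> (\<exists>S\<subseteq>cball (0::'a) 1. uncountable S \<and> (\<forall>x\<in>S. \<forall>y\<in>S. x \<noteq> y \<longrightarrow> r \<le> dist x y))}"
  have "r0 \<in> T" using S0 by (auto simp: T_def)
  have T2: "r \<le> 2" if r: "r \<in> T" for r
  proof -
    obtain S where S: "S \<subseteq> cball (0::'a) 1" "uncountable S" "\<forall>x\<in>S. \<forall>y\<in>S. x \<noteq> y \<longrightarrow> r \<le> dist x y"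
      using r by (auto simp: T_def)
    then obtain x where x: "x \<in> S" by fastforce
    have "S \<noteq> {x}" using S(2) by auto
    then obtain y where y: "y \<in> S" "y \<noteq> x" using x by blast
    have "r \<le> dist x y" using S x y by auto
    also have "\<dots> \<le> norm x + norm y" by (simp add: dist_norm norm_triangle_ineq4)
    also have "\<dots> \<le> 1 + 1" using S(1) x y by (intro add_mono) auto
    finally show ?thesis by simp
  qed
  then have bdd: "bdd_above T" by (meson bdd_above.I)
  have r0: "r0 \<le> Sup T" using cSup_upper[OF \<open>r0 \<in> T\<close> bdd] .
  define k where "k = 1 + \<eta> / t"
  have k: "1 < k" using pos by (simp add: k_def)
  have "Sup T / k < Sup T" using r0 S0(1) k by (simp add: divide_less_eq)
  then obtain r where r: "r \<in> T" "Sup T / k < r" using less_cSupD[of T] \<open>r0 \<in> T\<close> by blast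
  then obtain S where S: "0 < r" "S \<subseteq> cball (0::'a) 1" "uncountable S" "\<And>x y. x \<in> S \<Longrightarrow> y \<in> S \<Longrightarrow> x \<noteq> y \<Longrightarrow> r \<le> dist x y"
    by (auto simp: T_def)
  obtain L :: "(nat \<Rightarrow> real) \<Rightarrow> nat \<times> int list"
    where L: "\<And>x y. x \<in> lp_carrier p \<Longrightarrow> y \<in> lp_carrier p \<Longrightarrow> L x = L y \<Longrightarrow> lp_norm p (\<lambda>n. x n - y n) < d"
    using lp_countable_partition[OF p pos(3)] by blast
  define g where "g x = f ((t / r) *\<^sub>R x)" for x
  have "S = (\<Union>l. {x \<in> S. L (g x) = l})" by auto
  then obtain l where l: "uncountable {x \<in> S. L (g x) = l}"
    using S(3) countable_UN[of UNIV "\<lambda>l. {x \<in> S. L (g x) = l}"] by (metis countableI_type)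
  define S' where "S' = {x \<in> S. L (g x) = l}"
  have "k * r \<notin> T" using r(2) k cSup_upper[OF _ bdd, of "k * r"] by (auto simp: field_simps)
  moreover have "0 < k * r" "S' \<subseteq> cball 0 1" "uncountable S'" using k S l by (auto simp: S'_def)
  ultimately obtain x y where xy: "x \<in> S'" "y \<in> S'" "x \<noteq> y" "dist x y < k * r"
    unfolding T_def by (auto simp: not_le)
  have "r \<le> dist x y" using S(4) xy by (auto simp: S'_def)
  have "dist ((t / r) *\<^sub>R x) ((t / r) *\<^sub>R y) = t / r * dist x y"
    using pos S(1) by (simp add: dist_norm flip: scaleR_diff_right)
  moreover have "t \<le> t / r * dist x y" using \<open>r \<le> dist x y\<close> pos S(1) by (simp add: field_simps)
  moreover have "t / r * dist x y \<le> t + \<eta>"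
  proof -
    have "t / r * dist x y \<le> t / r * (k * r)" using xy pos S(1) by (intro mult_left_mono) auto
    also have "\<dots> = t + \<eta>" using S(1) pos by (simp add: k_def field_simps)
    finally show ?thesis .
  qed
  ultimately have "d \<le> lp_norm p (\<lambda>n. g x n - g y n)" unfolding g_def by (intro low) auto
  moreover have "lp_norm p (\<lambda>n. g x n - g y n) < d"
    using xy f by (intro L) (auto simp: S'_def g_def)
  ultimately show False by simp
qed

section \<open>Realisation by square summable sequences\<close>

text \<open>Gram-Schmidt along a sequence \<open>d\<close> of points, carried out for all points of the space at the same time:
\<open>schur_iter d K n\<close> is the kernel of the components orthogonal to the vectors of \<open>d 0, \<dots>, d (n - 1)\<close>.\<close>

fun schur_iter :: "(nat \<Rightarrow> 'a) \<Rightarrow> ('a \<Rightarrow> 'a \<Rightarrow> real) \<Rightarrow> nat \<Rightarrow> 'a \<Rightarrow> 'a \<Rightarrow> real"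
  where "schur_iter d K 0 = K"
  | "schur_iter d K (Suc n) = schur_compl (d n) (schur_iter d K n)"

definition gram_vector :: "(nat \<Rightarrow> 'a) \<Rightarrow> ('a \<Rightarrow> 'a \<Rightarrow> real) \<Rightarrow> 'a \<Rightarrow> nat \<Rightarrow> real"
  where "gram_vector d K x n = schur_iter d K n x (d n) / sqrt (schur_iter d K n (d n) (d n))"

lemma psd_on_schur_iter: "psd_on UNIV K \<Longrightarrow> psd_on UNIV (schur_iter d K n)"
  by (induction n) (auto intro: psd_on_schur_compl)

lemma schur_iter_row: "psd_on UNIV K \<Longrightarrow> i < n \<Longrightarrow> schur_iter d K n (d i) x = 0"
proof (induction n arbitrary: x)
  case (Suc n)
  show ?case
  proof (cases "i = n")
    case True
    then show ?thesis using schur_compl_row[OF psd_on_schur_iter[OF Suc.prems(1)]] by simp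
  next
    case False
    then have "schur_iter d K n (d i) y = 0" for y using Suc by simp
    then show ?thesis by (simp add: schur_compl_def)
  qed
qed simp

lemma gram_vector_partial_sum:
  assumes "psd_on UNIV K"
  shows "(\<Sum>n<m. gram_vector d K x n * gram_vector d K y n) = K x y - schur_iter d K m x y"
proof (induction m)
  case (Suc m)
  let ?R = "schur_iter d K m"
  have R: "psd_on UNIV ?R" by (rule psd_on_schur_iter[OF assms])
  have "gram_vector d K x m * gram_vector d K y m = ?R x (d m) * ?R y (d m) / ?R (d m) (d m)"
    using psd_on_diag[OF R, of "d m"] by (simp add: gram_vector_def)
  then show ?case using Suc psd_on_sym[OF R, of y "d m"] by (simp add: schur_compl_def)
qed simp

text \<open>Parseval's identity. The remainder after \<open>m\<close> steps measures the distance to the span of the first \<open>m\<close> pivots;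
it tends to 0 because the vectors of the pivots are dense.\<close>

lemma gram_vector_sums:
  assumes K: "psd_on UNIV K"
    and dense: "\<And>x e. 0 < e \<Longrightarrow> \<exists>i. K x x - 2 * K x (d i) + K (d i) (d i) < e"
  shows "(\<lambda>n. gram_vector d K x n * gram_vector d K y n) sums K x y"
proof -
  let ?R = "schur_iter d K" and ?v = "gram_vector d K"
  have R: "psd_on UNIV (?R m)" for m by (rule psd_on_schur_iter[OF K])
  have Rdiag: "(\<lambda>m. ?R m x x) \<longlonglongrightarrow> 0" for x
  proof (rule LIMSEQ_I)
    fix e :: real assume "0 < e"
    then obtain i where i: "K x x - 2 * K x (d i) + K (d i) (d i) < e" using dense by blast
    have "norm (?R m x x - 0) < e" if "i < m" for m
    proof -
      \<comment> \<open>Orthogonal projection shrinks the distance of \<open>x\<close> from \<open>d i\<close>, and the projection of \<open>d i\<close> is 0.\<close>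
      have "0 \<le> (\<Sum>n<m. (?v x n - ?v (d i) n)\<^sup>2)" by (simp add: sum_nonneg)
      also have "\<dots> = (\<Sum>n<m. ?v x n * ?v x n) - 2 * (\<Sum>n<m. ?v x n * ?v (d i) n) + (\<Sum>n<m. ?v (d i) n * ?v (d i) n)"
        by (simp add: power2_eq_square algebra_simps sum.distrib sum_subtractf sum_distrib_left)
      also have "\<dots> = (K x x - 2 * K x (d i) + K (d i) (d i)) - (?R m x x - 2 * ?R m x (d i) + ?R m (d i) (d i))"
        unfolding gram_vector_partial_sum[OF K] by simp
      also have "?R m x (d i) = 0" using schur_iter_row[OF K that] psd_on_sym[OF R] by (metis UNIV_I)
      also have "?R m (d i) (d i) = 0" using schur_iter_row[OF K that] by simp
      finally have "?R m x x < e" using i by simp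
      then show ?thesis using psd_on_diag[OF R, of x m] by simp
    qed
    then show "\<exists>n0. \<forall>m\<ge>n0. norm (?R m x x - 0) < e" by (meson Suc_le_eq)
  qed
  have "\<bar>?R m x y\<bar> \<le> ?R m x x + ?R m y y" for m
    using psd_on_two_points[OF R, of x y 1 m 1] psd_on_two_points[OF R, of x y 1 m "-1"]
      psd_on_diag[OF R, of x m] psd_on_diag[OF R, of y m] by simp
  then have "(\<lambda>m. ?R m x y) \<longlonglongrightarrow> 0"
    using tendsto_add[OF Rdiag[of x] Rdiag[of y]]
    by (intro Lim_null_comparison[of "\<lambda>m. ?R m x y" "\<lambda>m. ?R m x x + ?R m y y"]) auto
  then have "(\<lambda>m. K x y - ?R m x y) \<longlonglongrightarrow> K x y - 0" by (intro tendsto_intros)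
  then show ?thesis unfolding sums_def gram_vector_partial_sum[OF K] by simp
qed

section \<open>The Mazur map\<close>

text \<open>One coordinate of the Mazur map, which sends the unit sphere of \<open>\<ell>\<^sub>2\<close> to that of \<open>\<ell>\<^sub>p\<close>.\<close>

definition mazur :: "real \<Rightarrow> real \<Rightarrow> real"
  where "mazur p a = sgn a * \<bar>a\<bar> powr (2 / p)"

lemma powr_superadditive:
  assumes "1 \<le> q" "0 \<le> (a::real)" "0 \<le> b"
  shows "a powr q + b powr q \<le> (a + b) powr q"
proof (cases "a + b = 0")
  case True
  then show ?thesis using assms by (simp add: add_nonneg_eq_0_iff)
next
  case False
  then have s: "0 < a + b" using assms by linarith
  have le: "c powr q \<le> (a + b) powr q * (c / (a + b))" if "0 \<le> c" "c \<le> a + b" for c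
  proof -
    have "c powr q = (a + b) powr q * (c / (a + b)) powr q"
      using that s by (simp add: powr_divide)
    also have "(c / (a + b)) powr q \<le> (c / (a + b)) powr 1"
      using that s assms by (intro powr_mono') auto
    finally show ?thesis using that s by (simp add: mult_left_mono)
  qed
  have "a powr q + b powr q \<le> (a + b) powr q * (a / (a + b)) + (a + b) powr q * (b / (a + b))"
    using assms by (intro add_mono le) auto
  also have "\<dots> = (a + b) powr q" using s by (simp flip: distrib_left add_divide_distrib)
  finally show ?thesis .
qed

lemma mazur_minus: "mazur p (- a) = - mazur p a"
  by (simp add: mazur_def)

lemma mazur_nonneg: "0 \<le> a \<Longrightarrow> mazur p a = a powr (2 / p)"
  by (auto simp: mazur_def sgn_if)

text \<open>Both bounds reduce to numbers of equal or of opposite sign. For \<open>0 \<le> b \<le> a\<close> and \<open>q = 2 / p\<close>, the lower bound is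
superadditivity of \<open>s \<mapsto> s\<^sup>q\<close>, and the upper bound follows from \<open>1 - u\<^sup>q \<le> 1 - u\<^sup>2 \<le> 2 (1 - u)\<close> for
\<open>u = b / a\<close>, which uses \<open>q \<le> 2\<close>.\<close>

lemma mazur_diff_bounds:
  fixes a b :: real
  assumes p: "1 \<le> p" "p \<le> 2"
  shows "(\<bar>a - b\<bar> / 2) powr (2 / p) \<le> \<bar>mazur p a - mazur p b\<bar>" (is "?lower a b")
    and "\<bar>mazur p a - mazur p b\<bar> \<le> 2 * (\<bar>a\<bar> + \<bar>b\<bar>) powr (2 / p - 1) * \<bar>a - b\<bar>" (is "?upper a b")
proof -
  define q where "q = 2 / p"
  have q: "1 \<le> q" "q \<le> 2" using p by (auto simp: q_def field_simps)
  have same: "?lower a b \<and> ?upper a b" if ab: "0 \<le> b" "b \<le> a" for a b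
  proof -
    have m: "\<bar>mazur p a - mazur p b\<bar> = a powr q - b powr q"
      using ab q by (simp add: mazur_nonneg q_def[symmetric] powr_mono2)
    have "(\<bar>a - b\<bar> / 2) powr q \<le> (a - b) powr q" using ab q by (intro powr_mono2) auto
    also have "\<dots> \<le> a powr q - b powr q" using powr_superadditive[OF q(1), of "a - b" b] ab by simp
    finally have lo: "?lower a b" unfolding m q_def .
    have "a powr q - b powr q \<le> 2 * (a + b) powr (q - 1) * (a - b)"
    proof (cases "a = 0")
      case True then show ?thesis using ab by simp
    next
      case False
      then have a: "0 < a" using ab by linarith
      have "(b / a) powr 2 \<le> (b / a) powr q" using ab a q by (intro powr_mono') auto
      then have "1 - (b / a) powr q \<le> 1 - (b / a)\<^sup>2" using ab a by simp
      also have "\<dots> = (1 + b / a) * (1 - b / a)" by (simp add: power2_eq_square algebra_simps)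
      also have "\<dots> \<le> 2 * (1 - b / a)" using ab a by (intro mult_right_mono) auto
      finally have "a powr q * (1 - (b / a) powr q) \<le> a powr q * (2 * (1 - b / a))"
        by (intro mult_left_mono) auto
      moreover have "a powr q * (1 - (b / a) powr q) = a powr q - b powr q"
        using ab a by (simp add: powr_divide algebra_simps)
      moreover have "a powr q * (2 * (1 - b / a)) = 2 * a powr (q - 1) * (a - b)"
        using a by (simp add: powr_diff field_simps)
      moreover have "2 * a powr (q - 1) * (a - b) \<le> 2 * (a + b) powr (q - 1) * (a - b)"
        using ab q by (intro mult_right_mono mult_left_mono powr_mono2) auto
      ultimately show ?thesis by linarith
    qed
    then have "?upper a b" unfolding m q_def[symmetric] using ab by simp
    with lo show ?thesis by blast
  qed
  have opp: "?lower a (- b) \<and> ?upper a (- b)" if ab: "0 \<le> a" "0 \<le> b" for a b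
  proof -
    have m: "\<bar>mazur p a - mazur p (- b)\<bar> = a powr q + b powr q"
      using ab by (simp add: mazur_minus mazur_nonneg q_def)
    have "(\<bar>a - - b\<bar> / 2) powr q \<le> max a b powr q" using ab q by (intro powr_mono2) auto
    also have "\<dots> \<le> a powr q + b powr q" by (simp add: max_def)
    finally have lo: "?lower a (- b)" unfolding m q_def .
    have "a powr q + b powr q \<le> (a + b) powr (q - 1 + 1)" using powr_superadditive[OF q(1) ab] by simp
    also have "\<dots> = (a + b) powr (q - 1) * (a + b)" using ab by (simp only: powr_add) simp
    also have "\<dots> \<le> 2 * (a + b) powr (q - 1) * (a + b)" using ab by (intro mult_right_mono) auto
    finally have "?upper a (- b)" unfolding m q_def[symmetric] using ab by simp
    with lo show ?thesis by blast
  qed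
  have comm: "?lower b a \<and> ?upper b a" if "?lower a b \<and> ?upper a b" for a b
    using that by (simp add: abs_minus_commute add.commute)
  have neg: "?lower (- a) (- b) \<and> ?upper (- a) (- b)" if "?lower a b \<and> ?upper a b" for a b
    using that by (simp add: mazur_minus abs_minus_commute)
  have nn: "?lower a b \<and> ?upper a b" if "0 \<le> a" "0 \<le> b" for a b
    using same[OF that(2)] comm[OF same[OF that(1)]] by (cases "b \<le> a") (blast, meson nle_le)
  have "?lower a b \<and> ?upper a b"
  proof (cases "0 \<le> a"; cases "0 \<le> b")
    assume "0 \<le> a" "0 \<le> b" then show ?thesis by (rule nn)
  next
    assume "0 \<le> a" "\<not> 0 \<le> b" then show ?thesis using opp[of a "- b"] by simp
  next
    assume "\<not> 0 \<le> a" "0 \<le> b" then show ?thesis using comm[OF opp[of b "- a"]] by simp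
  next
    assume "\<not> 0 \<le> a" "\<not> 0 \<le> b" then show ?thesis using neg[OF nn[of "- a" "- b"]] by simp
  qed
  then show "?lower a b" "?upper a b" by auto
qed

lemma mazur_lower:
  assumes p: "1 \<le> p" "p \<le> 2"
  shows "(a - b)\<^sup>2 / 4 \<le> \<bar>mazur p a - mazur p b\<bar> powr p"
proof -
  have "((\<bar>a - b\<bar> / 2) powr (2 / p)) powr p \<le> \<bar>mazur p a - mazur p b\<bar> powr p"
    using mazur_diff_bounds(1)[OF p] p by (intro powr_mono2) auto
  moreover have "((\<bar>a - b\<bar> / 2) powr (2 / p)) powr p = (\<bar>a - b\<bar> / 2)\<^sup>2"
    using p by (simp add: powr_powr)
  ultimately show ?thesis by (simp add: power_divide)
qed

text \<open>An additive substitute for Hoelder's inequality with the exponents \<open>2 / (2 - p)\<close> and \<open>2 / p\<close>, which includes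
the case \<open>p = 2\<close>: the term \<open>(|a| + |b|)\<^bsup>2 - p\<^esup> |a - b|\<^sup>p\<close> is estimated separately according to whether
\<open>|a - b| \<le> e (|a| + |b|)\<close>.\<close>

lemma mazur_upper:
  assumes p: "1 \<le> p" "p \<le> 2" and e: "0 < e" "e \<le> 1"
  shows "\<bar>mazur p a - mazur p b\<bar> powr p \<le> 8 * e * (a\<^sup>2 + b\<^sup>2) + 4 / e * (a - b)\<^sup>2"
proof -
  define s where "s = \<bar>a\<bar> + \<bar>b\<bar>"
  define u where "u = \<bar>a - b\<bar>"
  have s: "0 \<le> s" "0 \<le> u" by (auto simp: s_def u_def)
  have "\<bar>mazur p a - mazur p b\<bar> powr p \<le> (2 * s powr (2 / p - 1) * u) powr p"
    using mazur_diff_bounds(2)[OF p, of a b] p unfolding s_def u_def by (intro powr_mono2) auto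
  also have "\<dots> = 2 powr p * (s powr (2 - p) * u powr p)"
    using p s by (simp add: powr_mult powr_powr left_diff_distrib)
  also have "\<dots> \<le> 4 * (s powr (2 - p) * u powr p)"
  proof -
    have "2 powr p \<le> 2 powr (2::real)" using p by (intro powr_mono) auto
    then show ?thesis by (intro mult_right_mono) auto
  qed
  also have "s powr (2 - p) * u powr p \<le> e * s\<^sup>2 + u\<^sup>2 / e"
  proof (cases "u \<le> e * s")
    case True
    have "s powr (2 - p) * u powr p \<le> s powr (2 - p) * (e * s) powr p"
      using True s p by (intro mult_left_mono powr_mono2) auto
    also have "\<dots> = e powr p * s\<^sup>2"
      using s e by (cases "s = 0") (simp_all add: powr_mult flip: powr_add)
    also have "\<dots> \<le> e powr 1 * s\<^sup>2" using e p by (intro mult_right_mono powr_mono') auto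
    finally have "s powr (2 - p) * u powr p \<le> e * s\<^sup>2" using e by simp
    moreover have "0 \<le> u\<^sup>2 / e" using e by simp
    ultimately show ?thesis by linarith
  next
    case False
    then have us: "s \<le> u / e" "0 < u" using e s by (auto simp: field_simps) (smt (verit) mult_nonneg_nonneg)
    have "s powr (2 - p) * u powr p \<le> (u / e) powr (2 - p) * u powr p"
      using us s p by (intro mult_right_mono powr_mono2) auto
    also have "\<dots> = u\<^sup>2 * (1 / e) powr (2 - p)"
      using us e by (simp add: powr_divide flip: powr_add)
    also have "\<dots> \<le> u\<^sup>2 * (1 / e) powr 1"
      using e p by (intro mult_left_mono powr_mono) auto
    finally show ?thesis using e by (simp add: add_increasing)
  qed
  also have "s\<^sup>2 \<le> 2 * (a\<^sup>2 + b\<^sup>2)"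
    using sum_squares_bound[of "\<bar>a\<bar>" "\<bar>b\<bar>"] by (simp add: s_def power2_sum)
  finally show ?thesis using e by (simp add: u_def algebra_simps)
qed

text \<open>The Mazur map is a uniform homeomorphism between unit spheres. Sum the coordinate estimates, with
\<open>e = sqrt D / 2\<close> in the upper one.\<close>

lemma mazur_sphere:
  fixes v w :: "nat \<Rightarrow> real"
  assumes p: "1 \<le> p" "p \<le> 2"
    and v: "(\<lambda>n. (v n)\<^sup>2) sums 1" and w: "(\<lambda>n. (w n)\<^sup>2) sums 1"
    and vw: "(\<lambda>n. (v n - w n)\<^sup>2) sums D"
  shows "summable (\<lambda>n. \<bar>mazur p (v n) - mazur p (w n)\<bar> powr p)" (is "summable ?m")
    and "D / 4 \<le> (\<Sum>n. \<bar>mazur p (v n) - mazur p (w n)\<bar> powr p)"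
    and "(\<Sum>n. \<bar>mazur p (v n) - mazur p (w n)\<bar> powr p) \<le> 16 * sqrt D"
proof -
  have D0: "0 \<le> D" using sums_le[OF _ sums_zero vw] by simp
  have up: "(\<lambda>n. 8 * e * ((v n)\<^sup>2 + (w n)\<^sup>2) + 4 / e * (v n - w n)\<^sup>2) sums (8 * e * (1 + 1) + 4 / e * D)" for e
    by (intro sums_add sums_mult v w vw)
  show summ: "summable ?m"
    by (rule summable_comparison_test'[OF sums_summable[OF up[of 1]], of 0]) (use mazur_upper[OF p, of 1] in auto)
  have T: "suminf ?m \<le> 16 * e + 4 / e * D" if "0 < e" "e \<le> 1" for e
    using sums_le[OF mazur_upper[OF p that] summable_sums[OF summ] up[of e]] by simp
  have "(\<lambda>n. (v n - w n)\<^sup>2 / 4) sums (D / 4)" by (intro sums_divide vw)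
  then show "D / 4 \<le> suminf ?m"
    by (rule sums_le[OF mazur_lower[OF p] _ summable_sums[OF summ]])
  have "D \<le> 2 * (1 + 1)"
  proof (rule sums_le[OF _ vw])
    show "(\<lambda>n. 2 * ((v n)\<^sup>2 + (w n)\<^sup>2)) sums (2 * (1 + 1))" by (intro sums_mult sums_add v w)
    show "(v n - w n)\<^sup>2 \<le> 2 * ((v n)\<^sup>2 + (w n)\<^sup>2)" for n
      using zero_le_power2[of "v n + w n"] by (simp add: power2_eq_square algebra_simps)
  qed
  then have "sqrt D \<le> sqrt (2\<^sup>2)" by (intro real_sqrt_le_mono) simp
  then have sD: "sqrt D / 2 \<le> 1" by simp
  show "suminf ?m \<le> 16 * sqrt D"
  proof (cases "D = 0")
    case True
    then have "(\<lambda>n. (v n - w n)\<^sup>2) = (\<lambda>n. 0)"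
      using vw suminf_eq_zero_iff[of "\<lambda>n. (v n - w n)\<^sup>2"] by (auto simp: sums_iff)
    then have "v n = w n" for n by (simp add: fun_eq_iff)
    then show ?thesis using True by simp
  next
    case False
    then have pos: "0 < sqrt D" using D0 by simp
    have "suminf ?m \<le> 16 * (sqrt D / 2) + 4 / (sqrt D / 2) * D"
      using pos sD by (intro T) auto
    also have "\<dots> = 16 * sqrt D"
    proof -
      have "4 / (sqrt D / 2) * D = 8 * (D / sqrt D)" by simp
      also have "D / sqrt D = sqrt D" using D0 by (rule real_div_sqrt)
      finally show ?thesis by simp
    qed
    finally show ?thesis .
  qed
qed

section \<open>The embedding\<close>

lemma sums_prod_decode:
  fixes g :: "nat \<Rightarrow> nat \<Rightarrow> real"
  assumes nonneg: "\<And>k n. 0 \<le> g k n" and g: "\<And>k. g k sums T k" and T: "summable T"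
  shows "(\<lambda>m. case prod_decode m of (k, n) \<Rightarrow> g k n) sums suminf T"
proof -
  have T0: "0 \<le> T k" for k using sums_le[OF _ sums_zero g] nonneg by simp
  have "(\<Sum>n. ennreal (g k n)) = ennreal (T k)" for k
    using g[of k] nonneg T0 by (intro sums_unique[symmetric]) simp
  then have "(\<Sum>m. (\<lambda>(k, n). ennreal (g k n)) (prod_decode m)) = (\<Sum>k. ennreal (T k))"
    by (intro suminf_ennreal_2dimen) simp
  also have "\<dots> = ennreal (suminf T)"
    using T T0 by (intro sums_unique[symmetric]) (simp add: suminf_nonneg summable_sums)
  finally have "(\<lambda>m. (\<lambda>(k, n). ennreal (g k n)) (prod_decode m)) sums ennreal (suminf T)"
    by (simp add: sums_iff)
  moreover have "(\<lambda>(k, n). ennreal (g k n)) z = ennreal (case z of (k, n) \<Rightarrow> g k n)" for z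
    by (simp add: case_prod_unfold)
  ultimately show ?thesis
    using nonneg T T0 by (simp add: case_prod_unfold suminf_nonneg)
qed

lemma finite_uniform_radius:
  fixes P :: "nat \<Rightarrow> real \<Rightarrow> bool"
  assumes "\<And>k. k < N \<Longrightarrow> \<exists>d>0. \<forall>r<d. P k r"
  shows "\<exists>d>0. \<forall>k<N. \<forall>r<d. P k r"
  using assms
proof (induction N)
  case (Suc N)
  then obtain d d' where "d > 0" "\<forall>k<N. \<forall>r<d. P k r" "d' > 0" "\<forall>r<d'. P N r"
    by (metis less_Suc_eq)
  then show ?case by (intro exI[of _ "min d d'"]) (auto simp: less_Suc_eq)
qed (auto intro: exI[of _ 1])

lemma (in negtype_function) gaussian_gram_sums:
  fixes d :: "nat \<Rightarrow> 'a"
  assumes dense: "\<And>x \<epsilon>. 0 < \<epsilon> \<Longrightarrow> \<exists>i. dist (d i) x < \<epsilon>" and l: "0 < l"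
  obtains v where "\<And>x y. (\<lambda>n. v x n * v y n) sums exp (- q (l *\<^sub>R (x - y)))"
proof -
  define K where "K x y = exp (- q (l *\<^sub>R (x - y)))" for x y
  have "negtype_on UNIV (\<lambda>x y. q (l *\<^sub>R x - l *\<^sub>R y))"
    by (rule negtype_on_pullback[OF negtype]) simp
  then have K: "psd_on UNIV K"
    unfolding K_def scaleR_diff_right by (rule schoenberg)
  have K1: "K x x = 1" for x using negtype_on_diag[OF negtype, of 0] by (simp add: K_def)
  have "\<exists>i. K x x - 2 * K x (d i) + K (d i) (d i) < e" if e: "0 < e" for x e
  proof -
    obtain b where b: "b > 0" "\<And>z. norm z < b \<Longrightarrow> q z \<le> e / 4" using small[of "e / 4"] e by auto
    obtain i where i: "dist (d i) x < b / l" using dense[of "b / l"] b l by auto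
    have "norm (l *\<^sub>R (x - d i)) < b"
      unfolding norm_scaleR using i l by (simp add: dist_norm norm_minus_commute field_simps)
    then have "q (l *\<^sub>R (x - d i)) \<le> e / 4" by (rule b)
    then have "1 - e / 4 \<le> K x (d i)"
      unfolding K_def using exp_ge_add_one_self[of "- q (l *\<^sub>R (x - d i))"] by linarith
    then show ?thesis using e K1 by (intro exI[of _ i]) simp
  qed
  then have "(\<lambda>n. gram_vector d K x n * gram_vector d K y n) sums exp (- q (l *\<^sub>R (x - y)))" for x y
    using gram_vector_sums[OF K, of d x y] unfolding K_def[of x y] by blast
  then show thesis by (rule that)
qed

text \<open>\<open>S x y\<close> is the \<open>p\<close>-th power of the distance of the images. It is a sum over scales \<open>l k\<close>, where the \<open>k\<close>-th
summand is controlled from both sides by the squared distance \<open>D k x y = 2 - 2 exp (- q (l k (x - y)))\<close> of unit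
vectors. The scales are so small that the \<open>k\<close>-th summand is at most \<open>32 / 2 ^ k\<close> on pairs at distance at
most \<open>k\<close>. Each summand is at least a fixed constant as soon as \<open>l k |x - y| \<ge> 1\<close>, whence the growth.\<close>

lemma (in negtype_function) lp_map_of_negtype:
  fixes d :: "nat \<Rightarrow> 'a"
  assumes p: "1 \<le> p" "p \<le> 2"
    and dense: "\<And>x \<epsilon>. 0 < \<epsilon> \<Longrightarrow> \<exists>i::nat. dist (d i) x < \<epsilon>"
    and lower: "\<And>r. 0 < r \<Longrightarrow> \<exists>b>0. \<forall>x. r \<le> norm x \<longrightarrow> b \<le> q x"
  obtains F :: "'a \<Rightarrow> nat \<Rightarrow> real" and S :: "'a \<Rightarrow> 'a \<Rightarrow> real"
  where "\<And>x. F x \<in> lp_carrier p"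
    "\<And>x y. lp_norm p (\<lambda>n. F x n - F y n) = S x y powr (1 / p)" "\<And>x y. 0 \<le> S x y"
    "\<And>e. 0 < e \<Longrightarrow> \<exists>b>0. \<forall>x y. norm (x - y) < b \<longrightarrow> S x y \<le> e"
    "\<And>r. \<exists>B. \<forall>x y. norm (x - y) \<le> r \<longrightarrow> S x y \<le> B"
    "\<And>r. 0 < r \<Longrightarrow> \<exists>b>0. \<forall>x y. r \<le> norm (x - y) \<longrightarrow> b \<le> S x y"
    "\<And>M. \<exists>r. \<forall>x y. r \<le> norm (x - y) \<longrightarrow> M \<le> S x y"
proof -
  have "\<exists>l>0. \<forall>z. norm z \<le> real k \<longrightarrow> q (l *\<^sub>R z) \<le> (1 / 4) ^ k" for k
  proof -
    obtain b where b: "b > 0" "\<And>z. norm z < b \<Longrightarrow> q z \<le> (1 / 4) ^ k" using small[of "(1 / 4) ^ k"] by auto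
    have "norm ((b / real (Suc k)) *\<^sub>R z) < b" if "norm z \<le> real k" for z :: 'a
    proof -
      have "b * norm z < b * real (Suc k)" using that b(1) by (intro mult_strict_left_mono) auto
      then show ?thesis using b(1) by (simp add: divide_less_eq del: of_nat_Suc)
    qed
    then show ?thesis using b by (intro exI[of _ "b / real (Suc k)"]) auto
  qed
  then obtain l where l: "\<And>k. 0 < l k" "\<And>k z. norm z \<le> real k \<Longrightarrow> q (l k *\<^sub>R z) \<le> (1 / 4) ^ k"
    by metis
  have "\<exists>v. \<forall>x y. (\<lambda>n. v x n * v y n) sums exp (- q (l k *\<^sub>R (x - y)))" for k
    using gaussian_gram_sums[OF dense l(1)] by metis
  then obtain v where v: "\<And>k x y. (\<lambda>n. v k x n * v k y n) sums exp (- q (l k *\<^sub>R (x - y)))" by metis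
  define D where "D k x y = 2 - 2 * exp (- q (l k *\<^sub>R (x - y)))" for k x y
  have v1: "(\<lambda>n. (v k x n)\<^sup>2) sums 1" for k x
    using v[of k x x] negtype_on_diag[OF negtype, of 0] by (simp add: power2_eq_square)
  have vD: "(\<lambda>n. (v k x n - v k y n)\<^sup>2) sums D k x y" for k x y
  proof -
    have "(\<lambda>n. (v k x n)\<^sup>2 - 2 * (v k x n * v k y n) + (v k y n)\<^sup>2)
        sums (1 - 2 * exp (- q (l k *\<^sub>R (x - y))) + 1)"
      by (intro sums_add sums_diff sums_mult v v1)
    then show ?thesis by (simp add: D_def power2_diff algebra_simps)
  qed
  define T where "T k x y = (\<Sum>n. \<bar>mazur p (v k x n) - mazur p (v k y n)\<bar> powr p)" for k x y
  have T: "(\<lambda>n. \<bar>mazur p (v k x n) - mazur p (v k y n)\<bar> powr p) sums T k x y"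
    "D k x y / 4 \<le> T k x y" "T k x y \<le> 16 * sqrt (D k x y)" for k x y
    using mazur_sphere[OF p v1[of k x] v1[of k y] vD] by (simp_all add: T_def summable_sums)
  have D: "0 \<le> D k x y" "D k x y \<le> 2" "D k x y \<le> 2 * q (l k *\<^sub>R (x - y))" for k x y
    using nonneg[of "l k *\<^sub>R (x - y)"] exp_ge_add_one_self[of "- q (l k *\<^sub>R (x - y))"] by (auto simp: D_def)
  have T0: "0 \<le> T k x y" for k x y using T(2)[of k x y] D(1)[of k x y] by linarith
  have T_le: "T k x y \<le> 16 * c" if "D k x y \<le> c\<^sup>2" "0 \<le> c" for k x y c
    using T(3)[of k x y] real_sqrt_le_mono[OF that(1)] that(2) by simp
  have T32: "T k x y \<le> 32" for k x y using T_le[of k x y 2] D(2)[of k x y] by simp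
  have Tgeo: "T k x y \<le> 32 * (1 / 2) ^ k" if "norm (x - y) \<le> real k" for k x y
  proof -
    have "((1 / 2 :: real) ^ k)\<^sup>2 = (1 / 4) ^ k"
      by (simp only: power2_eq_square power_mult_distrib[symmetric]) simp
    then have "2 * (1 / 4) ^ k \<le> (2 * (1 / 2 :: real) ^ k)\<^sup>2"
      unfolding power_mult_distrib by (simp only:) simp
    then have "D k x y \<le> (2 * (1 / 2) ^ k)\<^sup>2" using D(3)[of k x y] l(2)[OF that] by linarith
    then show ?thesis using T_le[of k x y "2 * (1 / 2) ^ k"] by simp
  qed
  have geo: "summable (\<lambda>k. 32 * (1 / 2 :: real) ^ k)" "(\<Sum>k. 32 * (1 / 2 :: real) ^ k) = 64"
    by (simp_all add: summable_mult summable_geometric suminf_mult suminf_geometric)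
  have summ: "summable (\<lambda>k. T k x y)" for x y
  proof (rule summable_comparison_test'[OF geo(1)])
    fix k assume "nat \<lceil>norm (x - y)\<rceil> \<le> k"
    then have "norm (x - y) \<le> real k" by linarith
    then show "norm (T k x y) \<le> 32 * (1 / 2) ^ k" using Tgeo T0 by simp
  qed
  define S where "S x y = (\<Sum>k. T k x y)" for x y
  \<comment> \<open>Subtracting the image of 0 makes the infinite sum over the scales \<open>k\<close> converge.\<close>
  define F where "F x m = (case prod_decode m of (k, n) \<Rightarrow> mazur p (v k x n) - mazur p (v k 0 n))" for x m
  have FS: "(\<lambda>m. \<bar>F x m - F y m\<bar> powr p) sums S x y" for x y
  proof -
    have "\<bar>F x m - F y m\<bar> powr p = (case prod_decode m of (k, n) \<Rightarrow> \<bar>mazur p (v k x n) - mazur p (v k y n)\<bar> powr p)" for m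
      by (simp add: F_def case_prod_unfold)
    then show ?thesis unfolding S_def using sums_prod_decode[OF _ T(1) summ] by simp
  qed
  have "F 0 = (\<lambda>m. 0)" by (simp add: F_def fun_eq_iff case_prod_unfold)
  then have mem: "F x \<in> lp_carrier p" for x
    using sums_summable[OF FS[of x 0]] by (simp add: lp_carrier_def)
  have norm_F: "lp_norm p (\<lambda>n. F x n - F y n) = S x y powr (1 / p)" for x y
    using sums_unique[OF FS[of x y]] by (simp add: lp_norm_def)
  have S0: "0 \<le> S x y" for x y unfolding S_def by (intro suminf_nonneg summ T0)
  have split: "S x y \<le> 64 * (1 / 2) ^ N + (\<Sum>k<N. T k x y)" if "norm (x - y) \<le> real N" for x y N
  proof -
    have "(\<Sum>k. T (k + N) x y) \<le> (\<Sum>k. (32 * (1 / 2) ^ k) * (1 / 2) ^ N)"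
    proof (rule suminf_le)
      fix k show "T (k + N) x y \<le> (32 * (1 / 2) ^ k) * (1 / 2) ^ N"
        using Tgeo[of x y "k + N"] that by (simp add: power_add)
    qed (intro summable_mult2 geo(1) summable_ignore_initial_segment[OF summ])+
    also have "\<dots> = 64 * (1 / 2) ^ N" using suminf_mult2[OF geo(1), of "(1 / 2) ^ N"] geo(2) by simp
    finally show ?thesis unfolding S_def using suminf_split_initial_segment[OF summ, of x y N] by simp
  qed
  have low: "(1 - exp (- b)) / 2 \<le> T k x y" if "b \<le> q (l k *\<^sub>R (x - y))" for k x y b
    using T(2)[of k x y] that by (simp add: D_def)
      (smt (verit) exp_le_cancel_iff)
  have sum_le: "(\<Sum>k<N. T k x y) \<le> S x y" for N x y
    unfolding S_def by (intro sum_le_suminf summ) (auto simp: T0)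
  show thesis
  proof (rule that[OF mem norm_F S0])
    fix e :: real assume e: "0 < e"
    obtain N where N: "(1 / 2) ^ N < e / 128" using real_arch_pow_inv[of "e / 128" "1 / 2"] e by auto
    have "\<exists>b>0. \<forall>r<b. \<forall>x y. norm (x - y) \<le> r \<longrightarrow> T k x y \<le> e / (2 * real (Suc N))" for k
    proof -
      define c where "c = e / (32 * real (Suc N))"
      have c: "0 < c" using e by (simp add: c_def)
      obtain b where b: "b > 0" "\<And>z. norm z < b \<Longrightarrow> q z \<le> c\<^sup>2 / 2" using small[of "c\<^sup>2 / 2"] c by auto
      have "T k x y \<le> e / (2 * real (Suc N))" if "norm (x - y) < b / l k" for x y
      proof -
        have "norm (l k *\<^sub>R (x - y)) < b" unfolding norm_scaleR using that l(1)[of k] by (simp add: field_simps)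
        then have "D k x y \<le> c\<^sup>2" using b(2) D(3)[of k x y] by fastforce
        then have "T k x y \<le> 16 * c" using c by (intro T_le) auto
        also have "16 * c = e / (2 * real (Suc N))" by (simp add: c_def field_simps)
        finally show ?thesis .
      qed
      then show ?thesis using b(1) l(1)[of k] by (intro exI[of _ "b / l k"]) auto
    qed
    then obtain b where b: "b > 0" "\<forall>k<N. \<forall>r<b. \<forall>x y. norm (x - y) \<le> r \<longrightarrow> T k x y \<le> e / (2 * real (Suc N))"
      using finite_uniform_radius[of N "\<lambda>k r. \<forall>x y. norm (x - y) \<le> r \<longrightarrow> T k x y \<le> e / (2 * real (Suc N))"] by blast
    have "S x y \<le> e" if xy: "norm (x - y) < min b (if N = 0 then 1 else real N)" for x y
    proof (cases "N = 0")
      case True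
      have "norm (x - y) \<le> real 1" using xy True by simp
      then have "S x y \<le> 64 * (1 / 2) ^ 1 + 32" using split[of x y 1] T32[of 0 x y] by simp
      then show ?thesis using N True by simp
    next
      case False
      then have "S x y \<le> 64 * (1 / 2) ^ N + (\<Sum>k<N. T k x y)" using xy by (intro split) auto
      also have "(\<Sum>k<N. T k x y) \<le> (\<Sum>k<N. e / (2 * real (Suc N)))"
        using b(2) xy by (intro sum_mono) auto
      also have "\<dots> \<le> e / 2" using e by (simp add: field_simps)
      also have "64 * (1 / 2) ^ N \<le> e / 2" using N by simp
      finally show ?thesis by simp
    qed
    then show "\<exists>b>0. \<forall>x y. norm (x - y) < b \<longrightarrow> S x y \<le> e"
      using b(1) by (intro exI[of _ "min b (if N = 0 then 1 else real N)"]) auto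
  next
    fix r :: real
    define N where "N = nat \<lceil>r\<rceil>"
    have "S x y \<le> 64 * (1 / 2) ^ N + (\<Sum>k<N. 32)" if "norm (x - y) \<le> r" for x y
    proof -
      have "norm (x - y) \<le> real N" using that by (simp add: N_def) linarith
      then have "S x y \<le> 64 * (1 / 2) ^ N + (\<Sum>k<N. T k x y)" by (rule split)
      also have "(\<Sum>k<N. T k x y) \<le> (\<Sum>k<N. 32)" by (intro sum_mono T32)
      finally show ?thesis by simp
    qed
    then show "\<exists>B. \<forall>x y. norm (x - y) \<le> r \<longrightarrow> S x y \<le> B" by blast
  next
    fix r :: real assume r: "0 < r"
    obtain b where b: "b > 0" "\<And>x. l 0 * r \<le> norm x \<Longrightarrow> b \<le> q x" using lower[of "l 0 * r"] l(1)[of 0] r by auto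
    have "(1 - exp (- b)) / 2 \<le> S x y" if "r \<le> norm (x - y)" for x y
    proof -
      have "l 0 * r \<le> norm (l 0 *\<^sub>R (x - y))" using that l(1)[of 0] by simp
      then have "(1 - exp (- b)) / 2 \<le> T 0 x y" by (intro low b)
      then show ?thesis using sum_le[where N = 1 and x = x and y = y] by simp
    qed
    then show "\<exists>b>0. \<forall>x y. r \<le> norm (x - y) \<longrightarrow> b \<le> S x y"
      using b(1) by (intro exI[of _ "(1 - exp (- b)) / 2"]) auto
  next
    fix M :: real
    obtain b where b: "b > 0" "\<And>x. 1 \<le> norm x \<Longrightarrow> b \<le> q x" using lower[of 1] by auto
    define c where "c = (1 - exp (- b)) / 2"
    have c: "0 < c" using b by (simp add: c_def)
    obtain N :: nat where N: "M / c < real N" using reals_Archimedean2 by blast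
    have "M \<le> S x y" if xy: "(\<Sum>k<N. 1 / l k) \<le> norm (x - y)" for x y
    proof -
      have "c \<le> T k x y" if "k < N" for k
      proof -
        have "1 / l k \<le> (\<Sum>k<N. 1 / l k)"
          using that l(1) by (intro member_le_sum) (auto intro: less_imp_le)
        then have "1 / l k \<le> norm (x - y)" using xy by linarith
        then have "1 \<le> norm (l k *\<^sub>R (x - y))" unfolding norm_scaleR using l(1)[of k] by (simp add: field_simps)
        then show ?thesis unfolding c_def by (intro low b)
      qed
      then have "(\<Sum>k<N. c) \<le> (\<Sum>k<N. T k x y)" by (intro sum_mono) auto
      then show ?thesis using N c sum_le[where N = N and x = x and y = y] by (simp add: field_simps)
    qed
    then show "\<exists>r. \<forall>x y. r \<le> norm (x - y) \<longrightarrow> M \<le> S x y" by blast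
  qed
qed

section \<open>Moduli and the equivalences\<close>

lemma expansion_modulus_finiteD:
  assumes "expansion_modulus m1 m2 f t < \<infinity>"
  obtains B where "0 \<le> B" "\<And>x y. x \<in> mspace m1 \<Longrightarrow> y \<in> mspace m1 \<Longrightarrow> mdist m1 x y \<le> t \<Longrightarrow> mdist m2 (f x) (f y) \<le> B"
proof -
  obtain B where B: "0 \<le> B" "expansion_modulus m1 m2 f t = ennreal B"
    using assms by (cases "expansion_modulus m1 m2 f t") auto
  have "mdist m2 (f x) (f y) \<le> B" if "x \<in> mspace m1" "y \<in> mspace m1" "mdist m1 x y \<le> t" for x y
  proof -
    have "ennreal (mdist m2 (f x) (f y)) \<le> ennreal B"
      unfolding B(2)[symmetric] expansion_modulus_def using that by (intro Sup_upper) blast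
    then show ?thesis using B(1) by (simp add: ennreal_le_iff)
  qed
  with B(1) that show thesis by blast
qed

lemma expansion_modulus_finiteI:
  assumes "\<And>x y. x \<in> mspace m1 \<Longrightarrow> y \<in> mspace m1 \<Longrightarrow> mdist m1 x y \<le> t \<Longrightarrow> mdist m2 (f x) (f y) \<le> B"
  shows "expansion_modulus m1 m2 f t < \<infinity>"
proof -
  have "expansion_modulus m1 m2 f t \<le> ennreal B"
    unfolding expansion_modulus_def using assms by (intro Sup_least) (auto intro!: ennreal_leI)
  also have "\<dots> < \<infinity>" by simp
  finally show ?thesis .
qed

lemma compression_modulus_geI:
  assumes "\<And>x y. x \<in> mspace m1 \<Longrightarrow> y \<in> mspace m1 \<Longrightarrow> t \<le> mdist m1 x y \<Longrightarrow> b \<le> mdist m2 (f x) (f y)"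
  shows "ennreal b \<le> compression_modulus m1 m2 f t"
  unfolding compression_modulus_def using assms by (intro Inf_greatest) (auto intro!: ennreal_leI)

lemma compression_modulus_lessD:
  assumes "ennreal b < compression_modulus m1 m2 f t"
    and "x \<in> mspace m1" "y \<in> mspace m1" "t \<le> mdist m1 x y"
  shows "b < mdist m2 (f x) (f y)"
proof -
  have "compression_modulus m1 m2 f t \<le> ennreal (mdist m2 (f x) (f y))"
    unfolding compression_modulus_def using assms by (intro Inf_lower) blast
  with assms(1) have "ennreal b < ennreal (mdist m2 (f x) (f y))" by (rule less_le_trans)
  then show ?thesis by (meson ennreal_leI not_less)
qed

lemma strong_embeddingI:
  assumes f: "f \<in> mspace m1 \<rightarrow> mspace m2"
    and uc: "uniformly_continuous_map m1 m2 f"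
    and bdd: "\<And>t. \<exists>B. \<forall>x\<in>mspace m1. \<forall>y\<in>mspace m1. mdist m1 x y \<le> t \<longrightarrow> mdist m2 (f x) (f y) \<le> B"
    and low: "\<And>t. 0 < t \<Longrightarrow> \<exists>b>0. \<forall>x\<in>mspace m1. \<forall>y\<in>mspace m1. t \<le> mdist m1 x y \<longrightarrow> b \<le> mdist m2 (f x) (f y)"
    and exp: "\<And>b. \<exists>t. \<forall>x\<in>mspace m1. \<forall>y\<in>mspace m1. t \<le> mdist m1 x y \<longrightarrow> b \<le> mdist m2 (f x) (f y)"
  shows "strong_embedding m1 m2 f"
proof -
  have comp: "0 < compression_modulus m1 m2 f t" if t: "0 < t" for t
  proof -
    obtain b where b: "b > 0" "\<And>x y. x \<in> mspace m1 \<Longrightarrow> y \<in> mspace m1 \<Longrightarrow> t \<le> mdist m1 x y \<Longrightarrow> b \<le> mdist m2 (f x) (f y)"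
      using low[OF t] by blast
    have "ennreal b \<le> compression_modulus m1 m2 f t" by (rule compression_modulus_geI) (rule b)
    with b(1) show ?thesis by (meson ennreal_less_zero_iff less_le_trans)
  qed
  have inj: "inj_on f (mspace m1)"
  proof (rule inj_onI, rule ccontr)
    fix x y assume xy: "x \<in> mspace m1" "y \<in> mspace m1" "f x = f y" "x \<noteq> y"
    then have "0 < mdist m1 x y" using mdist_nonneg[of m1 x y] mdist_zero[of x m1 y]
      by (metis order_le_less)
    then obtain b where "b > 0" "b \<le> mdist m2 (f x) (f y)" using low xy by blast
    moreover have "mdist m2 (f x) (f y) = 0" using xy f by (metis PiE mdist_zero)
    ultimately show False by simp
  qed
  have "(compression_modulus m1 m2 f \<longlongrightarrow> \<infinity>) at_top"
    unfolding infinity_ennreal_def tendsto_top_iff_ennreal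
  proof (intro allI impI)
    fix b :: real assume b: "0 \<le> b"
    obtain t where t: "\<And>x y. x \<in> mspace m1 \<Longrightarrow> y \<in> mspace m1 \<Longrightarrow> t \<le> mdist m1 x y \<Longrightarrow> b + 1 \<le> mdist m2 (f x) (f y)"
      using exp[of "b + 1"] by blast
    have "ennreal b < compression_modulus m1 m2 f s" if "t \<le> s" for s
    proof -
      have "ennreal b < ennreal (b + 1)" using b by (simp add: ennreal_less_iff)
      also have "\<dots> \<le> compression_modulus m1 m2 f s"
        by (rule compression_modulus_geI) (use t that in auto)
      finally show ?thesis .
    qed
    then show "\<forall>\<^sub>F s in at_top. ennreal b < compression_modulus m1 m2 f s"
      by (auto simp: eventually_at_top_linorder)
  qed
  moreover have "expansion_modulus m1 m2 f t < \<infinity>" for t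
    using bdd[of t] expansion_modulus_finiteI by metis
  ultimately show ?thesis
    using f uc inj comp
    by (auto simp: strong_embedding_def coarse_embedding_def coarse_map_def expanding_map_def
        uniform_embedding_iff_moduli uniformly_continuous_map_iff_modulus)
qed

text \<open>Averaging over translations and then over segments turns a lower bound at one distance into lower bounds at all
positive distances, which is what the construction of the embedding asks for.\<close>

lemma strongly_embeds_of_negtype:
  fixes Q :: "'a::banach \<Rightarrow> 'a \<Rightarrow> real" and D :: "'a set"
  assumes p: "1 \<le> p" "p \<le> 2"
    and Q: "negtype_on UNIV Q" "\<And>x y. Q x y \<le> w (dist x y)"
    and w: "\<And>e. 0 < e \<Longrightarrow> \<exists>b>0. \<forall>s. 0 \<le> s \<longrightarrow> s < b \<longrightarrow> w s \<le> e"
    and low: "0 < t" "0 < c" "\<And>x y. dist x y = t \<Longrightarrow> c \<le> Q x y"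
    and D: "countable D" "closure D = UNIV"
  shows "strongly_embeds (euclidean_metric :: 'a metric) (lp_metric p)"
proof -
  obtain q :: "'a \<Rightarrow> real" where q: "negtype_on UNIV (\<lambda>x y. q (x - y))" "\<And>x. q x \<le> w (norm x)"
    "\<And>x. norm x = t \<Longrightarrow> c \<le> q x"
    using translation_invariant_negtype[OF Q(1), of w t c] Q(2) low(3) unfolding dist_norm by metis
  interpret q: negtype_function q
  proof
    show "\<exists>d>0. \<forall>x. norm x < d \<longrightarrow> q x \<le> e" if e: "0 < e" for e
    proof -
      obtain b where b: "b > 0" "\<And>s. 0 \<le> s \<Longrightarrow> s < b \<Longrightarrow> w s \<le> e" using w[OF e] by blast
      have "q x \<le> e" if "norm x < b" for x using q(2)[of x] b(2)[OF norm_ge_zero that] by linarith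
      then show ?thesis using b(1) by blast
    qed
  qed (rule q(1))
  interpret a: negtype_function q.ray_avg by (rule q.negtype_function_ray_avg)
  have "D \<noteq> {}" using D(2) by auto
  then have dense: "\<exists>i. dist (from_nat_into D i) x < e" if "0 < e" for x e
    using D that by (metis UNIV_I closure_approachable from_nat_into_surj)
  have lower: "\<exists>b>0. \<forall>x. r \<le> norm x \<longrightarrow> b \<le> q.ray_avg x" if r: "0 < r" for r
    using q.ray_avg_lower[OF low(1,2) q(3) r] by metis
  obtain F S where F: "\<And>x. F x \<in> lp_carrier p"
    and FS: "\<And>x y. lp_norm p (\<lambda>n. F x n - F y n) = S x y powr (1 / p)" "\<And>x y. 0 \<le> S x y"
    and S1: "\<And>e. 0 < e \<Longrightarrow> \<exists>b>0. \<forall>x y::'a. norm (x - y) < b \<longrightarrow> S x y \<le> e"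
    and S2: "\<And>r. \<exists>B. \<forall>x y. norm (x - y) \<le> r \<longrightarrow> S x y \<le> B"
    and S3: "\<And>r. 0 < r \<Longrightarrow> \<exists>b>0. \<forall>x y. r \<le> norm (x - y) \<longrightarrow> b \<le> S x y"
    and S4: "\<And>M. \<exists>r. \<forall>x y. r \<le> norm (x - y) \<longrightarrow> M \<le> S x y"
    by (rule a.lp_map_of_negtype[OF p dense lower]) (assumption | rule that)+
  have root: "(e powr p) powr (1 / p) = e" if "0 \<le> e" for e using that p by (simp add: powr_powr)
  have mono: "a powr (1 / p) \<le> b powr (1 / p)" if "0 \<le> a" "a \<le> b" for a b :: real
    using that p by (intro powr_mono2) auto
  have "strong_embedding (euclidean_metric :: 'a metric) (lp_metric p) F"
  proof (rule strong_embeddingI)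
    show "F \<in> mspace euclidean_metric \<rightarrow> mspace (lp_metric p)" using F p by simp
    show "uniformly_continuous_map euclidean_metric (lp_metric p) F"
      unfolding uniformly_continuous_map_def
    proof (intro conjI allI impI)
      show "F \<in> mspace euclidean_metric \<rightarrow> mspace (lp_metric p)" using F p by simp
      fix e :: real assume e: "0 < e"
      obtain b where b: "b > 0" "\<And>x y::'a. norm (x - y) < b \<Longrightarrow> S x y \<le> (e / 2) powr p"
        using S1[of "(e / 2) powr p"] e by auto
      have "S x y powr (1 / p) < e" if "norm (x - y) < b" for x y
      proof -
        have "S x y powr (1 / p) \<le> ((e / 2) powr p) powr (1 / p)"
          using b(2)[OF that] FS(2) by (intro mono)
        also have "\<dots> < e" using root[of "e / 2"] e by simp
        finally show ?thesis .
      qed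
      then show "\<exists>\<delta>>0. \<forall>x\<in>mspace euclidean_metric. \<forall>y\<in>mspace euclidean_metric.
          mdist euclidean_metric y x < \<delta> \<longrightarrow> mdist (lp_metric p) (F y) (F x) < e"
        using b(1) p by (auto simp: FS dist_norm)
    qed
    fix r :: real
    obtain B where B: "\<And>x y. norm (x - y) \<le> r \<Longrightarrow> S x y \<le> B" using S2 by blast
    have "S x y powr (1 / p) \<le> B powr (1 / p)" if "norm (x - y) \<le> r" for x y
      using B[OF that] FS(2) by (intro mono)
    then show "\<exists>B. \<forall>x\<in>mspace euclidean_metric. \<forall>y\<in>mspace euclidean_metric.
        mdist euclidean_metric x y \<le> r \<longrightarrow> mdist (lp_metric p) (F x) (F y) \<le> B"
      using p by (auto simp: FS dist_norm)
  next
    fix r :: real assume r: "0 < r"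
    obtain b where b: "0 < b" "\<And>x y. r \<le> norm (x - y) \<Longrightarrow> b \<le> S x y" using S3[OF r] by blast
    have "b powr (1 / p) \<le> S x y powr (1 / p)" if "r \<le> norm (x - y)" for x y
      using b(1) b(2)[OF that] by (intro mono) auto
    moreover have "0 < b powr (1 / p)" using b(1) by simp
    ultimately show "\<exists>b>0. \<forall>x\<in>mspace euclidean_metric. \<forall>y\<in>mspace euclidean_metric.
        r \<le> mdist euclidean_metric x y \<longrightarrow> b \<le> mdist (lp_metric p) (F x) (F y)"
      using p unfolding mdist_lp_metric[OF p(1)] mdist_euclidean_metric FS dist_norm by blast
  next
    fix b :: real
    obtain r where r: "\<And>x y. r \<le> norm (x - y) \<Longrightarrow> \<bar>b\<bar> powr p \<le> S x y" using S4 by blast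
    have "b \<le> S x y powr (1 / p)" if "r \<le> norm (x - y)" for x y
      using mono[OF _ r[OF that]] root[of "\<bar>b\<bar>"] by auto
    then show "\<exists>r. \<forall>x\<in>mspace euclidean_metric. \<forall>y\<in>mspace euclidean_metric.
        r \<le> mdist euclidean_metric x y \<longrightarrow> b \<le> mdist (lp_metric p) (F x) (F y)"
      using p unfolding mdist_lp_metric[OF p(1)] mdist_euclidean_metric FS dist_norm by blast
  qed
  then show ?thesis by (auto simp: strongly_embeds_def)
qed

text \<open>The factor \<open>s\<close> makes the pulled back kernel small at distances up to 24. Solvency is used for an \<open>n\<close> so large
that on some interval of distances of length \<open>n \<ge> 4\<close> the kernel is at least 1 in spite of this factor. Both the
smoothing and the separability argument then apply.\<close>

lemma strongly_embeds_of_solvent: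
  fixes f :: "'a::banach \<Rightarrow> nat \<Rightarrow> real"
  assumes p: "1 \<le> p" "p \<le> 2"
    and coarse: "coarse_map (euclidean_metric :: 'a metric) (lp_metric p) f"
    and solvent: "solvent_map (euclidean_metric :: 'a metric) (lp_metric p) f"
  shows "strongly_embeds (euclidean_metric :: 'a metric) (lp_metric p)"
proof -
  have mem: "f x \<in> lp_carrier p" for x using coarse p by (auto simp: coarse_map_def)
  define L where "L x y = lp_norm p (\<lambda>n. f x n - f y n)" for x y
  have L0: "0 \<le> L x y" for x y by (simp add: L_def lp_norm_nonneg)
  obtain B where B: "0 \<le> B" "\<And>x y. dist x y \<le> 24 \<Longrightarrow> L x y \<le> B"
  proof -
    have "expansion_modulus (euclidean_metric :: 'a metric) (lp_metric p) f 24 < \<infinity>"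
      using coarse by (simp add: coarse_map_def)
    then show thesis using that p
      by (elim expansion_modulus_finiteD) (simp add: L_def)
  qed
  define s where "s = 1 / (24 * (B powr p + 1))"
  have s: "0 < s" "s * B powr p \<le> 1 / 24" by (simp_all add: s_def add_nonneg_pos divide_simps)
  define n where "n = max 4 (nat \<lceil>1 / s\<rceil>)"
  have n: "4 \<le> n" "1 / s \<le> real n"
    by (simp_all add: n_def) linarith
  obtain R where R: "0 < R" "\<And>x y. dist x y \<in> {R..R + real n} \<Longrightarrow> real n < L x y"
  proof -
    have "\<exists>R>0. \<forall>x y. dist x y \<in> {R..R + real n} \<longrightarrow> real n < L x y"
      using solvent p unfolding solvent_map_def by (simp add: L_def)
    then show thesis using that by blast
  qed
  have neg: "negtype_on UNIV (\<lambda>x y. s * L x y powr p)"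
    unfolding L_def using s(1) mem
    by (intro negtype_on_scale negtype_on_pullback[OF negtype_on_lp[OF p]]) auto
  have up: "s * L x y powr p \<le> 1 / 24" if "dist x y \<le> 24" for x y
  proof -
    have "s * L x y powr p \<le> s * B powr p"
      using B(2)[OF that] L0 p s(1) by (intro mult_left_mono powr_mono2) auto
    then show ?thesis using s(2) by linarith
  qed
  have low: "1 \<le> s * L x y powr p" if "\<bar>dist x y - (R + 2)\<bar> \<le> 2" for x y
  proof -
    have "dist x y \<in> {R..R + real n}" using that n(1) by (auto simp: abs_le_iff)
    then have L: "real n < L x y" by (rule R)
    then have "L x y powr 1 \<le> L x y powr p" using n(1) p by (intro powr_mono) auto
    then have "real n \<le> L x y powr p" using L n(1) by simp
    then have "1 / s \<le> L x y powr p" using n(2) by linarith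
    then show ?thesis using s(1) by (simp add: field_simps)
  qed
  obtain Q :: "'a \<Rightarrow> 'a \<Rightarrow> real" where Q: "negtype_on UNIV Q" "\<And>x y. Q x y \<le> dist x y / 24"
    "\<And>x y. dist x y = R + 2 \<Longrightarrow> 1 / 16 \<le> Q x y"
    using negtype_smoothing[OF neg up low] by blast
  have "real n \<le> lp_norm p (\<lambda>k. f x k - f y k)" if "dist x y \<in> {R..R + real n}" for x y
    using R(2)[OF that] by (simp add: L_def)
  then have "\<exists>D::'a set. countable D \<and> closure D = UNIV"
    by (intro separable_of_uncollapsed[OF p(1), of f R "real n" "real n"] mem R(1)) (use n(1) in auto)
  then obtain D :: "'a set" where D: "countable D" "closure D = UNIV" by blast
  show ?thesis
  proof (rule strongly_embeds_of_negtype[OF p Q(1), of "\<lambda>s. s / 24" "R + 2" "1 / 16"])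
    show "\<exists>b>0. \<forall>s. 0 \<le> s \<longrightarrow> s < b \<longrightarrow> s / 24 \<le> e" if "0 < e" for e :: real
      using that by (intro exI[of _ e]) auto
  qed (use Q R(1) D in auto)
qed

text \<open>The kernel inherits uniform continuity, which takes the place of smoothing. Uniform continuity also spreads the lower bound from
distance exactly \<open>t\<close> to distances slightly above \<open>t\<close>, as needed for separability: a pair at such a
distance is shortened along its segment.\<close>

lemma strongly_embeds_of_uncollapsed:
  fixes f :: "'a::banach \<Rightarrow> nat \<Rightarrow> real"
  assumes p: "1 \<le> p" "p \<le> 2"
    and uc: "uniformly_continuous_map (euclidean_metric :: 'a metric) (lp_metric p) f"
    and au: "almost_uncollapsed (euclidean_metric :: 'a metric) (lp_metric p) f"
  shows "strongly_embeds (euclidean_metric :: 'a metric) (lp_metric p)"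
proof -
  have mem: "f x \<in> lp_carrier p" for x using uc p by (auto simp: uniformly_continuous_map_def)
  define L where "L x y = lp_norm p (\<lambda>n. f x n - f y n)" for x y
  have L0: "0 \<le> L x y" for x y by (simp add: L_def lp_norm_nonneg)
  have uc: "\<exists>b>0. \<forall>x y. dist x y < b \<longrightarrow> L x y < e" if "0 < e" for e
    using uc that p unfolding uniformly_continuous_map_def L_def
    by simp (metis dist_commute)
  obtain t c where t: "0 < t" and c: "0 < c" "\<And>x y. dist x y = t \<Longrightarrow> c \<le> L x y"
  proof -
    obtain t where t: "0 < t" "0 < exact_compression_modulus (euclidean_metric :: 'a metric) (lp_metric p) f t"
      using au by (auto simp: almost_uncollapsed_def)
    obtain c where c: "0 < c" "ennreal c < exact_compression_modulus (euclidean_metric :: 'a metric) (lp_metric p) f t"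
      using ennreal_real_between[OF t(2)] by blast
    have "c \<le> L x y" if xy: "dist x y = t" for x y :: 'a
    proof -
      have "exact_compression_modulus (euclidean_metric :: 'a metric) (lp_metric p) f t \<le> ennreal (L x y)"
        unfolding exact_compression_modulus_def L_def using xy p by (intro Inf_lower) auto
      with c(2) have "ennreal c < ennreal (L x y)" by (rule less_le_trans)
      then show ?thesis by (metis ennreal_leI linear not_less)
    qed
    then show thesis using that t(1) c(1) by blast
  qed
  define Q where "Q x y = 1 - exp (- (L x y powr p))" for x y
  have "negtype_on UNIV (\<lambda>x y. L x y powr p)"
    unfolding L_def using mem by (intro negtype_on_pullback[OF negtype_on_lp[OF p]]) auto
  then have Q: "negtype_on UNIV Q" unfolding Q_def by (rule negtype_on_one_minus_exp)
  have Q1: "Q x y \<le> 1" "Q x y \<le> L x y powr p" for x y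
    using exp_ge_add_one_self[of "- (L x y powr p)"] by (auto simp: Q_def)
  define w where "w s = Sup {Q x y | x y :: 'a. dist x y \<le> s}" for s
  have bdd: "bdd_above {Q x y | x y :: 'a. dist x y \<le> s}" for s
    using Q1(1) by (auto intro!: bdd_aboveI[of _ 1])
  have Qw: "Q x y \<le> w (dist x y)" for x y
    unfolding w_def by (rule cSup_upper[OF _ bdd]) auto
  have w: "\<exists>b>0. \<forall>s. 0 \<le> s \<longrightarrow> s < b \<longrightarrow> w s \<le> e" if e: "0 < e" for e
  proof -
    obtain b where b: "b > 0" "\<And>x y. dist x y < b \<Longrightarrow> L x y < e powr (1 / p)"
      using uc[of "e powr (1 / p)"] e by auto
    have "w s \<le> e" if s: "0 \<le> s" "s < b" for s
      unfolding w_def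
    proof (rule cSup_least)
      have "Q 0 0 \<in> {Q x y | x y :: 'a. dist x y \<le> s}" using s by force
      then show "{Q x y | x y :: 'a. dist x y \<le> s} \<noteq> {}" by blast
      fix z assume "z \<in> {Q x y | x y :: 'a. dist x y \<le> s}"
      then obtain x y where z: "z = Q x y" "dist x y \<le> s" by blast
      then have "L x y powr p \<le> (e powr (1 / p)) powr p"
        using b(2)[of x y] s L0 p by (intro powr_mono2) auto
      also have "\<dots> = e" using e p by (simp add: powr_powr)
      finally show "z \<le> e" using Q1(2)[of x y] z by linarith
    qed
    then show ?thesis using b(1) by blast
  qed
  have lowQ: "1 - exp (- (c powr p)) \<le> Q x y" if "dist x y = t" for x y
  proof -
    have "c powr p \<le> L x y powr p" using c(1) c(2)[OF that] p by (intro powr_mono2) auto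
    then show ?thesis by (simp add: Q_def)
  qed
  obtain b where b: "b > 0" "\<And>x y. dist x y < b \<Longrightarrow> L x y < c / 2" using uc[of "c / 2"] c(1) by auto
  have "c / 2 \<le> lp_norm p (\<lambda>n. f x n - f y n)" if xy: "dist x y \<in> {t..t + b / 2}" for x y
  proof -
    define d where "d = dist x y"
    have d: "t \<le> d" "d \<le> t + b / 2" "0 < d" using xy t by (auto simp: d_def)
    define z where "z = x + (t / d) *\<^sub>R (y - x)"
    have "dist x z = \<bar>t / d\<bar> * d" by (simp add: z_def dist_norm d_def norm_minus_commute)
    then have "dist x z = t" using d t by simp
    then have "c \<le> L x z" by (rule c)
    have "y - z = (1 - t / d) *\<^sub>R (y - x)" by (simp add: z_def algebra_simps)
    then have "dist z y = \<bar>1 - t / d\<bar> * d" by (simp add: dist_norm d_def norm_minus_commute)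
    also have "\<dots> = d - t" using d t by (simp add: abs_if field_simps)
    finally have "L z y < c / 2" using d b(1) by (intro b) linarith
    moreover have "L x z \<le> L x y + L y z"
      using Metric_space.triangle[OF Metric_space_lp[OF p(1)] mem mem mem] by (simp add: L_def)
    moreover have "L y z = L z y"
      using Metric_space.commute[OF Metric_space_lp[OF p(1)]] by (simp add: L_def)
    ultimately show ?thesis using \<open>c \<le> L x z\<close> by (simp add: L_def)
  qed
  then have "\<exists>D::'a set. countable D \<and> closure D = UNIV"
    by (intro separable_of_uncollapsed[OF p(1), of f t "b / 2" "c / 2"] mem t) (use b(1) c(1) in auto)
  then obtain D :: "'a set" where D: "countable D" "closure D = UNIV" by blast
  show ?thesis
    by (rule strongly_embeds_of_negtype[OF p Q Qw w t _ lowQ D]) (use c in auto)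
qed

lemma solvent_of_expanding:
  assumes "expanding_map m1 m2 f"
  shows "solvent_map m1 m2 f"
  unfolding solvent_map_def
proof (intro conjI allI)
  show "f \<in> mspace m1 \<rightarrow> mspace m2" using assms by (simp add: expanding_map_def)
  fix n :: nat
  have "(compression_modulus m1 m2 f \<longlongrightarrow> top) at_top" using assms by (simp add: expanding_map_def)
  then have "\<forall>\<^sub>F t in at_top. ennreal (real n) < compression_modulus m1 m2 f t"
    by (intro order_tendstoD) (auto simp: less_top[symmetric])
  then obtain R where R: "\<And>t. R \<le> t \<Longrightarrow> ennreal (real n) < compression_modulus m1 m2 f t"
    by (auto simp: eventually_at_top_linorder)
  show "\<exists>R>0. \<forall>x\<in>mspace m1. \<forall>y\<in>mspace m1. mdist m1 x y \<in> {R..R + real n} \<longrightarrow> real n < mdist m2 (f x) (f y)"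
    using compression_modulus_lessD[OF R[of "max 1 R"]] by (intro exI[of _ "max 1 R"]) auto
qed

lemma almost_uncollapsed_of_uniform_embedding:
  assumes "uniform_embedding m1 m2 f"
  shows "almost_uncollapsed m1 m2 f"
proof -
  have f: "f \<in> mspace m1 \<rightarrow> mspace m2" "0 < compression_modulus m1 m2 f 1"
    using assms by (auto simp: uniform_embedding_iff_moduli)
  have "compression_modulus m1 m2 f 1 \<le> exact_compression_modulus m1 m2 f 1"
    unfolding compression_modulus_def exact_compression_modulus_def
    by (rule Inf_superset_mono) force
  with f show ?thesis by (auto simp: almost_uncollapsed_def intro!: exI[of _ 1])
qed

theorem theorem1p6:
  fixes X :: "'a::banach metric" and Y :: "(nat \<Rightarrow> real) metric" and p :: real
  assumes X: "X = euclidean_metric"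
    and p: "1 \<le> p" "p \<le> 2"
    and Y: "Y = lp_metric p"
  shows "(coarsely_embeds X Y \<longleftrightarrow> uniformly_embeds X Y) \<and>
    (uniformly_embeds X Y \<longleftrightarrow> strongly_embeds X Y) \<and>
    (strongly_embeds X Y \<longleftrightarrow> (\<exists>f. coarse_map X Y f \<and> solvent_map X Y f)) \<and>
    ((\<exists>f. coarse_map X Y f \<and> solvent_map X Y f) \<longleftrightarrow>
      (\<exists>f. uniformly_continuous_map X Y f \<and> almost_uncollapsed X Y f))"
proof -
  have "strongly_embeds X Y \<Longrightarrow> coarsely_embeds X Y" "strongly_embeds X Y \<Longrightarrow> uniformly_embeds X Y"
    by (auto simp: strongly_embeds_def strong_embedding_def coarsely_embeds_def uniformly_embeds_def)
  moreover have "coarsely_embeds X Y \<Longrightarrow> \<exists>f. coarse_map X Y f \<and> solvent_map X Y f"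
    using solvent_of_expanding by (auto simp: coarsely_embeds_def coarse_embedding_def)
  moreover have "uniformly_embeds X Y \<Longrightarrow> \<exists>f. uniformly_continuous_map X Y f \<and> almost_uncollapsed X Y f"
    using almost_uncollapsed_of_uniform_embedding by (auto simp: uniformly_embeds_def uniform_embedding_def)
  moreover have "\<exists>f. coarse_map X Y f \<and> solvent_map X Y f \<Longrightarrow> strongly_embeds X Y"
    unfolding X Y using strongly_embeds_of_solvent[OF p] by blast
  moreover have "\<exists>f. uniformly_continuous_map X Y f \<and> almost_uncollapsed X Y f \<Longrightarrow> strongly_embeds X Y"
    unfolding X Y using strongly_embeds_of_uncollapsed[OF p] by blast
  ultimately show ?thesis by blast
qed

end
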